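(* Let $J$ be a $q$-periodic block Jacobi matrix on $\ell^2(\mathbb{Z})^m$, let $X$ be the position operator, and let $X(t)=e^{itJ}Xe^{-itJ}$. (a) There is a bounded self-adjoint operator $Q$ with $\operatorname{Ker}Q=\{0\}$ such that for every $\psi\in D(X)$, $$\lim_{t\to\infty}\frac1tX(t)\psi=Q\psi.$$ (b) If $f:\mathbb{R}\to\mathbb{R}$ is a bounded continuous function, then for every $\psi\in\ell^2(\mathbb{Z})^m$, $$\lim_{t\to\infty}f\Big(\frac1tX(t)\Big)\psi=f(Q)\psi.$$ (c) If $\psi\in\ell^2(\mathbb{Z})^m\setminus\{0\}$ decays exponentially, then for every $p>0$, $\beta^+_\psi(p)=\beta^-_\psi(p)=1$.
   Context: A block Jacobi matrix is an operator $J:\ell^2(\mathbb{Z})^m\to\ell^2(\mathbb{Z})^m$ (elements viewed as $\ell^2$ sequences $u=(u_n)_{n\in\mathbb{Z}}$, $u_n\in\mathbb{C}^m$) of the form $(Ju)_n=a_{n-1}^*u_{n-1}+b_nu_n+a_nu_{n+1}$, with $a_n,b_n$ complex $m\times m$ matrices, $\det a_n\ne0$, $b_n^*=b_n$. It is $q$-periodic if $a_{n+q}=a_n$, $b_{n+q}=b_n$ for all $n$. The position operator is $(Xu)_n=nu_n$ with domain $D(X)=\{u:\sum_n|nu_n|^2<\infty\}$; $X(t)=e^{itJ}Xe^{-itJ}$ has domain $D(X(t))=\{u:e^{-itJ}u\in D(X)\}$ (which equals $D(X)$ for all $t$). A vector $\psi$ decays exponentially if $|\psi_n|\le Ke^{-c|n|}$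 for all $n$ for some $K,c>0$. With $\psi(t)=e^{-itJ}\psi$, the transport exponents are $$\beta^+_\psi(p)=\limsup_{t\to\infty}\frac{\log\langle\psi(t),|X|^p\psi(t)\rangle}{p\log t},\qquad\beta^-_\psi(p)=\liminf_{t\to\infty}\frac{\log\langle\psi(t),|X|^p\psi(t)\rangle}{p\log t}.$$ *)

theory Defs
  imports "HOL-Analysis.Analysis"
begin

section \<open>The Hilbert space of square-summable two-sided sequences of vectors\<close>

typedef 'm l2 = "{u :: int \<Rightarrow> complex ^ 'm::finite. (\<lambda>n. (norm (u n))\<^sup>2) summable_on UNIV}"
  morphisms l2_nth Abs_l2
  by (rule exI[of _ "\<lambda>_. 0"]) simp

setup_lifting type_definition_l2

lemma l2_summable: "(\<lambda>n. (norm (l2_nth u n))\<^sup>2) summable_on UNIV"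
  using l2_nth[of u] by simp

lemma summable_on_le:
  fixes f g :: "'a \<Rightarrow> real"
  assumes "g summable_on A" "\<And>x. x \<in> A \<Longrightarrow> \<bar>f x\<bar> \<le> g x"
  shows "f summable_on A"
proof -
  have "(\<lambda>x. norm (g x)) summable_on A"
    using assms(1) summable_on_iff_abs_summable_on_real by auto
  then have "(\<lambda>x. norm (f x)) summable_on A"
    by (rule Infinite_Sum.abs_summable_on_comparison_test) (use assms(2) in force)
  then show ?thesis
    using summable_on_iff_abs_summable_on_real by auto
qed

lemma norm_add_sq_le: "(norm (x + y))\<^sup>2 \<le> 2 * (norm x)\<^sup>2 + 2 * (norm y)\<^sup>2"
  for x y :: "'a::real_normed_vector"
proof -
  have "(norm (x + y))\<^sup>2 \<le> (norm x + norm y)\<^sup>2"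
    by (intro power_mono norm_triangle_ineq norm_ge_zero)
  also have "\<dots> \<le> 2 * (norm x)\<^sup>2 + 2 * (norm y)\<^sup>2"
    using sum_squares_bound[of "norm x" "norm y"] by (simp add: power2_sum)
  finally show ?thesis .
qed

lemma square_summable_add:
  fixes f g :: "'a \<Rightarrow> 'b::real_normed_vector"
  assumes "(\<lambda>n. (norm (f n))\<^sup>2) summable_on A" "(\<lambda>n. (norm (g n))\<^sup>2) summable_on A"
  shows "(\<lambda>n. (norm (f n + g n))\<^sup>2) summable_on A"
  by (rule summable_on_le[of "\<lambda>n. 2 * (norm (f n))\<^sup>2 + 2 * (norm (g n))\<^sup>2"])
     (auto intro!: summable_on_add summable_on_cmult_right assms norm_add_sq_le)

lemma norm_vector_scalar_mult: "norm (c *s x) = cmod c * norm x" for x :: "complex ^ 'n::finite"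
  by (simp add: norm_vec_def norm_mult L2_set_right_distrib)

lift_definition cscale :: "complex \<Rightarrow> 'm::finite l2 \<Rightarrow> 'm l2" is "\<lambda>c u n. c *s u n"
  by (simp add: norm_vector_scalar_mult power_mult_distrib summable_on_cmult_right)

instantiation l2 :: (finite) real_vector
begin

lift_definition zero_l2 :: "'a l2" is "\<lambda>_. 0" by simp

lift_definition plus_l2 :: "'a l2 \<Rightarrow> 'a l2 \<Rightarrow> 'a l2" is "\<lambda>u v n. u n + v n"
  by (simp add: square_summable_add)

lift_definition uminus_l2 :: "'a l2 \<Rightarrow> 'a l2" is "\<lambda>u n. - u n" by simp

lift_definition minus_l2 :: "'a l2 \<Rightarrow> 'a l2 \<Rightarrow> 'a l2" is "\<lambda>u v n. u n - v n"
  by (simp only: diff_conv_add_uminus mem_Collect_eq) (rule square_summable_add; simp)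

lift_definition scaleR_l2 :: "real \<Rightarrow> 'a l2 \<Rightarrow> 'a l2" is "\<lambda>r u n. r *\<^sub>R u n"
  by (simp add: power_mult_distrib summable_on_cmult_right)

instance
  by standard (transfer; simp add: algebra_simps scaleR_add_left scaleR_add_right)+

end

lemma inner_summable: "(\<lambda>n. l2_nth u n \<bullet> l2_nth v n) summable_on UNIV"
proof (rule summable_on_le[of "\<lambda>n. (norm (l2_nth u n))\<^sup>2 + (norm (l2_nth v n))\<^sup>2"])
  fix n
  have "\<bar>l2_nth u n \<bullet> l2_nth v n\<bar> \<le> norm (l2_nth u n) * norm (l2_nth v n)"
    by (rule Cauchy_Schwarz_ineq2)
  also have "\<dots> \<le> 2 * norm (l2_nth u n) * norm (l2_nth v n)" by simp
  also have "\<dots> \<le> (norm (l2_nth u n))\<^sup>2 + (norm (l2_nth v n))\<^sup>2" by (rule sum_squares_bound)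
  finally show "\<bar>l2_nth u n \<bullet> l2_nth v n\<bar> \<le> (norm (l2_nth u n))\<^sup>2 + (norm (l2_nth v n))\<^sup>2" .
qed (intro summable_on_add l2_summable)

text \<open>
  The real inner product below is the real part of the complex one (see \<open>Re_cinner\<close>), so both
  induce the same norm.
\<close>

instantiation l2 :: (finite) real_inner
begin

definition inner_l2 :: "'a l2 \<Rightarrow> 'a l2 \<Rightarrow> real" where
  "inner_l2 u v = (\<Sum>\<^sub>\<infinity>n. l2_nth u n \<bullet> l2_nth v n)"

definition norm_l2 :: "'a l2 \<Rightarrow> real" where
  "norm_l2 u = sqrt (inner u u)"

definition sgn_l2 :: "'a l2 \<Rightarrow> 'a l2" where
  "sgn_l2 u = u /\<^sub>R norm u"

definition dist_l2 :: "'a l2 \<Rightarrow> 'a l2 \<Rightarrow> real" where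
  "dist_l2 u v = norm (u - v)"

definition uniformity_l2 :: "('a l2 \<times> 'a l2) filter" where
  "uniformity_l2 = (INF e\<in>{0 <..}. principal {(x, y). dist x y < e})"

definition open_l2 :: "'a l2 set \<Rightarrow> bool" where
  "open_l2 U \<longleftrightarrow> (\<forall>x\<in>U. eventually (\<lambda>(x', y). x' = x \<longrightarrow> y \<in> U) uniformity)"

instance
proof
  fix u v w :: "'a l2" and r :: real
  show "inner u v = inner v u"
    by (simp add: inner_l2_def inner_commute)
  show "inner (u + v) w = inner u w + inner v w"
    by (simp add: inner_l2_def plus_l2.rep_eq inner_add_left infsum_add inner_summable)
  show "inner (r *\<^sub>R u) v = r * inner u v"
    by (simp add: inner_l2_def scaleR_l2.rep_eq infsum_cmult_right')
  show "0 \<le> inner u u"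
    by (simp add: inner_l2_def infsum_nonneg)
  show "inner u u = 0 \<longleftrightarrow> u = 0"
  proof
    assume 0: "inner u u = 0"
    have "l2_nth u n \<bullet> l2_nth u n = 0" for n
      by (rule nonneg_infsum_le_0D[where A = UNIV and f = "\<lambda>n. l2_nth u n \<bullet> l2_nth u n"])
         (use 0 in \<open>auto simp: inner_l2_def intro: inner_summable\<close>)
    then have "l2_nth u = l2_nth 0"
      by (auto simp: zero_l2.rep_eq)
    then show "u = 0" by (simp add: l2_nth_inject)
  qed (simp add: inner_l2_def zero_l2.rep_eq)
qed (simp_all add: norm_l2_def sgn_l2_def dist_l2_def uniformity_l2_def open_l2_def)

end

definition cinner :: "'m::finite l2 \<Rightarrow> 'm l2 \<Rightarrow> complex" where
  "cinner u v = (\<Sum>\<^sub>\<infinity>n. \<Sum>i\<in>UNIV. cnj (l2_nth u n $ i) * l2_nth v n $ i)"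

lemma cinner_summable:
  "(\<lambda>n. \<Sum>i\<in>UNIV. cnj (l2_nth u n $ i) * l2_nth v n $ i) summable_on UNIV"
proof -
  let ?f = "\<lambda>n. \<Sum>i\<in>UNIV. cnj (l2_nth u n $ i) * l2_nth v n $ i"
  have Re: "Re (?f n) = l2_nth u n \<bullet> l2_nth v n" for n
    by (simp add: inner_vec_def inner_complex_def)
  have Im: "Im (?f n) = l2_nth (cscale \<i> u) n \<bullet> l2_nth v n" for n
    by (simp add: cscale.rep_eq inner_vec_def inner_complex_def algebra_simps)
  have "(\<lambda>n. complex_of_real (Re (?f n)) + \<i> * complex_of_real (Im (?f n))) summable_on UNIV"
    unfolding Re Im
    by (intro summable_on_add summable_on_cmult_right summable_on_of_real inner_summable)
  then show ?thesis
    by (simp only: complex_eq[symmetric])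
qed

lemma Re_cinner: "Re (cinner u v) = inner u v"
  unfolding cinner_def inner_l2_def infsum_Re[OF cinner_summable, symmetric]
  by (simp add: inner_vec_def inner_complex_def)


section \<open>Operators\<close>

definition bounded_operator :: "('m::finite l2 \<Rightarrow> 'm l2) \<Rightarrow> bool" where
  "bounded_operator T \<longleftrightarrow> bounded_linear T \<and> (\<forall>c u. T (cscale c u) = cscale c (T u))"

definition bounded_selfadjoint :: "('m::finite l2 \<Rightarrow> 'm l2) \<Rightarrow> bool" where
  "bounded_selfadjoint T \<longleftrightarrow>
     bounded_operator T \<and> (\<forall>u v. cinner (T u) v = cinner u (T v))"

text \<open>The unitary group \<open>e\<^sup>i\<^sup>t\<^sup>A\<close> of a bounded operator \<open>A\<close>, by its norm-convergent power series.\<close>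

definition exp_i :: "('m::finite l2 \<Rightarrow> 'm l2) \<Rightarrow> real \<Rightarrow> 'm l2 \<Rightarrow> 'm l2" where
  "exp_i A t u = (\<Sum>k. cscale ((\<i> * of_real t) ^ k / fact k) ((A ^^ k) u))"


section \<open>Functional calculus for self-adjoint operators\<close>

definition projection_valued_measure :: "(real set \<Rightarrow> 'm::finite l2 \<Rightarrow> 'm l2) \<Rightarrow> bool" where
  "projection_valued_measure E \<longleftrightarrow>
     (\<forall>B\<in>sets borel. bounded_selfadjoint (E B) \<and> (\<forall>\<psi>. E B (E B \<psi>) = E B \<psi>)) \<and>
     (\<forall>\<psi>. E {} \<psi> = 0) \<and> (\<forall>\<psi>. E UNIV \<psi> = \<psi>) \<and>
     (\<forall>B\<in>sets borel. \<forall>C\<in>sets borel. \<forall>\<psi>. E (B \<inter> C) \<psi> = E B (E C \<psi>)) \<and>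
     (\<forall>B :: nat \<Rightarrow> real set. range B \<subseteq> sets borel \<longrightarrow> disjoint_family B \<longrightarrow>
        (\<forall>\<psi>. (\<lambda>k. E (B k) \<psi>) sums E (\<Union>k. B k) \<psi>))"

definition spectral_measure ::
    "(real set \<Rightarrow> 'm::finite l2 \<Rightarrow> 'm l2) \<Rightarrow> 'm l2 \<Rightarrow> real measure" where
  "spectral_measure E \<psi> =
     measure_of UNIV (sets borel) (\<lambda>B. ennreal (Re (cinner \<psi> (E B \<psi>))))"

text \<open>
  A possibly unbounded operator is given by its domain \<open>D\<close> and a map \<open>A\<close>, which is only relevant
  on \<open>D\<close>. The next definition expresses \<open>A = \<integral> \<lambda> dE(\<lambda>)\<close>, including equality of domains; by
  polarization the quadratic form determines the operator. The same remark applies to the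
  defining equation of \<open>f(A) = \<integral> f(\<lambda>) dE(\<lambda>)\<close> below it.
\<close>

definition spectral_resolution ::
    "'m::finite l2 set \<Rightarrow> ('m l2 \<Rightarrow> 'm l2) \<Rightarrow> (real set \<Rightarrow> 'm l2 \<Rightarrow> 'm l2) \<Rightarrow> bool" where
  "spectral_resolution D A E \<longleftrightarrow>
     projection_valued_measure E \<and>
     D = {\<psi>. (\<integral>\<^sup>+x. ennreal (x\<^sup>2) \<partial>spectral_measure E \<psi>) < \<infinity>} \<and>
     (\<forall>\<psi>\<in>D. cinner \<psi> (A \<psi>) = of_real (\<integral>x. x \<partial>spectral_measure E \<psi>))"

text \<open>
  Intended for self-adjoint \<open>(D, A)\<close> and bounded Borel \<open>f\<close>; the spectral theorem provides a unique
  spectral resolution, hence a unique \<open>T\<close>.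
\<close>

definition fun_calc ::
    "'m::finite l2 set \<Rightarrow> ('m l2 \<Rightarrow> 'm l2) \<Rightarrow> (real \<Rightarrow> real) \<Rightarrow> 'm l2 \<Rightarrow> 'm l2" where
  "fun_calc D A f = (THE T. bounded_operator T \<and>
     (\<exists>E. spectral_resolution D A E \<and>
          (\<forall>\<psi>. cinner \<psi> (T \<psi>) = of_real (\<integral>x. f x \<partial>spectral_measure E \<psi>))))"


section \<open>Block Jacobi matrices\<close>

definition conj_transpose :: "complex ^ 'n ^ 'm \<Rightarrow> complex ^ 'm ^ 'n" where
  "conj_transpose A = (\<chi> i j. cnj (A $ j $ i))"

definition block_jacobi_coeffs ::
    "(int \<Rightarrow> complex ^ 'm ^ 'm::finite) \<Rightarrow> (int \<Rightarrow> complex ^ 'm ^ 'm) \<Rightarrow> bool" where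
  "block_jacobi_coeffs a b \<longleftrightarrow> (\<forall>n. det (a n) \<noteq> 0 \<and> conj_transpose (b n) = b n)"

definition periodic_coeffs ::
    "nat \<Rightarrow> (int \<Rightarrow> complex ^ 'm ^ 'm::finite) \<Rightarrow> (int \<Rightarrow> complex ^ 'm ^ 'm) \<Rightarrow> bool" where
  "periodic_coeffs q a b \<longleftrightarrow> (\<forall>n. a (n + int q) = a n \<and> b (n + int q) = b n)"

text \<open>
  \<open>Abs_l2\<close> is harmless for bounded coefficients, in particular for periodic ones; see
  \<open>l2_nth_jacobi\<close>.
\<close>

definition jacobi ::
    "(int \<Rightarrow> complex ^ 'm ^ 'm::finite) \<Rightarrow> (int \<Rightarrow> complex ^ 'm ^ 'm) \<Rightarrow> 'm l2 \<Rightarrow> 'm l2" where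
  "jacobi a b u = Abs_l2 (\<lambda>n. conj_transpose (a (n - 1)) *v l2_nth u (n - 1)
                              + b n *v l2_nth u n + a n *v l2_nth u (n + 1))"

lemma finite_range_periodic:
  fixes f :: "int \<Rightarrow> 'a"
  assumes "q > 0" and per: "\<And>n. f (n + int q) = f n"
  shows "finite (range f)"
proof -
  have up: "f (n + int k * int q) = f n" for n and k :: nat
  proof (induction k)
    case (Suc k)
    have "f (n + int (Suc k) * int q) = f ((n + int k * int q) + int q)"
      by (simp add: algebra_simps)
    then show ?case using Suc per by simp
  qed simp
  have "f n = f (n mod int q)" for n
  proof (cases "n div int q \<ge> 0")
    case True
    then show ?thesis
      using up[of "n mod int q" "nat (n div int q)"] by simp
  next
    case False
    then have "n mod int q = n + int (nat (- (n div int q))) * int q"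
      by (simp add: minus_div_mult_eq_mod[symmetric])
    then show ?thesis
      using up[of n "nat (- (n div int q))"] by simp
  qed
  moreover have "n mod int q \<in> {0..<int q}" for n
    using assms(1) by simp
  ultimately have "range f \<subseteq> f ` {0..<int q}"
    by (metis image_eqI image_subsetI)
  then show ?thesis
    by (rule finite_subset) simp
qed

lemma square_summable_matrix_shift:
  fixes M :: "int \<Rightarrow> complex ^ 'm ^ 'm::finite"
  assumes "finite (range M)"
  shows "(\<lambda>n. (norm (M n *v l2_nth u (n + k)))\<^sup>2) summable_on UNIV"
proof -
  have "bounded_linear (\<lambda>x. A *v x)" for A :: "complex ^ 'm ^ 'm"
    by (simp add: linear_conv_bounded_linear[symmetric])
  then have "\<exists>C>0. \<forall>x. norm (A *v x) \<le> norm x * C" for A :: "complex ^ 'm ^ 'm"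
    using bounded_linear.pos_bounded by blast
  then have "\<forall>A :: complex ^ 'm ^ 'm. \<exists>C>0. \<forall>x. norm (A *v x) \<le> norm x * C"
    by blast
  then obtain C :: "complex ^ 'm ^ 'm \<Rightarrow> real"
    where C: "\<And>A. C A > 0" "\<And>A x. norm (A *v x) \<le> norm x * C A"
    by metis
  define K where "K = Max (C ` range M)"
  have K: "C (M n) \<le> K" for n
    unfolding K_def using assms by (intro Max_ge) auto
  have bd: "norm (M n *v x) \<le> norm x * K" for n x
    using C(2)[of "M n" x] mult_left_mono[OF K[of n] norm_ge_zero[of x]] by linarith
  have "bij_betw (\<lambda>n. n + k) UNIV UNIV"
    by (rule bij_betwI[where g = "\<lambda>n. n - k"]) auto
  then have "(\<lambda>n. (norm (l2_nth u (n + k)))\<^sup>2) summable_on UNIV"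
    using summable_on_reindex_bij_betw[where f = "\<lambda>n. (norm (l2_nth u n))\<^sup>2"] l2_summable by blast
  then have "(\<lambda>n. K\<^sup>2 * (norm (l2_nth u (n + k)))\<^sup>2) summable_on UNIV"
    by (rule summable_on_cmult_right)
  then show ?thesis
  proof (rule summable_on_le)
    fix n
    have "(norm (M n *v l2_nth u (n + k)))\<^sup>2 \<le> (norm (l2_nth u (n + k)) * K)\<^sup>2"
      by (intro power_mono bd norm_ge_zero)
    then show "\<bar>(norm (M n *v l2_nth u (n + k)))\<^sup>2\<bar> \<le> K\<^sup>2 * (norm (l2_nth u (n + k)))\<^sup>2"
      by (simp add: power_mult_distrib mult.commute)
  qed
qed

lemma l2_nth_jacobi:
  assumes "q > 0" "periodic_coeffs q a b"
  shows "l2_nth (jacobi a b u) n = conj_transpose (a (n - 1)) *v l2_nth u (n - 1)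
           + b n *v l2_nth u n + a n *v l2_nth u (n + 1)"
proof -
  have fa: "finite (range a)" and fb: "finite (range b)"
    using assms by (auto intro!: finite_range_periodic simp: periodic_coeffs_def)
  have "range (\<lambda>n. conj_transpose (a (n - 1))) \<subseteq> conj_transpose ` range a"
    by auto
  then have fc: "finite (range (\<lambda>n. conj_transpose (a (n - 1))))"
    by (rule finite_subset) (use fa in simp)
  show ?thesis
    unfolding jacobi_def
    using square_summable_matrix_shift[OF fc, of u "-1"]
      square_summable_matrix_shift[OF fb, of u 0] square_summable_matrix_shift[OF fa, of u 1]
    by (subst Abs_l2_inverse) (auto intro!: square_summable_add)
qed


section \<open>Position operator, Heisenberg evolution and transport exponents\<close>

text \<open>\<open>pos_op\<close>, \<open>heis_op\<close> and \<open>abs_pos_pow\<close> are only meaningful on the respective domains.\<close>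

definition pos_dom :: "'m::finite l2 set" where
  "pos_dom = {u. (\<lambda>n. (norm (of_int n *\<^sub>R l2_nth u n))\<^sup>2) summable_on UNIV}"

definition pos_op :: "'m::finite l2 \<Rightarrow> 'm l2" where
  "pos_op u = Abs_l2 (\<lambda>n. of_int n *\<^sub>R l2_nth u n)"

definition heis_dom :: "('m::finite l2 \<Rightarrow> 'm l2) \<Rightarrow> real \<Rightarrow> 'm l2 set" where
  "heis_dom J t = {u. exp_i J (- t) u \<in> pos_dom}"

definition heis_op :: "('m::finite l2 \<Rightarrow> 'm l2) \<Rightarrow> real \<Rightarrow> 'm l2 \<Rightarrow> 'm l2" where
  "heis_op J t u = exp_i J t (pos_op (exp_i J (- t) u))"

definition exp_decaying :: "'m::finite l2 \<Rightarrow> bool" where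
  "exp_decaying \<psi> \<longleftrightarrow>
     (\<exists>K>0. \<exists>c>0. \<forall>n. norm (l2_nth \<psi> n) \<le> K * exp (- c * \<bar>of_int n\<bar>))"

text \<open>\<open>\<bar>X\<bar>\<^sup>p\<close>, with domain the \<open>u\<close> for which the sequence on the right is square-summable.\<close>

definition abs_pos_pow :: "real \<Rightarrow> 'm::finite l2 \<Rightarrow> 'm l2" where
  "abs_pos_pow p u = Abs_l2 (\<lambda>n. (\<bar>of_int n\<bar> powr p) *\<^sub>R l2_nth u n)"

definition moment :: "('m::finite l2 \<Rightarrow> 'm l2) \<Rightarrow> real \<Rightarrow> 'm l2 \<Rightarrow> real \<Rightarrow> real" where
  "moment J p \<psi> t = Re (cinner (exp_i J (- t) \<psi>) (abs_pos_pow p (exp_i J (- t) \<psi>)))"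

definition beta_upper :: "('m::finite l2 \<Rightarrow> 'm l2) \<Rightarrow> 'm l2 \<Rightarrow> real \<Rightarrow> ereal" where
  "beta_upper J \<psi> p = Limsup at_top (\<lambda>t. ereal (ln (moment J p \<psi> t) / (p * ln t)))"

definition beta_lower :: "('m::finite l2 \<Rightarrow> 'm l2) \<Rightarrow> 'm l2 \<Rightarrow> real \<Rightarrow> ereal" where
  "beta_lower J \<psi> p = Liminf at_top (\<lambda>t. ereal (ln (moment J p \<psi> t) / (p * ln t)))"

end

theory Submission
  imports Defs "HOL-Probability.Probability" "HOL-Computational_Algebra.Fundamental_Theorem_Algebra" "HOL-Real_Asymp.Real_Asymp"
begin

text \<open>
  No Bloch decomposition is used; the whole argument takes place in position space.

  Let \<open>U\<^sub>t\<close> be the unitary group generated by \<open>J\<close> and \<open>A = i[J, X]\<close>, a bounded periodic operator. On \<open>D(X)\<close>,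
  \<open>X(t) - X\<close> is the integral of \<open>U\<^sub>s A U\<^sub>-\<^sub>s\<close> over \<open>[0, t]\<close>, so (a) is a mean ergodic theorem for the conjugation
  action. Measure a periodic operator by its Hilbert--Schmidt norm per unit cell: this norm is invariant under
  adjoints, hence under conjugation by \<open>U\<^sub>t\<close>, and von Neumann's convexity argument gives convergence of the
  averages on the unit vectors, and then everywhere by density.

  The kernel of \<open>Q\<close> is trivial for the following reason. Let \<open>S\<close> be the shift by one period. Dimension counting
  yields a polynomial \<open>p \<noteq> 0\<close> with \<open>p(S, J) = 0\<close>. Averaging \<open>[X, p(S, J)]\<close> over the evolution shows
  \<open>(\<partial>\<^sub>S p)(S, J) \<psi> = 0\<close> whenever \<open>Q \<psi> = 0\<close>. Descending in the \<open>S\<close>-degree one arrives at \<open>D(J) \<psi> = 0\<close> for some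
  one-variable \<open>D \<noteq> 0\<close>, which forces \<open>\<psi> = 0\<close> because \<open>J\<close> has no eigenvalues.

  For (b), strong convergence on \<open>D(X)\<close> gives convergence of resolvents at points far from the real axis. The
  Stone--Weierstrass theorem on the circle traced by \<open>x \<mapsto> 1 / (x - iM)\<close> and tightness of the distributions of
  \<open>X(t)/t\<close> extend this to all bounded continuous \<open>f\<close>; the spectral measures of \<open>Q\<close> are the weak limits of these
  distributions.

  For (c), \<open>U\<^sub>t\<close> spreads exponentially decaying vectors at most linearly in time, so \<open>\<beta>\<^sup>+ \<le> 1\<close>. Since
  \<open>X(t)\<psi>/t\<close> tends to \<open>Q \<psi> \<noteq> 0\<close>, a portion of the mass that is bounded below sits at distance of order \<open>t\<close>, so
  \<open>\<beta>\<^sup>- \<ge> 1\<close>.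
\<close>

subsection \<open>The sequence space as a Hilbert space\<close>

text \<open>\<open>fun_calc\<close> is a definite description over all spectral resolutions, so (b)
  asks for more than a limit: any two resolutions of an operator, bounded or not, must have the same
  scalar measures, although a resolution prescribes only the quadratic form on the domain.
  Commutation with the projections is therefore recovered from the form, and spectral intervals are
  then separated by growth rates of iterates.

  In (a) neither standard norm suits the conjugation action: the operator norm does not come from an
  inner product, and the full Hilbert-Schmidt norm is infinite on nonzero periodic operators. Hence
  the norm per cell.

  For the kernel, a relation \<open>p(S, J) = 0\<close> may be differentiated only if it holds on
  all vectors, while the differentiated relation is known only on \<open>Ker Q\<close>. Descent on
  one polynomial would stall after a single step. Two minimal polynomials are compared instead, a
  global one and one for a kernel vector; polynomials in \<open>S\<close> and \<open>J\<close> are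
  normal operators, which rules out repeated factors in the global one and closes the gap.\<close>

lemma norm_l2_sq: "(norm u)\<^sup>2 = (\<Sum>\<^sub>\<infinity>n. (norm (l2_nth u n))\<^sup>2)"
proof -
  have "(norm u)\<^sup>2 = inner u u" by (simp add: power2_norm_eq_inner)
  then show ?thesis by (simp add: inner_l2_def power2_norm_eq_inner)
qed

lemma l2_eqI: "(\<And>n. l2_nth u n = l2_nth v n) \<Longrightarrow> u = v"
  by (metis ext l2_nth_inject)

lemma norm_l2_nth_le: "norm (l2_nth u n) \<le> norm u"
proof -
  have "(\<Sum>\<^sub>\<infinity>k\<in>{n}. (norm (l2_nth u k))\<^sup>2) \<le> (\<Sum>\<^sub>\<infinity>k. (norm (l2_nth u k))\<^sup>2)"
    by (rule infsum_mono_neutral) (auto intro: l2_summable)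
  then have "(norm (l2_nth u n))\<^sup>2 \<le> (norm u)\<^sup>2" by (simp add: norm_l2_sq)
  then show ?thesis by (simp add: power2_le_iff_abs_le)
qed

lemma sum_norm_l2_le: "finite F \<Longrightarrow> (\<Sum>n\<in>F. (norm (l2_nth u n))\<^sup>2) \<le> (norm u)\<^sup>2"
  unfolding norm_l2_sq by (rule finite_sum_le_infsum) (auto intro: l2_summable)

lemma l2I:
  assumes "\<And>F. finite F \<Longrightarrow> (\<Sum>n\<in>F. (norm (u n :: complex ^ 'm::finite))\<^sup>2) \<le> B"
  shows "u \<in> {u :: int \<Rightarrow> complex ^ 'm. (\<lambda>n. (norm (u n))\<^sup>2) summable_on UNIV}"
proof -
  have "bdd_above (sum (\<lambda>n. (norm (u n))\<^sup>2) ` {F. finite F})"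
    using assms by (auto intro!: bdd_aboveI2)
  then show ?thesis
    by (auto intro!: nonneg_bdd_above_summable_on)
qed

lemma norm_l2_leI:
  assumes "\<And>F. finite F \<Longrightarrow> (\<Sum>n\<in>F. (norm (l2_nth u n))\<^sup>2) \<le> B\<^sup>2" "B \<ge> 0"
  shows "norm u \<le> B"
proof -
  have "(norm u)\<^sup>2 \<le> B\<^sup>2"
    unfolding norm_l2_sq by (rule infsum_le_finite_sums[OF l2_summable]) (rule assms(1))
  then show ?thesis using assms(2) by (rule power2_le_imp_le)
qed

lemma bounded_linear_l2_nth: "bounded_linear (\<lambda>u. l2_nth u n)"
  by (rule bounded_linear_intro[of _ 1])
     (auto simp: plus_l2.rep_eq scaleR_l2.rep_eq norm_l2_nth_le)

text \<open>A Cauchy sequence converges in each coordinate. Cauchy bounds pass to the limit on every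
  finite set of indices, uniformly in that set, and this gives both membership of the limit and
  convergence in norm.\<close>

instance l2 :: (finite) complete_space
proof
  fix X :: "nat \<Rightarrow> 'a l2"
  assume C: "Cauchy X"
  have C1: "Cauchy (\<lambda>k. l2_nth (X k) n)" for n
    using bounded_linear.Cauchy[OF bounded_linear_l2_nth C] .
  define x where "x n = lim (\<lambda>k. l2_nth (X k) n)" for n
  have x: "(\<lambda>k. l2_nth (X k) n) \<longlonglongrightarrow> x n" for n
    unfolding x_def using C1[of n] Cauchy_convergent convergent_LIMSEQ_iff by blast
  have bd: "(\<Sum>n\<in>F. (norm (l2_nth (X N) n - x n))\<^sup>2) \<le> e\<^sup>2"
    if "\<And>k. k \<ge> N \<Longrightarrow> norm (X N - X k) \<le> e" "finite F" for N e F
  proof (rule tendsto_upperbound)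
    show "(\<lambda>k. \<Sum>n\<in>F. (norm (l2_nth (X N) n - l2_nth (X k) n))\<^sup>2) \<longlonglongrightarrow> (\<Sum>n\<in>F. (norm (l2_nth (X N) n - x n))\<^sup>2)"
      by (intro tendsto_intros x)
    show "\<forall>\<^sub>F k in sequentially. (\<Sum>n\<in>F. (norm (l2_nth (X N) n - l2_nth (X k) n))\<^sup>2) \<le> e\<^sup>2"
      unfolding eventually_sequentially
    proof (intro exI[of _ N] allI impI)
      fix k assume "k \<ge> N"
      have "(\<Sum>n\<in>F. (norm (l2_nth (X N - X k) n))\<^sup>2) \<le> (norm (X N - X k))\<^sup>2"
        by (rule sum_norm_l2_le) fact
      also have "\<dots> \<le> e\<^sup>2" using that(1)[OF \<open>k \<ge> N\<close>] by (intro power_mono) auto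
      finally show "(\<Sum>n\<in>F. (norm (l2_nth (X N) n - l2_nth (X k) n))\<^sup>2) \<le> e\<^sup>2"
        by (simp add: minus_l2.rep_eq)
    qed
  qed simp
  have ev: "\<exists>N. \<forall>m\<ge>N. \<forall>k\<ge>N. norm (X m - X k) < e" if "e > 0" for e
    using C that unfolding Cauchy_def dist_norm by blast
  obtain N1 where N1: "\<forall>m\<ge>N1. \<forall>k\<ge>N1. norm (X m - X k) < 1" using ev[of 1] by auto
  \<comment> \<open>The coordinatewise limit is square-summable because it differs from
    \<open>X N1\<close> by a square-summable sequence.\<close>
  have "(\<lambda>n. l2_nth (X N1) n - x n) \<in> {u. (\<lambda>n. (norm (u n))\<^sup>2) summable_on UNIV}"
    by (rule l2I[of _ "1\<^sup>2"], rule bd) (use N1 less_imp_le in auto)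
  then have "(\<lambda>n. (norm (l2_nth (X N1) n + - (l2_nth (X N1) n - x n)))\<^sup>2) summable_on UNIV"
    by (intro square_summable_add l2_summable) (auto simp: norm_minus_commute)
  then have xin: "l2_nth (Abs_l2 x) = x"
    by (subst Abs_l2_inverse) auto
  have "X \<longlonglongrightarrow> Abs_l2 x"
  proof (rule LIMSEQ_I)
    fix r :: real assume "r > 0"
    then obtain N where N: "\<forall>m\<ge>N. \<forall>k\<ge>N. norm (X m - X k) < r / 2" using ev[of "r / 2"] by auto
    have "norm (X m - Abs_l2 x) \<le> r / 2" if "m \<ge> N" for m
    proof (rule norm_l2_leI)
      fix F :: "int set" assume "finite F"
      then show "(\<Sum>n\<in>F. (norm (l2_nth (X m - Abs_l2 x) n))\<^sup>2) \<le> (r / 2)\<^sup>2"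
        unfolding minus_l2.rep_eq xin
        by (intro bd) (use N that in \<open>meson less_imp_le order_trans\<close>)+
    qed (use \<open>r > 0\<close> in auto)
    then show "\<exists>no. \<forall>n\<ge>no. norm (X n - Abs_l2 x) < r"
      using \<open>r > 0\<close> by (intro exI[of _ N]) (smt (verit) field_sum_of_halves)
  qed
  then show "convergent X" by (auto simp: convergent_def)
qed

instance l2 :: (finite) banach ..

lemma cscale_simps [simp]:
  "cscale c (u + v) = cscale c u + cscale c v" "cscale c (u - v) = cscale c u - cscale c v"
  "cscale c 0 = 0" "cscale c (- u) = - cscale c u" "cscale c (cscale d u) = cscale (c * d) u"
  "cscale 1 u = u" "cscale 0 u = 0"
  "cscale c (r *\<^sub>R u) = r *\<^sub>R cscale c u" "cscale (of_real r) u = r *\<^sub>R u"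
  by (transfer, auto simp: vec_eq_iff algebra_simps scaleR_conv_of_real[where 'a=complex])+

lemma cscale_add_left: "cscale (c + d) u = cscale c u + cscale d u"
  by transfer (auto simp: vec_eq_iff algebra_simps)

lemma cscale_eq: "cscale c u = Re c *\<^sub>R u + Im c *\<^sub>R cscale \<i> u"
proof -
  have "cscale (of_real (Re c) + of_real (Im c) * \<i>) u = Re c *\<^sub>R u + Im c *\<^sub>R cscale \<i> u"
    by (simp only: cscale_add_left cscale_simps(9)) (simp flip: cscale_simps(5))
  then show ?thesis by (metis complex_eq mult.commute)
qed

lemma norm_cscale [simp]: "norm (cscale c u) = cmod c * norm u"
proof -
  have "(norm (cscale c u))\<^sup>2 = (cmod c * norm u)\<^sup>2"
    unfolding norm_l2_sq cscale.rep_eq norm_vector_scalar_mult power_mult_distrib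
    by (simp add: infsum_cmult_right')
  then show ?thesis by (simp add: power2_eq_iff_nonneg)
qed

lemma bounded_linear_cscale: "bounded_linear (cscale c)"
  by (rule bounded_linear_intro[of _ "cmod c"]) auto

lemma cinner_eq: "cinner u v = Complex (inner u v) (inner (cscale \<i> u) v)"
proof -
  have "Im (cinner u v) = (\<Sum>\<^sub>\<infinity>n. Im (\<Sum>i\<in>UNIV. cnj (l2_nth u n $ i) * l2_nth v n $ i))"
    unfolding cinner_def by (rule infsum_Im[symmetric, OF cinner_summable])
  also have "\<dots> = inner (cscale \<i> u) v"
    by (simp add: inner_l2_def cscale.rep_eq inner_vec_def inner_complex_def algebra_simps)
  finally show ?thesis using Re_cinner by (simp add: complex_eq_iff)
qed

lemma inner_cscale_i: "inner (cscale \<i> u) v = - inner u (cscale \<i> v)"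
  unfolding inner_l2_def cscale.rep_eq infsum_uminus[symmetric]
  by (rule infsum_cong) (simp add: inner_vec_def inner_complex_def algebra_simps sum_negf[symmetric])

text \<open>A complex scalar is \<open>Re c + \<i> * Im c\<close>, so for a real-linear map only the
  factor \<open>\<i>\<close> has to be checked.\<close>

lemma bounded_operatorI:
  assumes "bounded_linear T" "\<And>u. T (cscale \<i> u) = cscale \<i> (T u)"
  shows "bounded_operator T"
proof -
  interpret bounded_linear T by fact
  have "T (cscale c u) = cscale c (T u)" for c u
    by (subst (1 2) cscale_eq) (simp only: add scaleR assms(2))
  then show ?thesis unfolding bounded_operator_def using assms(1) by blast
qed

lemma bounded_operatorD:
  assumes "bounded_operator T"
  shows "bounded_linear T" "T (cscale c u) = cscale c (T u)"
  using assms by (auto simp: bounded_operator_def)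

text \<open>The imaginary part of \<open>cinner u v\<close> is
  \<open>inner (cscale \<i> u) v\<close>, so symmetry of the real form together with complex
  linearity gives the complex identity. Adjoints can thus be handled with the real inner
  product.\<close>

lemma bounded_selfadjointI:
  assumes "bounded_operator T" "\<And>u v. inner (T u) v = inner u (T v)"
  shows "bounded_selfadjoint T"
  unfolding bounded_selfadjoint_def cinner_eq
  using assms bounded_operatorD(2)[OF assms(1), symmetric] by auto

lemma bounded_selfadjointD:
  assumes "bounded_selfadjoint T"
  shows "bounded_operator T" "bounded_linear T" "T (cscale c u) = cscale c (T u)"
    "inner (T u) v = inner u (T v)"
  using assms bounded_operatorD[of T] unfolding bounded_selfadjoint_def cinner_eq by auto

lemma cinner_selfadjoint:
  assumes "bounded_selfadjoint T"
  shows "cinner u (T u) = of_real (inner u (T u))"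
proof -
  have "inner (cscale \<i> u) (T u) = 0"
    using bounded_selfadjointD[OF assms] inner_cscale_i[of u "T u"]
    by (smt (verit) inner_commute)
  then show ?thesis by (simp add: cinner_eq complex_eq_iff)
qed

lift_definition single :: "int \<Rightarrow> complex ^ 'm::finite \<Rightarrow> 'm l2" is "\<lambda>k x n. if n = k then x else 0"
proof -
  fix k :: int and x :: "complex ^ 'm"
  have "(\<lambda>n. (norm (if n = k then x else 0))\<^sup>2) summable_on {k} \<longleftrightarrow>
     (\<lambda>n. (norm (if n = k then x else 0))\<^sup>2) summable_on UNIV"
    by (rule summable_on_cong_neutral) auto
  then show "(\<lambda>n. (norm (if n = k then x else 0))\<^sup>2) summable_on UNIV"
    by auto
qed

lemma single_linear: "linear (single k)"
  by standard (transfer; auto)+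

lemma single_simps [simp]:
  "single k (x + y) = single k x + single k y" "single k 0 = 0" "single k (r *\<^sub>R x) = r *\<^sub>R single k x"
  "cscale c (single k x) = single k (c *s x)"
  by (transfer, auto)+

lemma inner_single: "inner (single k x) u = inner x (l2_nth u k)"
proof -
  have "inner (single k x) u = (\<Sum>\<^sub>\<infinity>n\<in>{k}. inner x (l2_nth u n))"
    unfolding inner_l2_def by (rule infsum_cong_neutral) (auto simp: single.rep_eq)
  then show ?thesis by simp
qed

lemma norm_single [simp]: "norm (single k x) = norm x"
  by (simp add: norm_eq_sqrt_inner inner_single single.rep_eq)

text \<open>Truncation to a finite set is an orthogonal projection, so the squared error is the
  total mass minus the mass in the set.\<close>

lemma sum_single_tendsto: "((\<lambda>F. \<Sum>n\<in>F. single n (l2_nth u n)) \<longlongrightarrow> u) (finite_subsets_at_top UNIV)"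
proof (rule Lim_null[THEN iffD2], rule tendsto_norm_zero_cancel)
  have nth: "l2_nth (\<Sum>n\<in>F. single n (l2_nth u n)) k = (if k \<in> F then l2_nth u k else 0)" if "finite F" for F k
    using that by (induction F rule: finite_induct) (auto simp: plus_l2.rep_eq zero_l2.rep_eq single.rep_eq)
  have eq: "(norm ((\<Sum>n\<in>F. single n (l2_nth u n)) - u))\<^sup>2 = (norm u)\<^sup>2 - (\<Sum>n\<in>F. (norm (l2_nth u n))\<^sup>2)"
    if "finite F" for F
  proof -
    define v where "v = (\<Sum>n\<in>F. single n (l2_nth u n))"
    have 1: "inner v w = (\<Sum>n\<in>F. inner (l2_nth u n) (l2_nth w n))" for w
      by (simp add: v_def inner_sum_left inner_single)
    have 2: "inner v v = (\<Sum>n\<in>F. (norm (l2_nth u n))\<^sup>2)"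
      unfolding 1 using nth[OF that] by (auto simp: v_def power2_norm_eq_inner intro!: sum.cong)
    have 3: "inner v u = (\<Sum>n\<in>F. (norm (l2_nth u n))\<^sup>2)"
      unfolding 1 by (simp add: power2_norm_eq_inner)
    show ?thesis unfolding v_def[symmetric] power2_norm_eq_inner[of "v - u"]
      by (simp add: inner_diff_left inner_diff_right 2 3 inner_commute[of u v] power2_norm_eq_inner[of u])
  qed
  have "((\<lambda>F. (norm u)\<^sup>2 - (\<Sum>n\<in>F. (norm (l2_nth u n))\<^sup>2)) \<longlongrightarrow> 0) (finite_subsets_at_top UNIV)"
    apply (rule tendsto_eq_rhs[of _ "(norm u)\<^sup>2 - (norm u)\<^sup>2"])
    unfolding norm_l2_sq using infsum_tendsto[OF l2_summable] by (intro tendsto_intros) simp_all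
  then have "((\<lambda>F. (norm ((\<Sum>n\<in>F. single n (l2_nth u n)) - u))\<^sup>2) \<longlongrightarrow> 0) (finite_subsets_at_top UNIV)"
    by (rule Lim_transform_eventually) (auto intro!: eventually_finite_subsets_at_top_weakI simp: eq)
  then have "((\<lambda>F. sqrt ((norm ((\<Sum>n\<in>F. single n (l2_nth u n)) - u))\<^sup>2)) \<longlongrightarrow> sqrt 0) (finite_subsets_at_top UNIV)"
    by (rule tendsto_real_sqrt)
  then show "((\<lambda>F. norm ((\<Sum>n\<in>F. single n (l2_nth u n)) - u)) \<longlongrightarrow> 0) (finite_subsets_at_top UNIV)"
    by simp
qed

lemma l2_dense_induct:
  assumes cl: "closed {u. P u}" and 0: "P 0" and add: "\<And>u v. P u \<Longrightarrow> P v \<Longrightarrow> P (u + v)"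
    and single: "\<And>k x. P (single k x)"
  shows "P u"
proof -
  have "P (\<Sum>n\<in>F. single n (l2_nth u n))" if "finite F" for F
    using that by (induction F rule: finite_induct) (auto intro: 0 add single)
  then have "u \<in> {u. P u}"
    by (intro Lim_in_closed_set[OF cl _ _ sum_single_tendsto[of u]] eventually_finite_subsets_at_top_weakI) auto
  then show ?thesis by simp
qed

lemma l2_approx:
  assumes "e > 0"
  obtains F where "finite F" "norm ((\<Sum>n\<in>F. single n (l2_nth u n)) - u) < e"
proof -
  have "\<forall>\<^sub>F F in finite_subsets_at_top UNIV. dist (\<Sum>n\<in>F. single n (l2_nth u n)) u < e"
    using tendstoD[OF sum_single_tendsto assms] .
  then show ?thesis using that unfolding eventually_finite_subsets_at_top dist_norm by blast
qed

subsection \<open>Banded operators\<close>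

text \<open>The entries along one diagonal, with a common bound. Hopping, potential, translations
  and multiplication by functions of position are all of this type, so boundedness, adjoints and
  commutators with position are proved once.\<close>

definition linear_family :: "(int \<Rightarrow> complex ^ 'm::finite \<Rightarrow> complex ^ 'm) \<Rightarrow> real \<Rightarrow> bool" where
  "linear_family L C \<longleftrightarrow> 0 \<le> C \<and> (\<forall>n x y. L n (x + y) = L n x + L n y) \<and>
     (\<forall>n c x. L n (c *s x) = c *s L n x) \<and> (\<forall>n x. norm (L n x) \<le> C * norm x)"

definition bandop :: "(int \<Rightarrow> complex ^ 'm::finite \<Rightarrow> complex ^ 'm) \<Rightarrow> int \<Rightarrow> 'm l2 \<Rightarrow> 'm l2" where
  "bandop L k u = Abs_l2 (\<lambda>n. L n (l2_nth u (n + k)))"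

lemma infsum_shift: "(\<Sum>\<^sub>\<infinity>n. f (n + k)) = (\<Sum>\<^sub>\<infinity>n. f n)" for k :: int
proof -
  have "bij_betw (\<lambda>n. n + k) UNIV UNIV"
    by (rule bij_betwI[where g = "\<lambda>n. n - k"]) auto
  then show ?thesis by (rule infsum_reindex_bij_betw)
qed

lemma scaleR_eq_smult: "r *\<^sub>R x = of_real r *s x" for x :: "complex ^ 'm::finite"
  by (simp add: vec_eq_iff scaleR_conv_of_real[where 'a=complex])

context
  fixes L :: "int \<Rightarrow> complex ^ 'm::finite \<Rightarrow> complex ^ 'm" and C :: real
  assumes L: "linear_family L C"
begin

lemma linear_familyD: "0 \<le> C" "L n (x + y) = L n x + L n y" "L n (c *s x) = c *s L n x"
  "norm (L n x) \<le> C * norm x" "L n (r *\<^sub>R x) = r *\<^sub>R L n x"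
  using L unfolding linear_family_def scaleR_eq_smult by auto

lemma bandop_sq: "finite F \<Longrightarrow> (\<Sum>n\<in>F. (norm (L n (l2_nth u (n + k))))\<^sup>2) \<le> (C * norm u)\<^sup>2"
proof -
  assume F: "finite F"
  have "(\<Sum>n\<in>F. (norm (L n (l2_nth u (n + k))))\<^sup>2) \<le> (\<Sum>n\<in>F. C\<^sup>2 * (norm (l2_nth u (n + k)))\<^sup>2)"
    using linear_familyD(4) by (intro sum_mono) (metis norm_ge_zero power_mono power_mult_distrib)
  also have "\<dots> = C\<^sup>2 * (\<Sum>n\<in>(\<lambda>n. n + k) ` F. (norm (l2_nth u n))\<^sup>2)"
    by (simp add: sum_distrib_left sum.reindex)
  also have "\<dots> \<le> C\<^sup>2 * (norm u)\<^sup>2"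
    using F by (intro mult_left_mono sum_norm_l2_le) auto
  finally show ?thesis by (simp add: power_mult_distrib)
qed

lemma bandop_nth: "l2_nth (bandop L k u) n = L n (l2_nth u (n + k))"
  unfolding bandop_def by (subst Abs_l2_inverse) (rule l2I, rule bandop_sq, auto)

lemma norm_bandop: "norm (bandop L k u) \<le> C * norm u"
  by (rule norm_l2_leI) (auto simp: bandop_nth linear_familyD(1) intro: bandop_sq)

lemma bandop_bounded: "bounded_operator (bandop L k)"
  by (rule bounded_operatorI, rule bounded_linear_intro[of _ C])
     (auto intro!: l2_eqI norm_bandop[THEN order_trans]
       simp: bandop_nth plus_l2.rep_eq scaleR_l2.rep_eq cscale.rep_eq linear_familyD mult.commute)

end

text \<open>Substituting \<open>n + k\<close> for \<open>n\<close> in the sum moves the entries to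
  the opposite diagonal; this is the origin of the index \<open>n - k\<close>.\<close>

lemma bandop_adjoint:
  assumes L: "linear_family L C" and L': "linear_family L' C'"
    and adj: "\<And>n x y. inner (L n x) y = inner x (L' n y)"
  shows "inner (bandop L k u) v = inner u (bandop (\<lambda>n. L' (n - k)) (- k) v)"
proof -
  have L'': "linear_family (\<lambda>n. L' (n - k)) C'"
    using L' by (simp add: linear_family_def)
  have "inner u (bandop (\<lambda>n. L' (n - k)) (- k) v) = (\<Sum>\<^sub>\<infinity>n. inner (l2_nth u n) (L' (n - k) (l2_nth v (n - k))))"
    by (simp add: inner_l2_def bandop_nth[OF L''])
  also have "\<dots> = (\<Sum>\<^sub>\<infinity>n. inner (l2_nth u (n + k)) (L' n (l2_nth v n)))"
    by (subst infsum_shift[symmetric, of _ k]) simp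
  also have "\<dots> = inner (bandop L k u) v"
    by (simp add: inner_l2_def bandop_nth[OF L] adj)
  finally show ?thesis by simp
qed

lemma pos_op_nth: "u \<in> pos_dom \<Longrightarrow> l2_nth (pos_op u) n = of_int n *\<^sub>R l2_nth u n"
  unfolding pos_op_def by (subst Abs_l2_inverse) (auto simp: pos_dom_def)

lemma pos_opI:
  assumes "\<And>n. l2_nth w n = of_int n *\<^sub>R l2_nth u n"
  shows "u \<in> pos_dom" "pos_op u = w"
proof -
  have "(\<lambda>n. (norm (of_int n *\<^sub>R l2_nth u n))\<^sup>2) summable_on UNIV"
    using l2_summable[of w] by (simp only: assms)
  then show *: "u \<in> pos_dom" by (simp add: pos_dom_def)
  show "pos_op u = w" by (rule l2_eqI) (simp only: pos_op_nth[OF *] assms)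
qed

lemma pos_op_add:
  assumes "u \<in> pos_dom" "v \<in> pos_dom"
  shows "u + v \<in> pos_dom" "pos_op (u + v) = pos_op u + pos_op v"
  by (rule pos_opI[where w = "pos_op u + pos_op v"]; use assms in \<open>simp add: plus_l2.rep_eq pos_op_nth scaleR_add_right\<close>)+

lemma pos_op_scaleR:
  assumes "u \<in> pos_dom"
  shows "r *\<^sub>R u \<in> pos_dom" "pos_op (r *\<^sub>R u) = r *\<^sub>R pos_op u"
  by (rule pos_opI[where w = "r *\<^sub>R pos_op u"]; use assms in \<open>simp add: scaleR_l2.rep_eq pos_op_nth\<close>)+

lemma pos_op_cscale:
  assumes "u \<in> pos_dom"
  shows "cscale c u \<in> pos_dom" "pos_op (cscale c u) = cscale c (pos_op u)"
  by (rule pos_opI[where w = "cscale c (pos_op u)"];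
      use assms in \<open>simp add: cscale.rep_eq pos_op_nth scaleR_eq_smult vec_eq_iff\<close>)+

lemma pos_op_single: "single k x \<in> pos_dom" "pos_op (single k x) = of_int k *\<^sub>R single k x"
  by (rule pos_opI[where w = "of_int k *\<^sub>R single k x"]; simp add: single.rep_eq scaleR_l2.rep_eq)+

lemma pos_op_zero: "0 \<in> pos_dom" "pos_op 0 = 0"
  using pos_op_single[of 0 0] by simp_all

lemma pos_op_sum:
  assumes "finite F" "\<And>k. k \<in> F \<Longrightarrow> u k \<in> pos_dom"
  shows "(\<Sum>k\<in>F. u k) \<in> pos_dom"
  using assms by (induction F rule: finite_induct) (auto intro: pos_op_zero pos_op_add)

text \<open>Diagonal \<open>k\<close> reads site \<open>n + k\<close> when writing to site
  \<open>n\<close>, and \<open>n = (n + k) - k\<close>; the commutator with position is therefore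
  bounded.\<close>

lemma pos_op_bandop:
  assumes L: "linear_family L C" and u: "u \<in> pos_dom"
  shows "bandop L k u \<in> pos_dom"
    "pos_op (bandop L k u) = bandop L k (pos_op u) - of_int k *\<^sub>R bandop L k u"
proof -
  have *: "l2_nth (bandop L k (pos_op u) - of_int k *\<^sub>R bandop L k u) n = of_int n *\<^sub>R l2_nth (bandop L k u) n" for n
    using u by (simp add: minus_l2.rep_eq scaleR_l2.rep_eq bandop_nth[OF L] pos_op_nth
        linear_familyD(2,5)[OF L] scaleR_add_left)
  show "bandop L k u \<in> pos_dom" "pos_op (bandop L k u) = bandop L k (pos_op u) - of_int k *\<^sub>R bandop L k u"
    by (rule pos_opI, rule *)+
qed

lemma pos_dom_approx:
  fixes u :: "'m::finite l2"
  assumes "e > 0" obtains v where "v \<in> pos_dom" "norm (v - u) < e"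
proof -
  obtain F where "finite F" "norm ((\<Sum>n\<in>F. single n (l2_nth u n)) - u) < e"
    using l2_approx[OF assms] by blast
  then show ?thesis using that[of "\<Sum>n\<in>F. single n (l2_nth u n)"] pos_op_sum[of F "\<lambda>n. single n (l2_nth u n)"]
      pos_op_single(1) by blast
qed

lemma inner_conj_transpose: "inner (A *v x) y = inner x (conj_transpose A *v y)"
  for A :: "complex ^ 'm ^ 'm::finite"
proof -
  have i: "inner u v = Re (\<Sum>i\<in>UNIV. cnj (u $ i) * v $ i)" for u v :: "complex ^ 'm"
    by (simp add: inner_vec_def inner_complex_def)
  have "(\<Sum>i\<in>UNIV. cnj ((A *v x) $ i) * y $ i) = (\<Sum>i\<in>UNIV. \<Sum>j\<in>UNIV. cnj (A $ i $ j) * cnj (x $ j) * y $ i)"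
    by (simp add: matrix_vector_mult_def sum_distrib_right)
  also have "\<dots> = (\<Sum>j\<in>UNIV. \<Sum>i\<in>UNIV. cnj (A $ i $ j) * cnj (x $ j) * y $ i)"
    by (rule sum.swap)
  also have "\<dots> = (\<Sum>j\<in>UNIV. cnj (x $ j) * (conj_transpose A *v y) $ j)"
    by (simp add: matrix_vector_mult_def conj_transpose_def sum_distrib_left algebra_simps)
  finally show ?thesis by (simp add: i)
qed

lemma finite_range_linear_family:
  fixes M :: "int \<Rightarrow> complex ^ 'm ^ 'm::finite"
  assumes "finite (range M)"
  obtains C where "linear_family (\<lambda>n. (*v) (M n)) C"
proof -
  have "bounded_linear (\<lambda>x. A *v x)" for A :: "complex ^ 'm ^ 'm"
    by (simp add: linear_conv_bounded_linear[symmetric])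
  then have "\<exists>C>0. \<forall>x. norm (A *v x) \<le> norm x * C" for A :: "complex ^ 'm ^ 'm"
    using bounded_linear.pos_bounded by blast
  then obtain C :: "complex ^ 'm ^ 'm \<Rightarrow> real"
    where C: "\<And>A. C A > 0" "\<And>A x. norm (A *v x) \<le> norm x * C A"
    by metis
  have K: "C (M n) \<le> Max (C ` range M)" for n
    using assms by (intro Max_ge) auto
  have "norm (M n *v x) \<le> Max (C ` range M) * norm x" for n x
    using C(2)[of "M n" x] mult_left_mono[OF K[of n] norm_ge_zero[of x]] by (simp add: mult.commute)
  moreover have "0 \<le> Max (C ` range M)" using C(1) K[of 0] by (meson less_imp_le order_trans)
  ultimately have "linear_family (\<lambda>n. (*v) (M n)) (Max (C ` range M))"
    by (simp add: linear_family_def matrix_vector_right_distrib vector_scalar_commute)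
  then show ?thesis by (rule that)
qed

lemma linear_family_id: "linear_family (\<lambda>n x. x) 1" by (simp add: linear_family_def)

section \<open>Operators built from the coefficients: hopping terms, shift by a period,
  velocity\<close>

locale periodic_jacobi =
  fixes a b :: "int \<Rightarrow> complex ^ 'm ^ 'm::finite" and q :: nat
  assumes q: "q \<ge> 1" and coeffs: "block_jacobi_coeffs a b" and per: "periodic_coeffs q a b"
begin

abbreviation J :: "'m l2 \<Rightarrow> 'm l2" where "J \<equiv> jacobi a b"
definition G :: "'m l2 \<Rightarrow> 'm l2" where "G u = cscale \<i> (J u)"
definition up :: "'m l2 \<Rightarrow> 'm l2" where "up = bandop (\<lambda>n. (*v) (a n)) 1"
definition down :: "'m l2 \<Rightarrow> 'm l2" where "down = bandop (\<lambda>n. (*v) (conj_transpose (a (n - 1)))) (-1)"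
definition diag :: "'m l2 \<Rightarrow> 'm l2" where "diag = bandop (\<lambda>n. (*v) (b n)) 0"
text \<open>The velocity \<open>i[J, X]\<close>: the commutator \<open>JX - XJ\<close> multiplies
  diagonal \<open>k\<close> by \<open>k\<close>, which keeps \<open>up\<close>, reverses
  \<open>down\<close> and removes \<open>diag\<close>.\<close>

definition A :: "'m l2 \<Rightarrow> 'm l2" where "A u = cscale \<i> (up u - down u)"
definition S :: "'m l2 \<Rightarrow> 'm l2" where "S = bandop (\<lambda>n x. x) (- int q)"
definition S' :: "'m l2 \<Rightarrow> 'm l2" where "S' = bandop (\<lambda>n x. x) (int q)"

lemma families: "\<exists>C. linear_family (\<lambda>n. (*v) (a n)) C" "\<exists>C. linear_family (\<lambda>n. (*v) (b n)) C"
  "\<exists>C. linear_family (\<lambda>n. (*v) (conj_transpose (a n))) C"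
  "\<exists>C. linear_family (\<lambda>n. (*v) (conj_transpose (a (n - 1)))) C"
proof -
  have fa: "finite (range a)" and fb: "finite (range b)"
    using q per by (auto intro!: finite_range_periodic[of q] simp: periodic_coeffs_def)
  have "range (\<lambda>n. conj_transpose (a n)) = conj_transpose ` range a" by auto
  then have fc: "finite (range (\<lambda>n. conj_transpose (a n)))" using fa by simp
  show "\<exists>C. linear_family (\<lambda>n. (*v) (a n)) C" using finite_range_linear_family[OF fa] by blast
  show "\<exists>C. linear_family (\<lambda>n. (*v) (b n)) C" using finite_range_linear_family[OF fb] by blast
  show 1: "\<exists>C. linear_family (\<lambda>n. (*v) (conj_transpose (a n))) C" using finite_range_linear_family[OF fc] by blast
  show "\<exists>C. linear_family (\<lambda>n. (*v) (conj_transpose (a (n - 1)))) C"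
    using 1 by (auto simp: linear_family_def)
qed

lemma nth_simps:
  "l2_nth (up u) n = a n *v l2_nth u (n + 1)"
  "l2_nth (down u) n = conj_transpose (a (n - 1)) *v l2_nth u (n - 1)"
  "l2_nth (diag u) n = b n *v l2_nth u n"
  "l2_nth (S u) n = l2_nth u (n - int q)"
  "l2_nth (S' u) n = l2_nth u (n + int q)"
  using families unfolding up_def down_def diag_def S_def S'_def
  by (auto simp: bandop_nth[OF linear_family_id] bandop_nth)

lemma J_eq: "J u = down u + diag u + up u"
  by (rule l2_eqI) (use q per in \<open>simp add: l2_nth_jacobi[of q a b u] plus_l2.rep_eq nth_simps\<close>)

lemma bounded_operators: "bounded_operator up" "bounded_operator down" "bounded_operator diag"
   "bounded_operator S" "bounded_operator S'"
  unfolding up_def down_def diag_def S_def S'_def using families linear_family_id bandop_bounded by blast+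

lemma up_down: "inner (up u) v = inner u (down v)"
  unfolding up_def down_def using families bandop_adjoint[where k = 1 and L = "\<lambda>n. (*v) (a n)" and L' = "\<lambda>n. (*v) (conj_transpose (a n))"]
    inner_conj_transpose by blast

lemma diag_selfadjoint: "inner (diag u) v = inner u (diag v)"
proof -
  obtain C where C: "linear_family (\<lambda>n. (*v) (b n)) C" using families by blast
  have "inner (b n *v x) y = inner x (b n *v y)" for n x y
    using inner_conj_transpose[of "b n" x y] coeffs by (simp add: block_jacobi_coeffs_def)
  from bandop_adjoint[OF C C this, of 0] show ?thesis by (simp add: diag_def)
qed

lemma S_adjoint: "inner (S u) v = inner u (S' v)"
  using bandop_adjoint[OF linear_family_id linear_family_id, of "- int q" u v]
  unfolding S_def S'_def by simp

lemma J_selfadjoint: "bounded_selfadjoint J"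
proof (intro bounded_selfadjointI bounded_operatorI)
  show "bounded_linear J"
    unfolding J_eq[abs_def] by (intro bounded_linear_add bounded_operatorD bounded_operators)
  show "J (cscale \<i> u) = cscale \<i> (J u)" for u
    unfolding J_eq by (simp add: bounded_operatorD bounded_operators)
  show "inner (J u) v = inner u (J v)" for u v
    using up_down[of u v] up_down[of v u] diag_selfadjoint[of u v]
    by (simp add: J_eq inner_add_left inner_add_right inner_commute)
qed

lemma bounded_linear_G: "bounded_linear G"
  unfolding G_def[abs_def]
  by (intro bounded_linear_compose[OF bounded_linear_cscale] bounded_selfadjointD(2) J_selfadjoint)

lemma G_cscale: "G (cscale c u) = cscale c (G u)"
  by (simp add: G_def bounded_selfadjointD(3)[OF J_selfadjoint] mult.commute)

lemma inner_G: "inner (G u) v = - inner u (G v)"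
  by (simp add: G_def inner_cscale_i bounded_selfadjointD[OF J_selfadjoint])

lemma A_selfadjoint: "bounded_selfadjoint A"
proof (intro bounded_selfadjointI bounded_operatorI)
  show "bounded_linear A"
    unfolding A_def[abs_def]
    by (intro bounded_linear_compose[OF bounded_linear_cscale] bounded_linear_sub bounded_operatorD bounded_operators)
  show "A (cscale \<i> u) = cscale \<i> (A u)" for u
    unfolding A_def by (simp add: bounded_operatorD bounded_operators)
  show "inner (A u) v = inner u (A v)" for u v
  proof -
    have "inner (A u) v = - inner (up u) (cscale \<i> v) + inner (down u) (cscale \<i> v)"
      unfolding A_def inner_cscale_i by (simp add: inner_diff_left)
    also have "\<dots> = - inner u (down (cscale \<i> v)) + inner u (up (cscale \<i> v))"
      using up_down[of u] up_down[of "cscale \<i> v" u] by (simp add: inner_commute)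
    also have "\<dots> = inner u (A v)"
      by (simp add: A_def bounded_operatorD bounded_operators inner_diff_right)
    finally show ?thesis .
  qed
qed

lemma S_S' [simp]: "S (S' u) = u" "S' (S u) = u"
  by (rule l2_eqI, simp add: nth_simps)+

lemma a_shift: "a (n - int q) = a n" "b (n - int q) = b n" "a (n - int q - 1) = a (n - 1)"
  using per unfolding periodic_coeffs_def by (metis diff_add_cancel, metis diff_add_cancel, metis diff_add_eq diff_add_cancel)

lemma S_commute: "up (S u) = S (up u)" "down (S u) = S (down u)" "diag (S u) = S (diag u)"
  using a_shift by (auto intro!: l2_eqI simp: nth_simps algebra_simps)

lemma J_S: "J (S u) = S (J u)" and A_S: "A (S u) = S (A u)" and G_S: "G (S u) = S (G u)"
  using bounded_operatorD[OF bounded_operators(4)]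
  by (simp_all add: J_eq A_def G_def S_commute linear_simps)

lemma J_S': "J (S' u) = S' (J u)"
  by (metis J_S S_S')

lemma pos_op_J:
  assumes u: "u \<in> pos_dom"
  shows "J u \<in> pos_dom" "pos_op (J u) = J (pos_op u) + (down u - up u)"
proof -
  have 1: "up u \<in> pos_dom" "pos_op (up u) = up (pos_op u) - up u"
    "down u \<in> pos_dom" "pos_op (down u) = down (pos_op u) + down u"
    "diag u \<in> pos_dom" "pos_op (diag u) = diag (pos_op u)"
    unfolding up_def down_def diag_def using families pos_op_bandop[OF _ u] by fastforce+
  show "J u \<in> pos_dom" "pos_op (J u) = J (pos_op u) + (down u - up u)"
    unfolding J_eq using 1 by (simp_all add: pos_op_add)
qed

lemma pos_op_G:
  assumes u: "u \<in> pos_dom"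
  shows "G u \<in> pos_dom" "pos_op (G u) = G (pos_op u) - A u"
  unfolding G_def using pos_op_J[OF u] by (simp_all add: pos_op_cscale A_def)

lemma pos_op_S:
  assumes u: "u \<in> pos_dom"
  shows "S u \<in> pos_dom" "pos_op (S u) = S (pos_op u) + of_nat q *\<^sub>R S u"
  unfolding S_def using pos_op_bandop[OF linear_family_id u] by auto

end

subsection \<open>The unitary group generated by J\<close>

text \<open>The coefficients are arbitrary vectors, not powers of a bounded operator applied to a
  vector, because the series is also used with \<open>pos_op ((G ^^ k) \<psi>)\<close>, where
  position is unbounded.\<close>

definition exp_series :: "(nat \<Rightarrow> 'a::banach) \<Rightarrow> real \<Rightarrow> 'a" where
  "exp_series y t = (\<Sum>k. (t ^ k / fact k) *\<^sub>R y k)"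

lemma summable_exp_bound: "summable (\<lambda>k. \<bar>t\<bar> ^ k / fact k * (K * C ^ k))" for t K C :: real
proof -
  have "summable (\<lambda>k. K * (inverse (fact k) * (\<bar>t\<bar> * C) ^ k))"
    by (intro summable_mult summable_exp)
  then show ?thesis by (simp add: field_simps power_mult_distrib)
qed

lemma summable_exp_series:
  assumes "\<And>k. norm (y k) \<le> K * C ^ k"
  shows "summable (\<lambda>k. (t ^ k / fact k) *\<^sub>R (y k :: 'a::banach))"
proof (rule summable_comparison_test[OF _ summable_exp_bound[of t K C]], intro exI allI impI)
  fix k
  show "norm ((t ^ k / fact k) *\<^sub>R y k) \<le> \<bar>t\<bar> ^ k / fact k * (K * C ^ k)"
    using assms by (auto simp: power_abs intro!: divide_right_mono mult_left_mono)
qed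

text \<open>Termwise differentiation: on a bounded interval around \<open>t\<close> the
  differentiated terms are dominated by a convergent numerical series, so the Weierstrass test
  applies.\<close>

lemma exp_series_deriv:
  assumes y: "\<And>k. norm (y k) \<le> K * C ^ k" and C: "C \<ge> 0"
  shows "(exp_series y has_vector_derivative exp_series (\<lambda>k. y (Suc k)) t) (at t)"
proof -
  define R where "R = \<bar>t\<bar> + 1"
  define S where "S = {- R<..<R}"
  have t: "t \<in> S" and S: "open S" "convex S" by (auto simp: S_def R_def)
  have K: "K \<ge> 0" using order_trans[OF norm_ge_zero y[of 0]] by simp
  define d where "d i x = (real i * x ^ (i - 1) / fact i) *\<^sub>R y i" for i x
  define M where "M i = real i * R ^ (i - 1) / fact i * (K * C ^ i)" for i
  have dM: "norm (d i x) \<le> M i" if "x \<in> S" for i x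
  proof -
    have "\<bar>x\<bar> ^ (i - 1) \<le> R ^ (i - 1)" using that by (intro power_mono) (auto simp: S_def)
    then show ?thesis unfolding d_def M_def
      using K C y by (auto simp: power_abs abs_mult R_def intro!: mult_mono divide_right_mono mult_left_mono)
  qed
  have "M (Suc i) = \<bar>R\<bar> ^ i / fact i * ((K * C) * C ^ i)" for i
    proof -
    have "real (Suc i) / fact (Suc i) = 1 / fact i" by (simp del: of_nat_Suc)
    then show ?thesis unfolding M_def R_def
      by (simp only: diff_Suc_1 power_Suc times_divide_eq_left[symmetric] mult.commute[of "real (Suc i)"] mult.assoc
          times_divide_eq_right[symmetric]) (simp add: divide_inverse mult_ac)
  qed
  then have "summable (\<lambda>i. M (Suc i))" using summable_exp_bound by simp
  then have sM: "summable M" by (simp add: summable_Suc_iff)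
  have sd: "summable (\<lambda>i. d i x)" if "x \<in> S" for x
    using dM[OF that] by (intro summable_comparison_test[OF _ sM]) blast
  have "(\<Sum>i. d i x) = exp_series (\<lambda>k. y (Suc k)) x" if "x \<in> S" for x
  proof -
    have "(\<Sum>i. d i x) = (\<Sum>i. d (Suc i) x) + d 0 x"
      using suminf_split_head[OF sd[OF that]] by simp
    moreover have "d (Suc i) x = (x ^ i / fact i) *\<^sub>R y (Suc i)" for i
      by (simp add: d_def del: of_nat_Suc)
    ultimately show ?thesis by (simp add: exp_series_def d_def)
  qed
  note deriv_sum = this
  have "uniform_limit S (\<lambda>n x. \<Sum>i<n. d i x) (\<lambda>x. \<Sum>i. d i x) sequentially"
    by (rule Weierstrass_m_test[OF dM sM])
  then have ul: "uniform_limit S (\<lambda>n x. \<Sum>i<n. d i x) (exp_series (\<lambda>k. y (Suc k))) sequentially"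
    by (rule uniform_limit_cong'[THEN iffD1, rotated 2]) (auto simp: deriv_sum)
  have "\<exists>g. \<forall>x\<in>S. (\<lambda>n. (x ^ n / fact n) *\<^sub>R y n) sums (g x) \<and>
     (g has_derivative (\<lambda>h. h *\<^sub>R exp_series (\<lambda>k. y (Suc k)) x)) (at x within S)"
  proof (rule has_derivative_series[where f = "\<lambda>n x. (x ^ n / fact n) *\<^sub>R y n" and f' = "\<lambda>n x h. h *\<^sub>R d n x"
        and x = 0 and l = "y 0"])
    show "((\<lambda>x. (x ^ n / fact n) *\<^sub>R y n) has_derivative (\<lambda>h. h *\<^sub>R d n x)) (at x within S)" for n x
      unfolding d_def by (auto intro!: derivative_eq_intros simp: fun_eq_iff field_simps)
    fix e :: real assume "e > 0"
    from uniform_limitD[OF ul this]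
    show "\<forall>\<^sub>F n in sequentially. \<forall>x\<in>S. \<forall>h. norm ((\<Sum>i<n. h *\<^sub>R d i x) - h *\<^sub>R exp_series (\<lambda>k. y (Suc k)) x) \<le> e * norm h"
    proof eventually_elim
      case (elim n)
      show ?case
      proof (intro ballI allI)
        fix x h assume "x \<in> S"
        have "norm ((\<Sum>i<n. h *\<^sub>R d i x) - h *\<^sub>R exp_series (\<lambda>k. y (Suc k)) x) =
           \<bar>h\<bar> * norm ((\<Sum>i<n. d i x) - exp_series (\<lambda>k. y (Suc k)) x)"
          by (simp flip: scaleR_sum_right scaleR_diff_right)
        also have "\<dots> \<le> \<bar>h\<bar> * e"
          using elim \<open>x \<in> S\<close> by (intro mult_left_mono) (auto simp: dist_norm intro: less_imp_le)
        finally show "norm ((\<Sum>i<n. h *\<^sub>R d i x) - h *\<^sub>R exp_series (\<lambda>k. y (Suc k)) x) \<le> e * norm h"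
          by (simp add: mult.commute)
      qed
    qed
  next
    have "(\<lambda>n. if n = 0 then y 0 else 0) sums y 0" using sums_single[of 0 "\<lambda>_. y 0"] by simp
    moreover have "(0 ^ n / fact n :: real) *\<^sub>R y n = (if n = 0 then y 0 else 0)" for n by (cases n) auto
    ultimately show "(\<lambda>n. (0 ^ n / fact n :: real) *\<^sub>R y n) sums y 0" by simp
  qed (auto simp: S_def R_def)
  then obtain g where g: "\<And>x. x \<in> S \<Longrightarrow> (\<lambda>n. (x ^ n / fact n) *\<^sub>R y n) sums (g x)"
    "\<And>x. x \<in> S \<Longrightarrow> (g has_derivative (\<lambda>h. h *\<^sub>R exp_series (\<lambda>k. y (Suc k)) x)) (at x within S)" by blast
  have "(g has_vector_derivative exp_series (\<lambda>k. y (Suc k)) t) (at t)"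
    using g(2)[OF t] by (simp add: has_vector_derivative_def at_within_open[OF t S(1)])
  then show ?thesis
    using S(1) t by (rule has_vector_derivative_transform_within_open)
      (simp add: exp_series_def sums_unique[OF g(1)])
qed

lemma funpow_bound:
  fixes G :: "'a::real_normed_vector \<Rightarrow> 'a"
  assumes "bounded_linear G"
  obtains C where "C \<ge> 1" "\<And>k u. norm ((G ^^ k) u) \<le> C ^ k * norm u"
proof -
  from bounded_linear.nonneg_bounded[OF assms] obtain B where B: "B \<ge> 0" "\<And>u. norm (G u) \<le> norm u * B" by blast
  have "norm ((G ^^ k) u) \<le> (B + 1) ^ k * norm u" for k u
  proof (induction k)
    case (Suc k)
    have "norm ((G ^^ Suc k) u) \<le> norm ((G ^^ k) u) * (B + 1)"
      using B(2)[of "(G ^^ k) u"] by (simp add: distrib_left add_increasing2)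
    also have "\<dots> \<le> (B + 1) ^ k * norm u * (B + 1)" using Suc B(1) by (intro mult_right_mono) auto
    finally show ?case by (simp add: algebra_simps)
  qed simp
  then show ?thesis using that[of "B + 1"] B(1) by simp
qed

context periodic_jacobi
begin

abbreviation U :: "real \<Rightarrow> 'm l2 \<Rightarrow> 'm l2" where "U \<equiv> exp_i J"

lemma funpow_G: "(G ^^ k) u = cscale (\<i> ^ k) ((J ^^ k) u)"
proof (induction k)
  case (Suc k)
  then show ?case by (simp add: G_cscale) (simp add: G_def mult.commute)
qed simp

lemma U_series: "U t u = exp_series (\<lambda>k. (G ^^ k) u) t"
proof -
  have "cscale ((\<i> * of_real t) ^ k / fact k) ((J ^^ k) u) = (t ^ k / fact k) *\<^sub>R (G ^^ k) u" for k
  proof -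
    have "(\<i> * of_real t) ^ k / fact k = of_real (t ^ k / fact k) * \<i> ^ k"
      by (simp add: power_mult_distrib)
    then show ?thesis unfolding funpow_G by (metis cscale_simps(5,9))
  qed
  then show ?thesis by (simp add: exp_i_def exp_series_def)
qed

lemma G_bound: obtains C where "C \<ge> 1" "\<And>k u. norm ((G ^^ k) u) \<le> norm u * C ^ k"
  using funpow_bound[OF bounded_linear_G] by (metis mult.commute)

lemma U_deriv: "((\<lambda>t. U t u) has_vector_derivative G (U t u)) (at t)"
proof -
  obtain C where C: "C \<ge> 1" "\<And>k u. norm ((G ^^ k) u) \<le> norm u * C ^ k" using G_bound by blast
  have "exp_series (\<lambda>k. (G ^^ Suc k) u) t = G (exp_series (\<lambda>k. (G ^^ k) u) t)"
    unfolding exp_series_def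
    by (subst bounded_linear.suminf[OF bounded_linear_G summable_exp_series[OF C(2)]])
       (simp add: linear_simps[OF bounded_linear_G])
  then show ?thesis
    using exp_series_deriv[of "\<lambda>k. (G ^^ k) u" "norm u" C t] C unfolding U_series by simp
qed

lemma U_0 [simp]: "U 0 u = u"
proof -
  have "(\<lambda>n. (0 ^ n / fact n) *\<^sub>R (G ^^ n) u) = (\<lambda>n. if n = 0 then u else 0)"
    by (auto simp: fun_eq_iff power_0_left)
  then show ?thesis
    unfolding U_series exp_series_def using sums_single[of 0 "\<lambda>_. u"] by (simp add: sums_iff)
qed

text \<open>\<open>G\<close> is skew-adjoint, so the derivative of the squared norm
  vanishes.\<close>

lemma ode_norm:
  assumes "\<And>t. (w has_vector_derivative G (w t)) (at t)"
  shows "norm (w t) = norm (w 0)"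
proof -
  have "((\<lambda>t. inner (w t) (w t)) has_vector_derivative 0) (at t)" for t
  proof -
    have "((\<lambda>t. inner (w t) (w t)) has_vector_derivative (inner (w t) (G (w t)) + inner (G (w t)) (w t))) (at t)"
      using assms[of t] by (rule bounded_bilinear.has_vector_derivative[OF bounded_bilinear_inner])
        (rule assms)
    then show ?thesis using inner_G[of "w t" "w t"] by simp
  qed
  then obtain c where "\<And>t. t \<in> UNIV \<Longrightarrow> inner (w t) (w t) = c"
    using has_vector_derivative_zero_constant[of UNIV "\<lambda>t. inner (w t) (w t)"] by auto
  then show ?thesis by (simp add: norm_eq_sqrt_inner)
qed

text \<open>Conservation of the norm, applied to the difference. Linearity, the group law and the
  commutation rules for \<open>U\<close> are all derived from this uniqueness rather than from the
  series.\<close>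

lemma ode_unique:
  assumes "\<And>t. (w has_vector_derivative G (w t)) (at t)" "\<And>t. (v has_vector_derivative G (v t)) (at t)" "w 0 = v 0"
  shows "w t = v t"
proof -
  have "((\<lambda>t. w t - v t) has_vector_derivative G (w t - v t)) (at t)" for t
    using has_vector_derivative_diff[OF assms(1,2)] by (simp add: linear_simps[OF bounded_linear_G])
  from ode_norm[of "\<lambda>t. w t - v t", OF this] show ?thesis using assms(3) by simp
qed

lemma norm_U [simp]: "norm (U t u) = norm u"
  using ode_norm[of "\<lambda>t. U t u", OF U_deriv] by simp

lemma U_commute:
  assumes B: "bounded_linear B" and BG: "\<And>u. B (G u) = G (B u)"
  shows "U t (B u) = B (U t u)"
proof (rule ode_unique[where v = "\<lambda>t. B (U t u)"])
  show "((\<lambda>t. U t (B u)) has_vector_derivative G (U t (B u))) (at t)" for t by (rule U_deriv)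
  show "((\<lambda>t. B (U t u)) has_vector_derivative G (B (U t u))) (at t)" for t
    using bounded_linear.has_vector_derivative[OF B U_deriv] BG by simp
qed simp

lemma U_linear: "U t (u + v) = U t u + U t v" "U t (r *\<^sub>R u) = r *\<^sub>R U t u"
  by (rule ode_unique[where w = "\<lambda>t. U t (u + v)" and v = "\<lambda>t. U t u + U t v"];
      auto intro!: derivative_eq_intros U_deriv simp: linear_simps[OF bounded_linear_G])
     (rule U_commute, auto simp: linear_simps[OF bounded_linear_G] bounded_linear_scaleR_right)

lemma bounded_linear_U: "bounded_linear (U t)"
  by (rule bounded_linear_intro[of _ 1]) (auto simp: U_linear)

lemma U_cscale: "U t (cscale c u) = cscale c (U t u)"
  by (rule U_commute) (auto simp: bounded_linear_cscale G_cscale)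

lemma U_G: "U t (G u) = G (U t u)"
  by (rule U_commute) (auto simp: bounded_linear_G)

lemma U_S: "U t (S u) = S (U t u)"
  by (rule U_commute) (auto simp: G_S bounded_operatorD bounded_operators)

lemma U_J: "U t (J u) = J (U t u)"
  by (rule U_commute) (auto simp: G_def bounded_selfadjointD[OF J_selfadjoint])

lemma U_add: "U (s + t) u = U s (U t u)"
proof (rule ode_unique[where w = "\<lambda>s. U (s + t) u" and v = "\<lambda>s. U s (U t u)"])
  show "((\<lambda>s. U (s + t) u) has_vector_derivative G (U (s + t) u)) (at s)" for s
  proof -
    have "((\<lambda>s. s + t) has_vector_derivative 1) (at s)" by (auto intro!: derivative_eq_intros)
    from vector_diff_chain_at[OF this U_deriv] show ?thesis by (simp add: o_def)
  qed
qed (auto simp: U_deriv)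

lemma U_inverse [simp]: "U t (U (- t) u) = u" "U (- t) (U t u) = u"
  using U_add[of t "- t" u] U_add[of "- t" t u] by simp_all

lemma inner_U_U: "inner (U t u) (U t v) = inner u v"
  unfolding dot_norm U_linear(1)[symmetric] norm_U ..

lemma U_adjoint: "inner (U t u) v = inner u (U (- t) v)"
  using inner_U_U[of t u "U (- t) v"] by simp

text \<open>A product rule using only strong differentiability of \<open>U\<close>: the first-order
  remainder of \<open>w\<close> is transported isometrically by \<open>U s\<close> and hence remains
  of smaller order than \<open>s - t\<close>.\<close>

lemma U_product_deriv:
  assumes w: "(w has_vector_derivative w') (at t)"
  shows "((\<lambda>s. U s (w s)) has_vector_derivative G (U t (w t)) + U t w') (at t)"
proof -
  define r where "r s = w s - w t - (s - t) *\<^sub>R w'" for s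
  have "(r has_vector_derivative 0) (at t)"
    unfolding r_def using w by (auto intro!: derivative_eq_intros)
  then have "((\<lambda>s. norm (r s) / norm (s - t)) \<longlongrightarrow> 0) (at t)"
    unfolding has_vector_derivative_def has_derivative_iff_norm by (simp add: r_def)
  then have 1: "((\<lambda>s. U s (r s)) has_vector_derivative 0) (at t)"
    unfolding has_vector_derivative_def has_derivative_iff_norm
    using U_linear(2)[of t 0] by (simp add: r_def)
  have 2: "((\<lambda>s. (s - t) *\<^sub>R U s w') has_vector_derivative U t w') (at t)"
    by (auto intro!: derivative_eq_intros U_deriv)
  have eq: "(\<lambda>s. U s (w s)) = (\<lambda>s. U s (r s) + (s - t) *\<^sub>R U s w' + U s (w t))"
    by (rule ext) (simp flip: U_linear add: r_def)
  show ?thesis unfolding eq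
    using has_vector_derivative_add[OF has_vector_derivative_add[OF 1 2] U_deriv[of "w t" t]]
    by (simp add: add.commute)
qed

lemma U_neg_deriv: "((\<lambda>t. U (- t) u) has_vector_derivative - G (U (- t) u)) (at t)"
proof -
  have "((\<lambda>s. - s) has_vector_derivative - 1) (at t)" by (auto intro!: derivative_eq_intros)
  from vector_diff_chain_at[OF this U_deriv] show ?thesis by (simp add: o_def)
qed

text \<open>Since \<open>X G = G X - A\<close>, the vectors \<open>pos_op ((G ^^ k) \<psi>)\<close>
  grow at most geometrically, so the exponential series still converges after position has been
  applied to each term.\<close>

lemma pos_op_U_series:
  assumes \<psi>: "\<psi> \<in> pos_dom"
  obtains K C where "C \<ge> 1" "\<And>k. norm (pos_op ((G ^^ k) \<psi>)) \<le> K * C ^ k"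
    "\<And>t. U t \<psi> \<in> pos_dom" "\<And>t. pos_op (U t \<psi>) = exp_series (\<lambda>k. pos_op ((G ^^ k) \<psi>)) t"
proof -
  obtain C1 where C1: "C1 \<ge> 1" "\<And>k u. norm ((G ^^ k) u) \<le> norm u * C1 ^ k" using G_bound by blast
  obtain C2 where C2: "C2 \<ge> 0" "\<And>u. norm (A u) \<le> norm u * C2"
    using bounded_linear.nonneg_bounded[OF bounded_selfadjointD(2)[OF A_selfadjoint]] by blast
  define C where "C = max C1 C2"
  have C: "C \<ge> 1" "C \<ge> C1" "C \<ge> C2" using C1 by (auto simp: C_def)
  have dom: "(G ^^ k) \<psi> \<in> pos_dom" for k
    by (induction k) (auto simp: \<psi> pos_op_G)
  have G1: "norm ((G ^^ k) \<psi>) \<le> norm \<psi> * C ^ k" for k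
    using C1(2)[of k \<psi>] power_mono[OF C(2), of k] C1(1)
      mult_left_mono[of "C1 ^ k" "C ^ k" "norm \<psi>"] by auto
  have "norm (pos_op ((G ^^ k) \<psi>)) \<le> (norm (pos_op \<psi>) + k * norm \<psi>) * C ^ k" for k
  proof (induction k)
    case (Suc k)
    have "norm (pos_op ((G ^^ Suc k) \<psi>)) \<le> norm (G (pos_op ((G ^^ k) \<psi>))) + norm (A ((G ^^ k) \<psi>))"
      using pos_op_G[OF dom[of k]] norm_triangle_ineq4 by simp
    also have "\<dots> \<le> norm (pos_op ((G ^^ k) \<psi>)) * C1 + norm ((G ^^ k) \<psi>) * C2"
      using C1(2)[of 1] C2(2) by (intro add_mono) auto
    also have "\<dots> \<le> (norm (pos_op \<psi>) + k * norm \<psi>) * C ^ k * C + norm \<psi> * C ^ k * C"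
      using Suc G1 C C1(1) C2(1) by (intro add_mono mult_mono) auto
    finally show ?case by (simp add: algebra_simps)
  qed simp
  note 1 = this
  \<comment> \<open>The linear factor \<open>k\<close>, produced by \<open>k\<close> commutators, is
    absorbed into \<open>2 ^ k\<close> at the price of doubling the growth rate.\<close>
  have 2: "norm (pos_op \<psi>) + k * norm \<psi> \<le> (norm (pos_op \<psi>) + norm \<psi>) * 2 ^ k" for k
  proof -
    have "real k \<le> 2 ^ k" "(1::real) \<le> 2 ^ k" by (simp_all add: of_nat_less_two_power less_imp_le)
    then have "norm (pos_op \<psi>) * 1 + norm \<psi> * real k \<le> norm (pos_op \<psi>) * 2 ^ k + norm \<psi> * 2 ^ k"
      by (intro add_mono mult_left_mono) auto
    then show ?thesis by (simp add: algebra_simps)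
  qed
  have bd: "norm (pos_op ((G ^^ k) \<psi>)) \<le> (norm (pos_op \<psi>) + norm \<psi>) * (2 * C) ^ k" for k
      proof -
    have "(norm (pos_op \<psi>) + k * norm \<psi>) * C ^ k \<le> (norm (pos_op \<psi>) + norm \<psi>) * 2 ^ k * C ^ k"
      using C(1) by (intro mult_right_mono) (simp_all add: 2)
    then show ?thesis using 1[of k] by (simp add: power_mult_distrib mult.assoc)
  qed
  \<comment> \<open>Closedness of position, checked in each coordinate, where it is multiplication
    by the number \<open>n\<close>.\<close>
  have *: "l2_nth (exp_series (\<lambda>k. pos_op ((G ^^ k) \<psi>)) t) n = of_int n *\<^sub>R l2_nth (U t \<psi>) n" for t n
  proof -
    have "l2_nth (exp_series (\<lambda>k. pos_op ((G ^^ k) \<psi>)) t) n = (\<Sum>k. of_int n *\<^sub>R l2_nth ((t ^ k / fact k) *\<^sub>R (G ^^ k) \<psi>) n)"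
      unfolding exp_series_def
      by (subst bounded_linear.suminf[OF bounded_linear_l2_nth summable_exp_series[OF bd]])
         (simp add: scaleR_l2.rep_eq pos_op_nth[OF dom] mult.commute)
    also have "\<dots> = of_int n *\<^sub>R l2_nth (\<Sum>k. (t ^ k / fact k) *\<^sub>R (G ^^ k) \<psi>) n"
      by (subst bounded_linear.suminf[OF bounded_linear_compose[OF bounded_linear_scaleR_right bounded_linear_l2_nth]
            summable_exp_series[OF C1(2)]]) simp
    finally show ?thesis by (simp add: U_series exp_series_def)
  qed
  show ?thesis
    using that[OF _ bd pos_opI[OF *]] C(1) by simp
qed

lemma U_pos_dom: "\<psi> \<in> pos_dom \<Longrightarrow> U t \<psi> \<in> pos_dom"
  using pos_op_U_series by blast

lemma pos_op_U_deriv: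
  assumes \<psi>: "\<psi> \<in> pos_dom"
  shows "((\<lambda>t. pos_op (U t \<psi>)) has_vector_derivative pos_op (G (U t \<psi>))) (at t)"
proof -
  have 1: "pos_op (G (U t \<psi>)) = exp_series (\<lambda>k. pos_op ((G ^^ Suc k) \<psi>)) t"
    using pos_op_U_series[OF pos_op_G(1)[OF \<psi>]] by (metis (no_types, lifting) U_G ext comp_apply funpow_Suc_right)
  obtain C K where *: "C \<ge> 1" "\<And>k. norm (pos_op ((G ^^ k) \<psi>)) \<le> K * C ^ k"
     "\<And>t. pos_op (U t \<psi>) = exp_series (\<lambda>k. pos_op ((G ^^ k) \<psi>)) t"
    using pos_op_U_series[OF \<psi>] by metis
  show ?thesis using exp_series_deriv[of "\<lambda>k. pos_op ((G ^^ k) \<psi>)" K C t] * unfolding 1 *(3) by simp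
qed

text \<open>The outer factor contributes \<open>G X\<close>, the inner one \<open>- X G\<close>; by
  \<open>X G = G X - A\<close> they combine to \<open>A\<close>.\<close>

lemma heis_deriv:
  assumes \<psi>: "\<psi> \<in> pos_dom"
  shows "((\<lambda>t. heis_op J t \<psi>) has_vector_derivative U t (A (U (- t) \<psi>))) (at t)"
proof -
  have "((\<lambda>s. - s) has_vector_derivative - 1) (at t)" by (auto intro!: derivative_eq_intros)
  from vector_diff_chain_at[OF this pos_op_U_deriv[OF \<psi>]]
  have "((\<lambda>s. pos_op (U (- s) \<psi>)) has_vector_derivative - pos_op (G (U (- t) \<psi>))) (at t)"
    by (simp add: o_def)
  from U_product_deriv[OF this] show ?thesis
    unfolding heis_op_def
    by (simp add: pos_op_G(2)[OF U_pos_dom[OF \<psi>]] linear_simps[OF bounded_linear_U] U_G)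
qed

section \<open>Time integrals of a conjugated bounded operator\<close>

definition evint :: "('m l2 \<Rightarrow> 'm l2) \<Rightarrow> real \<Rightarrow> 'm l2 \<Rightarrow> 'm l2" where
  "evint B t \<psi> = integral {0..t} (\<lambda>s. U s (B (U (- s) \<psi>)))"

context
  fixes B :: "'m l2 \<Rightarrow> 'm l2" assumes B: "bounded_linear B"
begin

lemma evint_continuous: "continuous_on T (\<lambda>s. U s (B (U (- s) \<psi>)))"
proof -
  have "((\<lambda>s. U s (B (U (- s) \<psi>))) has_vector_derivative G (U s (B (U (- s) \<psi>))) + U s (B (- G (U (- s) \<psi>)))) (at s)" for s
    by (intro U_product_deriv bounded_linear.has_vector_derivative[OF B] U_neg_deriv)
  then show ?thesis
    by (meson continuous_at_imp_continuous_on has_vector_derivative_continuous)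
qed

lemma evint_integrable: "(\<lambda>s. U s (B (U (- s) \<psi>))) integrable_on {c..d}"
  by (intro integrable_continuous_real evint_continuous)

lemma evint_linear:
  "evint B t (u + v) = evint B t u + evint B t v" "evint B t (r *\<^sub>R u) = r *\<^sub>R evint B t u"
  by (simp_all add: evint_def linear_simps[OF bounded_linear_U] linear_simps[OF B] integral_add evint_integrable)

lemma evint_bound:
  assumes "\<And>u. norm (B u) \<le> K * norm u" "t \<ge> 0"
  shows "norm (evint B t u) \<le> t * (K * norm u)"
proof -
  have "norm (evint B t u) \<le> (K * norm u) * (t - 0)"
    unfolding evint_def using assms(1)[of "U _ u"] assms(2)
    by (intro integral_bound evint_continuous) auto
  then show ?thesis by (simp add: mult.commute)
qed

lemma evint_bounded_linear: "bounded_linear (evint B t)"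
proof (cases "t \<ge> 0")
  case True
  obtain K where "\<And>u. norm (B u) \<le> norm u * K" using bounded_linear.bounded[OF B] by blast
  then have "norm (evint B t u) \<le> norm u * (t * K)" for u
    using evint_bound[of K t u] True by (simp add: mult_ac)
  then show ?thesis by (intro bounded_linear_intro[of _ "t * K"]) (auto simp: evint_linear)
next
  case False
  then show ?thesis by (simp add: evint_def[abs_def])
qed

lemma evint_commute:
  assumes D: "bounded_linear D" and DU: "\<And>t u. D (U t u) = U t (D u)" and DB: "\<And>u. D (B u) = B (D u)"
  shows "evint B t (D u) = D (evint B t u)"
proof -
  have "D (evint B t u) = integral {0..t} (D \<circ> (\<lambda>s. U s (B (U (- s) u))))"
    unfolding evint_def by (rule integral_linear[OF evint_integrable D, symmetric])
  then show ?thesis by (simp add: evint_def o_def DU DB)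
qed

lemma evint_adjoint:
  assumes B': "bounded_linear B'" and BB': "\<And>u v. inner (B u) v = inner u (B' v)"
  shows "inner (evint B t u) v = inner u (evint B' t v)"
proof -
  have "inner (evint B t u) v = integral {0..t} ((\<lambda>x. inner x v) \<circ> (\<lambda>s. U s (B (U (- s) u))))"
    unfolding evint_def by (rule integral_linear[OF evint_integrable, symmetric]) (rule bounded_linear_inner_left)
  also have "\<dots> = integral {0..t} ((\<lambda>x. inner u x) \<circ> (\<lambda>s. U s (B' (U (- s) v))))"
    using BB' U_adjoint[of _ _ v] U_adjoint[of _ u] inner_commute by (intro integral_cong) (simp add: U_adjoint)
  also have "\<dots> = inner u (evint B' t v)"
    unfolding evint_def by (rule integral_linear) (auto intro!: integrable_continuous_real bounded_linear_inner_right
      periodic_jacobi.evint_continuous[OF periodic_jacobi_axioms B'])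
  finally show ?thesis .
qed

text \<open>The integral over \<open>[s, s + t]\<close> is the one over \<open>[0, t]\<close>
  conjugated by \<open>U s\<close>. This turns integrals up to integer times into sums of
  conjugates, and later gives commutation of \<open>Q\<close> with the evolution.\<close>

lemma evint_cocycle:
  assumes "s \<ge> 0" "t \<ge> 0"
  shows "evint B (s + t) u = evint B s u + U s (evint B t (U (- s) u))"
proof -
  have "evint B (s + t) u = evint B s u + integral {s..s + t} (\<lambda>r. U r (B (U (- r) u)))"
    unfolding evint_def using assms by (subst Henstock_Kurzweil_Integration.integral_combine[where c = s]) (auto intro: evint_integrable)
  also have "integral {s..s + t} (\<lambda>r. U r (B (U (- r) u))) = integral {0..t} (\<lambda>r. U (r + s) (B (U (- (r + s)) u)))"
  proof -
    show ?thesis using integral_shift_real_ivl[of s s "s + t" "\<lambda>r. U r (B (U (- r) u))"] by simp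
  qed
  also have "\<dots> = integral {0..t} (U s \<circ> (\<lambda>r. U r (B (U (- r) (U (- s) u)))))"
    by (simp add: o_def U_add[symmetric] add.commute)
  also have "\<dots> = U s (evint B t (U (- s) u))"
    unfolding evint_def by (rule integral_linear[OF evint_integrable bounded_linear_U])
  finally show ?thesis .
qed

end

lemma heis_eq:
  assumes \<psi>: "\<psi> \<in> pos_dom" and t: "t \<ge> 0"
  shows "heis_op J t \<psi> = pos_op \<psi> + evint A t \<psi>"
proof -
  have "((\<lambda>s. U s (A (U (- s) \<psi>))) has_integral heis_op J t \<psi> - heis_op J 0 \<psi>) {0..t}"
    by (rule fundamental_theorem_of_calculus[OF t], rule has_vector_derivative_at_within, rule heis_deriv[OF \<psi>])
  then show ?thesis by (simp add: evint_def integral_unique heis_op_def)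
qed

end

text \<open>The uniform bound lets the Cauchy property pass to limits of vectors by a three-term
  estimate, so convergence has to be checked only on a dense set.\<close>

lemma closed_convergent:
  fixes T :: "nat \<Rightarrow> 'a::real_normed_vector \<Rightarrow> 'b::banach"
  assumes lin: "\<And>n u v. T n (u - v) = T n u - T n v" and bd: "\<And>n u. norm (T n u) \<le> K * norm u"
  shows "closed {u. convergent (\<lambda>n. T n u)}"
proof (rule closed_sequential_limits[THEN iffD2], intro allI impI, elim conjE)
  fix x l assume x: "\<forall>k. x k \<in> {u. convergent (\<lambda>n. T n u)}" and l: "x \<longlonglongrightarrow> l"
  have "Cauchy (\<lambda>n. T n l)"
  proof (rule metric_CauchyI)
    fix e :: real assume e: "e > 0"
    define K' where "K' = max K 1"
    have K': "K' > 0" "K \<le> K'" by (auto simp: K'_def)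
    from LIMSEQ_D[OF l, of "e / (3 * K')"] obtain k where k: "norm (x k - l) < e / (3 * K')"
      using e K' by auto
    have close: "norm (T n (x k) - T n l) < e / 3" for n
    proof -
      have "norm (T n (x k) - T n l) \<le> K' * norm (x k - l)"
        using bd[of n "x k - l"] mult_right_mono[OF K'(2), of "norm (x k - l)"] by (simp add: lin)
      also have "\<dots> < K' * (e / (3 * K'))" using k K' by (intro mult_strict_left_mono) auto
      finally show ?thesis using K' by simp
    qed
    have "Cauchy (\<lambda>n. T n (x k))" using x convergent_Cauchy by blast
    from metric_CauchyD[OF this, of "e / 3"] e obtain M where M: "\<And>m n. m \<ge> M \<Longrightarrow> n \<ge> M \<Longrightarrow> dist (T m (x k)) (T n (x k)) < e / 3"
      by auto
    have "dist (T m l) (T n l) < e" if "m \<ge> M" "n \<ge> M" for m n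
      using M[OF that] close[of m] close[of n] by (metis dist_commute dist_norm dist_triangle_third)
    then show "\<exists>M. \<forall>m\<ge>M. \<forall>n\<ge>M. dist (T m l) (T n l) < e" by blast
  qed
  then show "l \<in> {u. convergent (\<lambda>n. T n u)}" by (simp add: Cauchy_convergent)
qed

subsection \<open>The mean ergodic theorem for stationary sequences\<close>

text \<open>\<open>p(T)\<close> applied to \<open>w 0\<close> for the formal shift \<open>T\<close>
  that sends \<open>w k\<close> to \<open>w (Suc k)\<close>. The algebra takes place on polynomials,
  where \<open>T\<close> is multiplication by the variable, since \<open>T\<close> need not be well
  defined on vectors.\<close>

definition poly_comb :: "(nat \<Rightarrow> 'b \<Rightarrow> 'a::real_vector) \<Rightarrow> real poly \<Rightarrow> 'b \<Rightarrow> 'a" where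
  "poly_comb w p x = (\<Sum>k\<le>degree p. coeff p k *\<^sub>R w k x)"

lemma poly_comb_eq: "degree p \<le> n \<Longrightarrow> poly_comb w p x = (\<Sum>k\<le>n. coeff p k *\<^sub>R w k x)"
  unfolding poly_comb_def by (rule sum.mono_neutral_left) (auto intro: coeff_eq_0)

lemma poly_comb_add: "poly_comb w (p + r) x = poly_comb w p x + poly_comb w r x"
  by (simp add: poly_comb_eq[of _ "max (degree p) (degree r)"] degree_add_le scaleR_add_left sum.distrib)

lemma poly_comb_smult: "poly_comb w (smult c p) x = c *\<^sub>R poly_comb w p x"
  by (simp add: poly_comb_eq[of _ "degree p"] degree_smult_le scaleR_sum_right)

lemma poly_comb_diff: "poly_comb w (p - r) x = poly_comb w p x - poly_comb w r x"
proof -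
  have "p - r = p + smult (-1) r" by simp
  then show ?thesis by (simp only: poly_comb_add poly_comb_smult) simp
qed

lemma poly_comb_shift: "poly_comb w (pCons 0 p) x = poly_comb (\<lambda>k. w (Suc k)) p x"
proof -
  have "poly_comb w (pCons 0 p) x = (\<Sum>k\<le>Suc (degree p). coeff (pCons 0 p) k *\<^sub>R w k x)"
    by (rule poly_comb_eq) simp
  then show ?thesis by (simp only: sum.atMost_Suc_shift) (simp add: poly_comb_def)
qed

text \<open>Averages are polynomials \<open>E n\<close> with value 1 at 1, and stationarity makes
  multiplication by the variable isometric for the seminorm \<open>N\<close>. Averaging a nearly
  minimal \<open>p\<close> with value 1 at 1 differs little from averaging 1, and by the
  parallelogram law the averages of \<open>p\<close> are close to each other. \<open>N\<close> sums
  squares over \<open>P\<close>, which becomes a cell.\<close>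

lemma mean_ergodic_stationary:
  fixes w :: "nat \<Rightarrow> 'b \<Rightarrow> 'a::real_inner"
  assumes P: "finite P"
    and stat: "\<And>j k. (\<Sum>x\<in>P. inner (w (Suc j) x) (w (Suc k) x)) = (\<Sum>x\<in>P. inner (w j x) (w k x))"
    and x: "x \<in> P"
  shows "Cauchy (\<lambda>n. (1 / real n) *\<^sub>R (\<Sum>k<n. w k x))"
proof -
  let ?c = "poly_comb w"
  define N where "N p = L2_set (\<lambda>x. norm (?c p x)) P" for p
  have N0: "N p \<ge> 0" for p by (simp add: N_def)
  have N_add: "N (p + r) \<le> N p + N r" for p r
    unfolding N_def poly_comb_add
    by (rule order_trans[OF L2_set_mono L2_set_triangle_ineq]) (auto intro: norm_triangle_ineq)
  have N_smult: "N (smult c p) = \<bar>c\<bar> * N p" for c p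
    unfolding N_def poly_comb_smult by (simp add: L2_set_right_distrib)
  have N_sq: "(N p)\<^sup>2 = (\<Sum>x\<in>P. (norm (?c p x))\<^sup>2)" for p
    by (simp add: N_def L2_set_def sum_nonneg)
  have N_par: "(N (p + r))\<^sup>2 + (N (p - r))\<^sup>2 = 2 * (N p)\<^sup>2 + 2 * (N r)\<^sup>2" for p r
  proof -
    have "(norm (?c (p + r) x))\<^sup>2 + (norm (?c (p - r) x))\<^sup>2 = 2 * (norm (?c p x))\<^sup>2 + 2 * (norm (?c r x))\<^sup>2" for x
      by (simp add: poly_comb_add poly_comb_diff power2_norm_eq_inner inner_add inner_diff)
    then show ?thesis unfolding N_sq sum_distrib_left sum.distrib[symmetric] by simp
  qed
  have N_shift: "N (pCons 0 p) = N p" for p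
  proof -
    have "(N (pCons 0 p))\<^sup>2 = (\<Sum>x\<in>P. \<Sum>j\<le>degree p. \<Sum>k\<le>degree p. (coeff p j * coeff p k) * inner (w (Suc k) x) (w (Suc j) x))"
      unfolding N_sq poly_comb_shift unfolding power2_norm_eq_inner poly_comb_def
      by (simp add: inner_sum_left inner_sum_right sum_distrib_left mult_ac)
    also have "\<dots> = (\<Sum>j\<le>degree p. \<Sum>k\<le>degree p. (coeff p j * coeff p k) * (\<Sum>x\<in>P. inner (w (Suc k) x) (w (Suc j) x)))"
      by (subst sum.swap, intro sum.cong refl, subst sum.swap) (simp add: sum_distrib_left)
    also have "\<dots> = (\<Sum>x\<in>P. \<Sum>j\<le>degree p. \<Sum>k\<le>degree p. (coeff p j * coeff p k) * inner (w k x) (w j x))"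
      unfolding stat by (subst (2) sum.swap, intro sum.cong refl, subst sum.swap) (simp add: sum_distrib_left)
    also have "\<dots> = (N p)\<^sup>2"
      unfolding N_sq power2_norm_eq_inner poly_comb_def
      by (simp add: inner_sum_left inner_sum_right sum_distrib_left mult_ac)
    finally show ?thesis using N0 by (simp add: power2_eq_iff_nonneg)
  qed
  have N_monom: "N (monom 1 k * p) = N p" for k p
    by (induction k) (simp_all add: monom_Suc N_shift)
  define E where "E n = smult (1 / real n) (\<Sum>k<n. monom 1 k)" for n
  have N_E: "N (E n * p) \<le> N p" for n p
  proof (cases "n = 0")
    case False
    have "N ((\<Sum>k<n. monom 1 k) * p) \<le> real n * N p" for n
    proof (induction n)
      case 0 then show ?case using N_smult[of 0 p] by simp
    next
      case (Suc n)
      then show ?case using N_add[of "(\<Sum>k<n. monom 1 k) * p" "monom 1 n * p"] N_monom[of n p]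
        by (simp add: distrib_right)
    qed
    then show ?thesis using False by (simp add: E_def N_smult field_simps)
  qed (use N0 N_smult[of 0 p] in \<open>simp add: E_def\<close>)
  have E1: "poly (E n) 1 = 1" if "n > 0" for n
    using that by (simp add: E_def poly_sum poly_monom)
  have E_tel: "E n * [:-1, 1:] = smult (1 / real n) (monom 1 n - 1)" for n
  proof -
    have "(\<Sum>k<n. monom 1 k) * [:-1, 1:] = monom (1::real) n - 1"
      using power_diff_1_eq[of "[:0, 1::real:]" n] by (simp add: monom_altdef one_pCons mult.commute)
    then show ?thesis by (simp only: E_def mult_smult_left)
  qed
  \<comment> \<open>\<open>p - 1\<close> is divisible by the variable minus 1, and multiplying
    \<open>E n\<close> by that factor telescopes to two terms of weight
    \<open>1 / n\<close>.\<close>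
  have close: "(\<lambda>n. N (E n * p - E n)) \<longlonglongrightarrow> 0" if p: "poly p 1 = 1" for p
  proof -
    have "poly (p - 1) 1 = 0" using p by simp
    then obtain r where r: "p - 1 = [:-1, 1:] * r" using poly_eq_0_iff_dvd by blast
    have le: "N (E n * p - E n) \<le> 2 * N r / real n" for n
    proof -
      have "E n * p - E n = smult (1 / real n) (monom 1 n * r + smult (-1) r)"
      proof -
        have "E n * p - E n = E n * (p - 1)" by (simp add: right_diff_distrib)
        also have "\<dots> = (E n * [:-1, 1:]) * r" by (simp only: r mult.assoc)
        also have "\<dots> = smult (1 / real n) (monom 1 n * r - r)" by (simp only: E_tel mult_smult_left left_diff_distrib mult_1)
        finally show ?thesis by simp
      qed
      then have "N (E n * p - E n) = 1 / real n * N (monom 1 n * r + smult (-1) r)"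
        by (simp only: N_smult) simp
      also have "\<dots> \<le> 1 / real n * (N r + N r)"
        using N_add[of "monom 1 n * r" "smult (-1) r"] by (intro mult_left_mono) (simp_all only: N_monom N_smult, simp_all)
      finally show ?thesis by simp
    qed
    have lim: "(\<lambda>n. 2 * N r / real n) \<longlonglongrightarrow> 0" by (rule lim_const_over_n)
    show ?thesis
      by (rule tendsto_sandwich[OF _ _ tendsto_const lim]) (simp_all add: N0 le)
  qed
  define m where "m = Inf (N ` {p. poly p 1 = 1})"
  have bdd: "bdd_below (N ` {p. poly p 1 = 1})" using N0 by (auto intro!: bdd_belowI[of _ 0])
  have m: "m \<le> N p" if "poly p 1 = 1" for p unfolding m_def using that bdd by (auto intro: cInf_lower)
  have m0: "m \<ge> 0" unfolding m_def using N0 by (intro cInf_greatest) (auto intro: exI[of _ 1])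
  show ?thesis
  proof (rule metric_CauchyI)
    fix e :: real assume e: "e > 0"
    \<comment> \<open>The parallelogram estimate yields \<open>4 * d * (2 * m + d)\<close>, which
      has to stay below \<open>(e / 3)\<^sup>2\<close>; hence 36 = 4 * 9, and
      \<open>d \<le> 1\<close> replaces the inner \<open>d\<close> by 1.\<close>
    define d where "d = min 1 (e\<^sup>2 / (36 * (2 * m + 1)))"
    have "d \<le> e\<^sup>2 / (36 * (2 * m + 1))" "0 < 36 * (2 * m + 1)" using m0 by (auto simp: d_def)
    then have "d * (36 * (2 * m + 1)) \<le> e\<^sup>2" by (simp add: pos_le_divide_eq)
    then have d: "d > 0" "d \<le> 1" "36 * (d * (2 * m + 1)) \<le> e\<^sup>2"
      using e m0 by (auto simp: d_def algebra_simps intro!: divide_pos_pos)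
    have "\<exists>p. poly p 1 = 1 \<and> N p < m + d"
    proof (rule ccontr)
      assume "\<not> ?thesis"
      then have "m + d \<le> m" unfolding m_def by (intro cInf_greatest) (auto intro: exI[of _ 1] simp: not_less m_def)
      then show False using d by simp
    qed
    then obtain p where p: "poly p 1 = 1" "N p < m + d" by blast
    from LIMSEQ_D[OF close[OF p(1)], of "e / 3"] obtain M0 where M0: "\<And>n. n \<ge> M0 \<Longrightarrow> N (E n * p - E n) < e / 3"
      using e N0 by auto
    have pp: "N (E i * p - E j * p) \<le> e / 3" if "i > 0" "j > 0" for i j
    proof -
      have 1: "N (E i * p) \<le> m + d" "N (E j * p) \<le> m + d" using N_E[of _ p] p(2) by (meson less_imp_le order_trans)+
      \<comment> \<open>The midpoint of two averages of \<open>p\<close> still has value 1 at 1, so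
        it cannot fall below the infimum.\<close>
      have "m \<le> N (smult (1/2) (E i * p + E j * p))" by (rule m) (simp add: E1 that p)
      then have "(2 * m)\<^sup>2 \<le> (N (E i * p + E j * p))\<^sup>2" using m0 by (intro power_mono) (auto simp: N_smult)
      moreover have "(N (E i * p))\<^sup>2 \<le> (m + d)\<^sup>2" "(N (E j * p))\<^sup>2 \<le> (m + d)\<^sup>2" using 1 N0 by (auto intro: power_mono)
      ultimately have "(N (E i * p - E j * p))\<^sup>2 \<le> 4 * (m + d)\<^sup>2 - 4 * m\<^sup>2"
        using N_par[of "E i * p" "E j * p"] by (simp add: power_mult_distrib)
      also have "\<dots> = 4 * (d * (2 * m + d))" by (simp add: power2_eq_square algebra_simps)
      also have "\<dots> \<le> 4 * (d * (2 * m + 1))" using d by simp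
      also have "\<dots> \<le> (e / 3)\<^sup>2" using d by (simp add: power_divide)
      finally show ?thesis by (rule power2_le_imp_le) (use e in simp)
    qed
    have "dist ((1 / real i) *\<^sub>R (\<Sum>k<i. w k x)) ((1 / real j) *\<^sub>R (\<Sum>k<j. w k x)) < e" if "i > M0" "j > M0" for i j
    proof -
      have cE: "?c (E n) x = (1 / real n) *\<^sub>R (\<Sum>k<n. w k x)" for n
      proof -
        have "?c (\<Sum>k<n. monom 1 k) x = (\<Sum>k<n. w k x)"
        proof (induction n)
          case 0 then show ?case by (simp add: poly_comb_def)
        next
          case (Suc n)
          have "?c (monom 1 n) x = w n x"
            by (simp add: poly_comb_def degree_monom_eq if_distrib[of "\<lambda>c. c *\<^sub>R _"] cong: if_cong)
          then show ?case using Suc by (simp add: poly_comb_add)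
        qed
        then show ?thesis by (simp add: E_def poly_comb_smult)
      qed
      have "E i - E j = (smult (-1) (E i * p - E i)) + ((E i * p - E j * p) + (E j * p - E j))" by simp
      then have "N (E i - E j) \<le> N (smult (-1) (E i * p - E i)) + (N (E i * p - E j * p) + N (E j * p - E j))"
        using N_add by (metis add_left_mono order_trans)
      also have "\<dots> < e / 3 + (e / 3 + e / 3)"
        using M0[of i] M0[of j] pp[of i j] that by (intro add_less_le_mono add_le_less_mono) (auto simp only: N_smult, auto)
      finally have "N (E i - E j) < e" by simp
      moreover have "norm (?c (E i - E j) x) \<le> N (E i - E j)"
        unfolding N_def using P x by (intro member_le_L2_set) auto
      ultimately show ?thesis by (simp add: cE dist_norm poly_comb_diff)
    qed
    then show "\<exists>M. \<forall>i\<ge>M. \<forall>j\<ge>M. dist ((1 / real i) *\<^sub>R (\<Sum>k<i. w k x)) ((1 / real j) *\<^sub>R (\<Sum>k<j. w k x)) < e"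
      by (metis Suc_le_lessD)
  qed
qed

subsection \<open>The Hilbert--Schmidt norm per unit cell\<close>

text \<open>
  Conjugation by \<open>e\<^sup>i\<^sup>t\<^sup>J\<close> preserves the Hilbert--Schmidt norm per period of a periodic operator, because
  that norm is invariant under taking adjoints. This makes the mean ergodic theorem applicable to
  the averages of \<open>e\<^sup>i\<^sup>t\<^sup>J A e\<^sup>-\<^sup>i\<^sup>t\<^sup>J\<close>.
\<close>

definition unit_at :: "int \<times> 'm \<Rightarrow> 'm::finite l2" where
  "unit_at y = single (fst y) (axis (snd y) 1)"

lemma cinner_unit_at:
  fixes u :: "'m::finite l2"
  shows "cinner (unit_at y) u = l2_nth u (fst y) $ snd y"
proof (rule complex_eqI)
  have 1: "inner (axis i 1) x = Re (x $ i)" "inner (axis i \<i>) x = Im (x $ i)" for x :: "complex ^ 'm" and i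
    by (simp_all add: inner_axis' inner_complex_def)
  have "\<i> *s axis i 1 = (axis i \<i> :: complex ^ 'm)" for i by (simp add: vec_eq_iff axis_def)
  then show "Re (cinner (unit_at y) u) = Re (l2_nth u (fst y) $ snd y)"
    "Im (cinner (unit_at y) u) = Im (l2_nth u (fst y) $ snd y)"
    by (simp_all add: cinner_eq unit_at_def inner_single 1)
qed

lemma cinner_commute: "cinner u v = cnj (cinner v u)"
  using inner_cscale_i[of u v] by (simp add: cinner_eq complex_eq_iff inner_commute)

text \<open>Parseval for the unit vectors, with each site written as \<open>r + q * l\<close> for
  \<open>r\<close> in the first period; this separates the finite sum over a cell from the sum over
  translations.\<close>

lemma norm_l2_sq_cells:
  fixes u :: "'m::finite l2"
  assumes q: "q > 0"
  shows "(norm u)\<^sup>2 = (\<Sum>y\<in>{0..<int q} \<times> UNIV. \<Sum>\<^sub>\<infinity>l. (cmod (cinner (unit_at (fst y + int q * l, snd y)) u))\<^sup>2)"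
proof -
  define f where "f = (\<lambda>(n, i). (cmod (l2_nth u n $ i))\<^sup>2)"
  define h :: "(int \<times> 'm) \<times> int \<Rightarrow> int \<times> 'm" where "h = (\<lambda>((r, i), l). (r + int q * l, i))"
  have h: "bij_betw h (({0..<int q} \<times> UNIV) \<times> UNIV) (UNIV \<times> UNIV)"
    by (rule bij_betwI[where g = "\<lambda>(n, i). ((n mod int q, i), n div int q)"]) (use q in \<open>auto simp: h_def\<close>)
  have nsq: "(norm x)\<^sup>2 = (\<Sum>i\<in>UNIV. (cmod (x $ i))\<^sup>2)" for x :: "complex ^ 'm"
    by (simp add: norm_vec_def L2_set_def sum_nonneg)
  have hs: "((\<lambda>i. f (n, i)) has_sum (norm (l2_nth u n))\<^sup>2) UNIV" for n
    by (simp add: f_def nsq)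
  have sm: "f summable_on (UNIV \<times> UNIV)"
    by (rule summable_on_SigmaI[OF hs l2_summable]) (simp add: f_def)
  have "(norm u)\<^sup>2 = infsum f (UNIV \<times> UNIV)"
    unfolding norm_l2_sq infsum_Sigma_banach[OF sm, symmetric]
    using infsumI[OF hs] by simp
  also have "\<dots> = infsum (\<lambda>x. f (h x)) (({0..<int q} \<times> UNIV) \<times> UNIV)"
    by (rule infsum_reindex_bij_betw[OF h, symmetric])
  also have "\<dots> = (\<Sum>\<^sub>\<infinity>y\<in>{0..<int q} \<times> UNIV. \<Sum>\<^sub>\<infinity>l. f (h (y, l)))"
    by (rule infsum_Sigma_banach[symmetric]) (use sm summable_on_reindex_bij_betw[OF h, of f] in auto)
  finally show ?thesis by (simp add: f_def h_def cinner_unit_at split_beta)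
qed

context periodic_jacobi
begin

definition cell :: "(int \<times> 'm) set" where "cell = {0..<int q} \<times> UNIV"

lemma finite_cell: "finite cell" by (simp add: cell_def)

definition shift :: "int \<Rightarrow> 'm l2 \<Rightarrow> 'm l2" where "shift l = bandop (\<lambda>n x. x) (- (int q * l))"

lemma shift_nth: "l2_nth (shift l u) n = l2_nth u (n - int q * l)"
  by (simp add: shift_def bandop_nth[OF linear_family_id])

lemma shift_unit: "shift l (unit_at (n, i)) = unit_at (n + int q * l, i)"
  by (rule l2_eqI) (auto simp: shift_nth unit_at_def single.rep_eq)

lemma shift_commute:
  assumes "\<And>u. C (S u) = S (C u)"
  shows "C (shift l u) = shift l (C u)"
proof (induction l rule: int_induct[where k = 0])
  case base
  have "shift 0 = id" by (auto simp: fun_eq_iff shift_nth intro!: l2_eqI)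
  then show ?case by simp
next
  case (step1 i)
  have "shift (i + 1) v = S (shift i v)" for v
    by (rule l2_eqI) (simp add: nth_simps shift_nth algebra_simps)
  then show ?case by (simp add: assms step1)
next
  case (step2 i)
  have *: "shift (i - 1) v = S' (shift i v)" for v
    by (rule l2_eqI) (simp add: nth_simps shift_nth algebra_simps)
  have "C (S' v) = S' (C v)" for v by (metis S_S' assms)
  then show ?case by (simp add: * step2)
qed

lemma cinner_shift: "cinner (shift l u) (shift l v) = cinner u v"
proof -
  have "inner (shift l u) (shift l v) = inner u v" for u v
    using infsum_shift[of "\<lambda>n. inner (l2_nth u n) (l2_nth v n)" "- (int q * l)"]
    by (simp add: inner_l2_def shift_nth)
  moreover have "cscale c (shift l u) = shift l (cscale c u)" for c
    by (rule l2_eqI) (simp add: shift_nth cscale.rep_eq)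
  ultimately show ?thesis by (simp add: cinner_eq)
qed

definition HS :: "('m l2 \<Rightarrow> 'm l2) \<Rightarrow> real" where "HS C = (\<Sum>x\<in>cell. (norm (C (unit_at x)))\<^sup>2)"

text \<open>The entry of \<open>C'\<close> between \<open>x\<close> and the \<open>l\<close>-th
  translate of \<open>y\<close> is conjugate to an entry of \<open>C\<close>, which periodicity
  moves to the one between \<open>y\<close> and the translate of \<open>x\<close> by
  \<open>- l\<close>. Summing over \<open>l\<close> and both cell indices gives the same
  total.\<close>

lemma HS_adjoint:
  assumes C: "bounded_operator C" and C': "bounded_operator C'"
    and adj: "\<And>u v. inner (C u) v = inner u (C' v)" and CS: "\<And>u. C (S u) = S (C u)"
  shows "HS C = HS C'"
proof -
  define sh where "sh l y = (fst y + int q * l, snd y)" for l :: int and y :: "int \<times> 'm"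
  have sh: "unit_at (sh l y) = shift l (unit_at y)" for l y using shift_unit[of l "fst y" "snd y"] by (simp add: sh_def)
  have cadj: "cinner (C u) v = cinner u (C' v)" for u v
    using adj bounded_operatorD(2)[OF C] by (simp add: cinner_eq flip: adj)
  have N: "HS D = (\<Sum>x\<in>cell. \<Sum>y\<in>cell. \<Sum>\<^sub>\<infinity>l. (cmod (cinner (unit_at (sh l y)) (D (unit_at x))))\<^sup>2)" for D
    unfolding HS_def cell_def sh_def by (intro sum.cong refl norm_l2_sq_cells) (use q in auto)
  have "(\<Sum>\<^sub>\<infinity>l. (cmod (cinner (unit_at (sh l y)) (C' (unit_at x))))\<^sup>2) =
     (\<Sum>\<^sub>\<infinity>l. (cmod (cinner (unit_at (sh l x)) (C (unit_at y))))\<^sup>2)" for x y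
  proof -
    have "cmod (cinner (unit_at (sh l y)) (C' (unit_at x))) = cmod (cinner (unit_at (sh (- l) x)) (C (unit_at y)))" for l
    proof -
      have inv: "shift (- l) (shift l u) = u" for u by (rule l2_eqI) (simp add: shift_nth)
      have "cinner (unit_at (sh l y)) (C' (unit_at x)) = cinner (shift l (C (unit_at y))) (unit_at x)"
        by (simp add: sh flip: cadj shift_commute[of C, OF CS])
      also have "\<dots> = cinner (C (unit_at y)) (shift (- l) (unit_at x))"
        using cinner_shift[of "- l" "shift l (C (unit_at y))" "unit_at x"] by (simp add: inv)
      finally show ?thesis by (metis sh cinner_commute complex_mod_cnj)
    qed
    moreover have "bij_betw uminus UNIV (UNIV :: int set)" by (rule bij_betwI[where g = uminus]) auto
    ultimately show ?thesis
      using infsum_reindex_bij_betw[of uminus UNIV UNIV "\<lambda>l. (cmod (cinner (unit_at (sh l x)) (C (unit_at y))))\<^sup>2"] by simp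
  qed
  then show ?thesis unfolding N by (simp only:) (rule sum.swap)
qed

text \<open>A unitary on the left changes no norm; the one on the right is brought to the left by
  passing to the adjoint, which is where self-adjointness and periodicity of \<open>B\<close>
  enter.\<close>

lemma HS_conjugate:
  assumes B: "bounded_selfadjoint B" and BS: "\<And>u. B (S u) = S (B u)"
  shows "HS (\<lambda>u. U t (B (U (- t) u))) = HS B"
proof -
  have bo: "bounded_operator (\<lambda>u. U s (B u))" "bounded_operator (\<lambda>u. B (U s u))" for s
    using bounded_selfadjointD[OF B]
    by (auto intro!: bounded_operatorI bounded_linear_compose[OF bounded_linear_U] bounded_linear_compose[of B, OF _ bounded_linear_U]
        simp: U_cscale)
  have "HS (\<lambda>u. U t (B (U (- t) u))) = HS (\<lambda>u. B (U (- t) u))" by (simp add: HS_def)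
  also have "\<dots> = HS (\<lambda>u. U t (B u))"
    by (rule HS_adjoint[OF bo(2,1)])
       (use U_adjoint[of "- t"] in \<open>simp_all add: bounded_selfadjointD[OF B] U_S BS\<close>)
  finally show ?thesis by (simp add: HS_def)
qed

lemma selfadjoint_conjugate:
  assumes B: "bounded_selfadjoint B"
  shows "bounded_selfadjoint (\<lambda>u. U t (B (U (- t) u)))"
proof (intro bounded_selfadjointI bounded_operatorI)
  show "bounded_linear (\<lambda>u. U t (B (U (- t) u)))"
    by (intro bounded_linear_compose[OF bounded_linear_U] bounded_linear_compose[OF bounded_selfadjointD(2)[OF B]] bounded_linear_U)
qed (simp_all add: U_cscale bounded_selfadjointD[OF B] U_adjoint)

section \<open>Convergence of the time averages of the velocity\<close>

definition A1 :: "'m l2 \<Rightarrow> 'm l2" where "A1 = evint A 1"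

lemmas A_linear = bounded_selfadjointD(2)[OF A_selfadjoint]

lemma A1_selfadjoint: "bounded_selfadjoint A1"
proof (intro bounded_selfadjointI bounded_operatorI)
  show "bounded_linear A1" unfolding A1_def by (rule evint_bounded_linear[OF A_linear])
  show "A1 (cscale \<i> u) = cscale \<i> (A1 u)" for u
    unfolding A1_def by (rule evint_commute[OF A_linear bounded_linear_cscale])
      (simp_all add: U_cscale bounded_selfadjointD[OF A_selfadjoint])
  show "inner (A1 u) v = inner u (A1 v)" for u v
    unfolding A1_def by (rule evint_adjoint[OF A_linear A_linear]) (rule bounded_selfadjointD[OF A_selfadjoint])
qed

lemma evint_S: "evint A t (S u) = S (evint A t u)"
  by (rule evint_commute[OF A_linear]) (simp_all add: bounded_operatorD bounded_operators U_S A_S)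

text \<open>The contribution of the time interval \<open>[k, k + 1]\<close>: the stationary sequence
  to which the discrete mean ergodic theorem is applied.\<close>

definition Ak :: "nat \<Rightarrow> 'm l2 \<Rightarrow> 'm l2" where "Ak k u = U (real k) (A1 (U (- real k) u))"

lemma evint_eq_sum: "evint A (real n) u = (\<Sum>k<n. Ak k u)"
proof (induction n)
  case 0 then show ?case by (simp add: evint_def)
next
  case (Suc n)
  have "evint A (real n + 1) u = evint A (real n) u + U (real n) (evint A 1 (U (- real n) u))"
    by (rule evint_cocycle[OF A_linear]) auto
  then show ?case using Suc by (simp add: Ak_def A1_def add.commute)
qed

lemma Ak_selfadjoint: "bounded_selfadjoint (Ak k)"
  unfolding Ak_def[abs_def] by (rule selfadjoint_conjugate[OF A1_selfadjoint])

lemma Ak_S: "Ak k (S u) = S (Ak k u)"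
  by (simp add: Ak_def A1_def U_S evint_S)

lemma Ak_Suc: "Ak (Suc k) u = U 1 (Ak k (U (- 1) u))"
  by (simp add: Ak_def U_add[symmetric] add.commute)

text \<open>\<open>HS\<close> is a quadratic form, so inner products follow by polarization; sums of
  the \<open>Ak\<close> are self-adjoint again, as invariance under conjugation demands.\<close>

lemma Ak_stationary:
  "(\<Sum>x\<in>cell. inner (Ak (Suc j) (unit_at x)) (Ak (Suc k) (unit_at x))) = (\<Sum>x\<in>cell. inner (Ak j (unit_at x)) (Ak k (unit_at x)))"
proof -
  have sa: "bounded_selfadjoint (\<lambda>u. Ak j u + Ak k u)" for j k
    using bounded_selfadjointD[OF Ak_selfadjoint]
    by (intro bounded_selfadjointI bounded_operatorI bounded_linear_add)
      (simp_all add: inner_add_left inner_add_right)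
  have 1: "HS (\<lambda>u. Ak (Suc j) u + Ak (Suc k) u) = HS (\<lambda>u. Ak j u + Ak k u)"
    using HS_conjugate[OF sa, of j k 1] by (simp add: Ak_Suc U_linear Ak_S linear_simps[OF bounded_operatorD(1)[OF bounded_operators(4)]])
  have 2: "HS (Ak (Suc i)) = HS (Ak i)" for i
    using HS_conjugate[OF Ak_selfadjoint, of i 1] by (simp add: Ak_Suc[abs_def] Ak_S)
  have gram: "(\<Sum>x\<in>cell. inner (Ak j (unit_at x)) (Ak k (unit_at x))) = (HS (\<lambda>u. Ak j u + Ak k u) - HS (Ak j) - HS (Ak k)) / 2" for j k
    unfolding HS_def dot_norm by (simp only: sum_divide_distrib[symmetric] sum_subtractf)
  show ?thesis unfolding gram 1 2 ..
qed

definition avg :: "('m l2 \<Rightarrow> 'm l2) \<Rightarrow> real \<Rightarrow> 'm l2 \<Rightarrow> 'm l2" where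
  "avg B t u = (1 / t) *\<^sub>R evint B t u"

lemma avg_bound:
  assumes "bounded_linear B" "\<And>u. norm (B u) \<le> K * norm u" "t \<ge> 0"
  shows "norm (avg B t u) \<le> K * norm u"
proof (cases "t = 0")
  case True
  then show ?thesis using order_trans[OF norm_ge_zero assms(2)[of u]] by (simp add: avg_def)
next
  case False
  then show ?thesis using evint_bound[OF assms] assms(3) by (simp add: avg_def field_simps)
qed

lemma avg_linear:
  assumes "bounded_linear B"
  shows "avg B t (u + v) = avg B t u + avg B t v" "avg B t (u - v) = avg B t u - avg B t v"
    "avg B t (r *\<^sub>R u) = r *\<^sub>R avg B t u"
  using linear_simps[OF evint_bounded_linear[OF assms]] by (auto simp: avg_def scaleR_right_distrib scaleR_diff_right)

lemma A_bound: obtains K where "K > 0" "\<And>u. norm (A u) \<le> K * norm u"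
  using bounded_linear.pos_bounded[OF A_linear] by (metis mult.commute)

text \<open>The ergodic theorem treats the unit vectors of one cell; translations, complex
  multiples, sums and closedness of the set of convergence extend the result to all vectors.\<close>

lemma avg_A_convergent: "convergent (\<lambda>n. avg A (real n) u)"
proof -
  obtain K where K: "K > 0" "\<And>u. norm (A u) \<le> K * norm u" using A_bound by blast
  let ?P = "\<lambda>u. convergent (\<lambda>n. avg A (real n) u)"
  have 1: "?P (unit_at x)" if "x \<in> cell" for x
    using mean_ergodic_stationary[OF finite_cell, of "\<lambda>k x. Ak k (unit_at x)", OF Ak_stationary that]
    by (simp add: avg_def evint_eq_sum Cauchy_convergent)
  have 2: "?P (shift l u)" if "?P u" for l u
  proof -
    have "avg A (real n) (shift l u) = shift l (avg A (real n) u)" for n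
      by (rule shift_commute) (simp add: avg_def evint_S linear_simps[OF bounded_operatorD(1)[OF bounded_operators(4)]])
    moreover have "bounded_linear (shift l)"
      unfolding shift_def by (rule bounded_operatorD bandop_bounded linear_family_id)+
    ultimately show ?thesis using that bounded_linear.convergent by fastforce
  qed
  have unit: "?P (unit_at x)" for x
  proof -
    obtain n i where x: "x = (n, i)" by force
    have "unit_at x = shift (n div int q) (unit_at (n mod int q, i))" by (simp add: shift_unit x)
    moreover have "(n mod int q, i) \<in> cell" using q by (simp add: cell_def)
    ultimately show ?thesis using 1 2 by metis
  qed
  show ?thesis
  proof (rule l2_dense_induct[where P = ?P])
    show "closed {u. ?P u}"
      by (rule closed_convergent[where K = K]) (auto simp: avg_linear[OF A_linear] intro: avg_bound[OF A_linear K(2)])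
    show "?P 0" using avg_linear(3)[OF A_linear, of _ 0 0] by (simp add: convergent_const)
    show add: "?P (u + v)" if "?P u" "?P v" for u v
      using convergent_add[OF that] by (simp add: avg_linear[OF A_linear])
    show "?P (single k x)" for k x
    proof -
      have "single k x = (\<Sum>i\<in>UNIV. cscale (x $ i) (unit_at (k, i)))"
      proof -
        have "x = (\<Sum>i\<in>UNIV. x $ i *s axis i 1)" by (simp add: basis_expansion)
        then have "single k x = single k (\<Sum>i\<in>UNIV. x $ i *s axis i 1)" by simp
        also have "\<dots> = (\<Sum>i\<in>UNIV. single k (x $ i *s axis i 1))" by (rule linear_sum[OF single_linear])
        finally show ?thesis by (simp add: unit_at_def)
      qed
      moreover have cs: "?P (cscale c (unit_at y))" for c y
      proof -
        have "avg A (real n) (cscale c u) = cscale c (avg A (real n) u)" for n u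
          unfolding avg_def
          by (subst evint_commute[OF A_linear bounded_linear_cscale, of c]) (auto simp: U_cscale bounded_selfadjointD[OF A_selfadjoint])
        then show ?thesis using bounded_linear.convergent[OF bounded_linear_cscale unit[of y]] by simp
      qed
      moreover have "?P (\<Sum>i\<in>F. cscale (x $ i) (unit_at (k, i)))" if "finite F" for F
        using that by (induction F rule: finite_induct) (auto intro: add cs \<open>?P 0\<close>)
      ultimately show ?thesis by simp
    qed
  qed
qed

section \<open>The asymptotic velocity operator\<close>

definition Q :: "'m l2 \<Rightarrow> 'm l2" where "Q u = lim (\<lambda>n. avg A (real n) u)"

text \<open>Rounding \<open>t\<close> down to an integer changes the integral by a piece of length
  at most 1, which is negligible after division by \<open>t\<close>.\<close>

lemma avg_Q: "((\<lambda>t. avg A t u) \<longlongrightarrow> Q u) at_top"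
proof -
  obtain K where K: "K > 0" "\<And>u. norm (A u) \<le> K * norm u" using A_bound by blast
  have 1: "(\<lambda>n. avg A (real n) u) \<longlonglongrightarrow> Q u"
    unfolding Q_def using avg_A_convergent convergent_LIMSEQ_iff by blast
  have fl: "filterlim (\<lambda>t::real. nat \<lfloor>t\<rfloor>) sequentially at_top"
    by (intro filterlim_compose[OF filterlim_nat_sequentially filterlim_floor_sequentially])
  have 2: "((\<lambda>t::real. real (nat \<lfloor>t\<rfloor>) / t) \<longlongrightarrow> 1) at_top"
  proof (rule tendsto_sandwich[where f = "\<lambda>t. 1 - 1 / t" and h = "\<lambda>_. 1"])
    have "1 - 1 / t \<le> real (nat \<lfloor>t\<rfloor>) / t" if "t > 0" for t :: real
    proof -
      have "t - 1 \<le> real (nat \<lfloor>t\<rfloor>)" by linarith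
      from divide_right_mono[OF this, of t] show ?thesis using that by (simp add: diff_divide_distrib)
    qed
    then show "\<forall>\<^sub>F t in at_top. 1 - 1 / t \<le> real (nat \<lfloor>t\<rfloor>) / t"
      by (rule eventually_mono[OF eventually_gt_at_top[of 0]])
    show "\<forall>\<^sub>F t::real in at_top. real (nat \<lfloor>t\<rfloor>) / t \<le> 1"
      using eventually_gt_at_top[of "0::real"] by eventually_elim (simp add: field_simps)
    show "((\<lambda>t::real. 1 - 1 / t) \<longlongrightarrow> 1) at_top" by real_asymp
  qed simp
  have "((\<lambda>t::real. (real (nat \<lfloor>t\<rfloor>) / t) *\<^sub>R avg A (real (nat \<lfloor>t\<rfloor>)) u) \<longlongrightarrow> 1 *\<^sub>R Q u) at_top"
    by (intro tendsto_scaleR 2 filterlim_compose[OF 1 fl])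
  moreover have "((\<lambda>t::real. avg A t u - (real (nat \<lfloor>t\<rfloor>) / t) *\<^sub>R avg A (real (nat \<lfloor>t\<rfloor>)) u) \<longlongrightarrow> 0) at_top"
  proof (rule Lim_null_comparison)
    show "((\<lambda>t::real. (1 / t) * (K * norm u)) \<longlongrightarrow> 0) at_top" by real_asymp
    show "\<forall>\<^sub>F t in at_top. norm (avg A t u - (real (nat \<lfloor>t\<rfloor>) / t) *\<^sub>R avg A (real (nat \<lfloor>t\<rfloor>)) u) \<le> (1 / t) * (K * norm u)"
      using eventually_gt_at_top[of "1::real"]
    proof eventually_elim
      case (elim t)
      define n where "n = nat \<lfloor>t\<rfloor>"
      define s where "s = t - real n"
      have n: "n > 0" and s: "0 \<le> s" "s \<le> 1" and t: "t = real n + s" using elim by (auto simp: n_def s_def) linarith+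
      have "evint A t u = evint A (real n) u + U (real n) (evint A s (U (- real n) u))"
        unfolding t using s by (intro evint_cocycle[OF A_linear]) auto
      then have "avg A t u - (real n / t) *\<^sub>R avg A (real n) u = (1 / t) *\<^sub>R U (real n) (evint A s (U (- real n) u))"
        using n by (simp add: avg_def scaleR_right_distrib)
      then have "norm (avg A t u - (real n / t) *\<^sub>R avg A (real n) u) = (1 / t) * norm (evint A s (U (- real n) u))"
        using elim by simp
      also have "\<dots> \<le> (1 / t) * (s * (K * norm u))"
        using evint_bound[OF A_linear K(2) s(1), of "U (- real n) u"] elim by (intro mult_left_mono) auto
      also have "\<dots> \<le> (1 / t) * (1 * (K * norm u))"
        using s K(1) elim by (intro mult_left_mono mult_right_mono) auto
      finally show ?case by (simp add: n_def)
    qed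
  qed
  ultimately show ?thesis using Lim_transform by fastforce
qed

lemma heis_Q:
  assumes \<psi>: "\<psi> \<in> pos_dom"
  shows "((\<lambda>t. (1 / t) *\<^sub>R heis_op J t \<psi>) \<longlongrightarrow> Q \<psi>) at_top"
proof -
  have "((\<lambda>t. (1 / t) *\<^sub>R pos_op \<psi> + avg A t \<psi>) \<longlongrightarrow> 0 *\<^sub>R pos_op \<psi> + Q \<psi>) at_top"
    by (intro tendsto_add avg_Q tendsto_scaleR tendsto_const) real_asymp
  moreover have "\<forall>\<^sub>F t in at_top. (1 / t) *\<^sub>R pos_op \<psi> + avg A t \<psi> = (1 / t) *\<^sub>R heis_op J t \<psi>"
    using eventually_ge_at_top[of 0] by eventually_elim (simp add: heis_eq[OF \<psi>] avg_def scaleR_right_distrib)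
  ultimately show ?thesis by (auto intro: Lim_transform_eventually)
qed

lemma Q_commute:
  assumes D: "bounded_linear D" and DU: "\<And>t u. D (U t u) = U t (D u)" and DA: "\<And>u. D (A u) = A (D u)"
  shows "Q (D u) = D (Q u)"
proof -
  have "avg A t (D u) = D (avg A t u)" for t
    unfolding avg_def by (simp add: evint_commute[OF A_linear D DU DA] linear_simps[OF D])
  then have "((\<lambda>t. avg A t (D u)) \<longlongrightarrow> D (Q u)) at_top"
    using bounded_linear.tendsto[OF D avg_Q] by simp
  then show ?thesis using avg_Q tendsto_unique trivial_limit_at_top_linorder by blast
qed

lemma Q_bound: obtains K where "K > 0" "\<And>u. norm (Q u) \<le> K * norm u" "\<And>t u. t \<ge> 0 \<Longrightarrow> norm (avg A t u) \<le> K * norm u"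
proof -
  obtain K where K: "K > 0" "\<And>u. norm (A u) \<le> K * norm u" using A_bound by blast
  have 1: "norm (avg A t u) \<le> K * norm u" if "t \<ge> 0" for t u by (rule avg_bound[OF A_linear K(2) that])
  have "norm (Q u) \<le> K * norm u" for u
    by (rule tendsto_upperbound[OF tendsto_norm[OF avg_Q]])
      (auto intro: eventually_mono[OF eventually_ge_at_top[of 0]] 1)
  then show ?thesis using that K(1) 1 by blast
qed

lemma Q_selfadjoint: "bounded_selfadjoint Q"
proof (intro bounded_selfadjointI bounded_operatorI)
  obtain K where K: "K > 0" "\<And>u. norm (Q u) \<le> K * norm u" using Q_bound by metis
  have add: "Q (u + v) = Q u + Q v" for u v
    using tendsto_add[OF avg_Q[of u] avg_Q[of v]] avg_Q[of "u + v"]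
    by (auto simp: avg_linear[OF A_linear] intro: tendsto_unique[OF trivial_limit_at_top_linorder])
  have sc: "Q (r *\<^sub>R u) = r *\<^sub>R Q u" for r u
    using tendsto_scaleR[OF tendsto_const avg_Q[of u]] avg_Q[of "r *\<^sub>R u"]
    by (auto simp: avg_linear[OF A_linear] intro: tendsto_unique[OF trivial_limit_at_top_linorder])
  show "bounded_linear Q"
    by (rule bounded_linear_intro[of _ K]) (use add sc K in \<open>auto simp: mult.commute\<close>)
  show "Q (cscale \<i> u) = cscale \<i> (Q u)" for u
    by (rule Q_commute) (auto simp: bounded_linear_cscale U_cscale bounded_selfadjointD[OF A_selfadjoint])
  show "inner (Q u) v = inner u (Q v)" for u v
  proof -
    have "inner (avg A t u) v = inner u (avg A t v)" for t
      by (simp add: avg_def evint_adjoint[OF A_linear A_linear bounded_selfadjointD(4)[OF A_selfadjoint]])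
    then show ?thesis
      using tendsto_inner[OF avg_Q[of u] tendsto_const[of v]] tendsto_inner[OF tendsto_const[of u] avg_Q[of v]]
      by (auto intro: tendsto_unique[OF trivial_limit_at_top_linorder])
  qed
qed

end

subsection \<open>Polynomials acting through a commuting operator\<close>

lemma cscale_minus: "cscale (- c) u = - cscale c u"
  using cscale_add_left[of c "- c" u] by (simp add: eq_neg_iff_add_eq_0 add.commute)

text \<open>Evaluation of a polynomial at \<open>T\<close>, with coefficients acting through
  \<open>f\<close>. Having the action as a parameter allows nesting: when \<open>f\<close> is itself
  evaluation at \<open>J\<close>, polynomials in \<open>S\<close> and \<open>J\<close> are
  one-variable polynomials over a polynomial ring, and division with remainder in \<open>S\<close>
  becomes available.\<close>

definition gact :: "('c::comm_ring_1 \<Rightarrow> 'v \<Rightarrow> 'v) \<Rightarrow> ('v \<Rightarrow> 'v) \<Rightarrow> 'c poly \<Rightarrow> 'v \<Rightarrow> 'v::ab_group_add" where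
  "gact f T p v = (\<Sum>i\<le>degree p. (T ^^ i) (f (coeff p i) v))"

locale operator_module =
  fixes f :: "'c::comm_ring_1 \<Rightarrow> 'v \<Rightarrow> 'v::ab_group_add" and T :: "'v \<Rightarrow> 'v"
  assumes f_add_right: "f c (u + v) = f c u + f c v" and f_add_left: "f (c + d) v = f c v + f d v"
    and f_mult: "f (c * d) v = f c (f d v)" and f_one: "f 1 v = v"
    and T_add: "T (u + v) = T u + T v" and T_f: "T (f c v) = f c (T v)"
begin

lemma f_zero: "f 0 v = 0" "f c 0 = 0" and T_zero: "T 0 = 0"
  using f_add_left[of 0 0 v] f_add_right[of c 0 0] T_add[of 0 0] by auto

lemma funpow_T_add: "(T ^^ i) (u + v) = (T ^^ i) u + (T ^^ i) v" and funpow_T_zero: "(T ^^ i) 0 = 0"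
  by (induction i) (simp_all add: T_add T_zero)

lemma gact_eq: "degree p \<le> n \<Longrightarrow> gact f T p v = (\<Sum>i\<le>n. (T ^^ i) (f (coeff p i) v))"
  unfolding gact_def by (rule sum.mono_neutral_left) (auto simp: coeff_eq_0 f_zero funpow_T_zero)

lemma T_sum: "T (sum g F) = (\<Sum>x\<in>F. T (g x))"
  by (induction F rule: infinite_finite_induct) (auto simp: T_add T_zero)

lemma gact_add_left: "gact f T (p + r) v = gact f T p v + gact f T r v"
  by (simp add: gact_eq[of _ "max (degree p) (degree r)"] degree_add_le f_add_left funpow_T_add sum.distrib)

lemma gact_add_right: "gact f T p (u + v) = gact f T p u + gact f T p v"
  by (simp add: gact_def f_add_right funpow_T_add sum.distrib)

lemma gact_pCons: "gact f T (pCons c p) v = f c v + T (gact f T p v)"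
proof -
  have "gact f T (pCons c p) v = (\<Sum>i\<le>Suc (degree p). (T ^^ i) (f (coeff (pCons c p) i) v))"
    by (rule gact_eq) (rule degree_pCons_le)
  then show ?thesis by (simp only: sum.atMost_Suc_shift) (simp add: gact_def T_sum)
qed

lemma gact_zero: "gact f T 0 v = 0" "gact f T p 0 = 0"
  using gact_add_left[of 0 0 v] gact_add_right[of p 0 0] by auto

lemma gact_commute:
  assumes "\<And>u v. C (u + v) = C u + C v" "\<And>c v. C (f c v) = f c (C v)" "\<And>v. C (T v) = T (C v)"
  shows "C (gact f T p v) = gact f T p (C v)"
proof (induction p)
  case 0
  then show ?case using assms(1)[of 0 0] by (simp add: gact_zero)
qed (simp add: gact_pCons assms)

lemma f_gact: "f c (gact f T p v) = gact f T p (f c v)"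
  by (rule gact_commute) (simp_all add: f_add_right T_f mult.commute flip: f_mult)

lemma T_gact: "T (gact f T p v) = gact f T p (T v)"
  by (rule gact_commute) (simp_all add: T_add T_f)

lemma gact_smult: "gact f T (smult c p) v = f c (gact f T p v)"
  by (induction p) (simp_all add: gact_zero f_zero gact_pCons f_mult f_add_right T_f)

lemma gact_mult: "gact f T (p * r) v = gact f T p (gact f T r v)"
  by (induction p) (simp_all add: gact_zero gact_pCons mult_pCons_left gact_add_left gact_smult f_zero)

lemma gact_one: "gact f T 1 v = v"
  by (simp add: one_pCons gact_pCons f_one gact_zero T_zero)

lemma gact_sum: "gact f T (sum g F) v = (\<Sum>x\<in>F. gact f T (g x) v)"
  by (induction F rule: infinite_finite_induct) (auto simp: gact_add_left gact_zero)

lemma gact_monom: "gact f T (monom c i) v = (T ^^ i) (f c v)"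
  by (induction i) (simp_all add: monom_0 monom_Suc gact_pCons gact_zero f_zero T_zero)

lemma operator_module_gact:
  assumes "\<And>u v. T' (u + v) = T' u + T' v" "\<And>c v. T' (f c v) = f c (T' v)" "\<And>v. T' (T v) = T (T' v)"
  shows "operator_module (gact f T) T'"
  by (intro operator_module.intro gact_add_right gact_add_left gact_mult gact_one assms(1)
      gact_commute assms)

end

lemma operator_module_scaleR: "linear T \<Longrightarrow> operator_module scaleR T"
  by standard (auto simp: scaleR_add_right scaleR_add_left linear_add linear_cmul)

lemma operator_module_cscale: "bounded_operator T \<Longrightarrow> operator_module cscale T"
  by standard (auto simp: bounded_operatorD cscale_add_left linear_simps[OF bounded_operatorD(1)])

text \<open>Over the complex numbers \<open>p\<close> splits into linear factors, and
  \<open>inj\<close> says that each factor acts injectively; induction on the degree removes one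
  root at a time.\<close>

lemma gact_cscale_injective:
  assumes T: "bounded_operator T" and inj: "\<And>z u. T u = cscale z u \<Longrightarrow> u = 0"
    and p: "p \<noteq> 0" and "gact cscale T p u = 0"
  shows "u = 0"
  using p assms(4)
proof (induction "degree p" arbitrary: p u rule: less_induct)
  case less
  interpret operator_module cscale T by (rule operator_module_cscale[OF T])
  show ?case
  proof (cases "degree p = 0")
    case True
    then obtain a where "p = [:a:]" "a \<noteq> 0" using less.prems(1) by (metis degree_eq_zeroE pCons_0_0)
    then have "cmod a * norm u = 0" using less.prems(2) by (simp add: gact_pCons gact_zero T_zero flip: norm_cscale)
    then show ?thesis using \<open>a \<noteq> 0\<close> by simp
  next
    case False
    then obtain z where "poly p z = 0" using fundamental_theorem_of_algebra constant_degree by metis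
    then obtain r where r: "p = [:- z, 1:] * r" by (metis dvdE poly_eq_0_iff_dvd)
    then have r0: "r \<noteq> 0" using less.prems(1) by auto
    have "degree r < degree p" unfolding r using r0 by (subst degree_mult_eq) auto
    moreover have "T (gact cscale T r u) = cscale z (gact cscale T r u)"
    proof -
      have "0 = cscale (- z) (gact cscale T r u) + T (gact cscale T r u)"
        using less.prems(2) unfolding r gact_mult by (simp add: gact_pCons gact_zero f_one T_zero f_zero)
      then show ?thesis by (simp add: cscale_minus)
    qed
    then have "gact cscale T r u = 0" by (rule inj)
    ultimately show ?thesis using less.hyps r0 by blast
  qed
qed

text \<open>Stated for families, so that repetitions count: two equal members give the relation with
  coefficients 1 and -1, and otherwise the dimension bound for the span applies.\<close>

lemma linear_dependence:
  fixes v :: "'i \<Rightarrow> 'a::real_vector"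
  assumes I: "finite I" and B: "finite B" "card B < card I" and v: "\<And>i. i \<in> I \<Longrightarrow> v i \<in> span B"
  obtains c where "\<exists>i\<in>I. c i \<noteq> 0" "(\<Sum>i\<in>I. c i *\<^sub>R v i) = 0"
proof (cases "inj_on v I")
  case True
  have "dependent (v ` I)"
    using independent_span_bound[OF B(1), of "v ` I"] v B(2) card_image[OF True] by force
  then obtain u where "\<exists>x\<in>v ` I. u x \<noteq> 0" "(\<Sum>x\<in>v ` I. u x *\<^sub>R x) = 0"
    using dependent_finite[of "v ` I"] I by auto
  then show ?thesis using that[of "u \<circ> v"] by (auto simp: sum.reindex[OF True])
next
  case False
  then obtain i j where ij: "i \<in> I" "j \<in> I" "i \<noteq> j" "v i = v j" by (auto simp: inj_on_def)
  define c :: "'i \<Rightarrow> real" where "c k = (if k = i then 1 else if k = j then - 1 else 0)" for k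
  have "(\<Sum>k\<in>I. c k *\<^sub>R v k) = (\<Sum>k\<in>{i, j}. c k *\<^sub>R v k)"
    by (rule sum.mono_neutral_right) (use I ij in \<open>auto simp: c_def\<close>)
  also have "\<dots> = 0" using ij by (simp add: c_def)
  finally have "(\<Sum>k\<in>I. c k *\<^sub>R v k) = 0" .
  moreover have "\<exists>k\<in>I. c k \<noteq> 0" using ij by (auto simp: c_def)
  ultimately show ?thesis by (rule that[rotated])
qed

context periodic_jacobi
begin

subsection \<open>Absence of eigenvalues\<close>

lemma a_injective: "a n *v x = 0 \<Longrightarrow> x = 0" and a_adjoint_injective: "conj_transpose (a n) *v x = 0 \<Longrightarrow> x = 0"
proof -
  have "invertible (a n)" using coeffs by (simp add: invertible_det_nz block_jacobi_coeffs_def)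
  then obtain B where B: "a n ** B = mat 1" "B ** a n = mat 1" by (auto simp: invertible_def)
  show "x = 0" if "a n *v x = 0"
    using B(2) that by (metis matrix_vector_mul_assoc matrix_vector_mul_lid matrix_vector_mult_0_right)
  show "x = 0" if "conj_transpose (a n) *v x = 0"
  proof -
    have "inner (a n *v (B *v x)) x = 0" by (simp only: inner_conj_transpose that inner_zero_right)
    then show ?thesis by (simp add: matrix_vector_mul_assoc B)
  qed
qed

text \<open>Both outer coefficients of the three-term recurrence are injective, so two adjacent
  zeros propagate in both directions.\<close>

lemma eigenvector_unique:
  assumes ev: "J u = cscale E u" and 0: "l2_nth u 0 = 0" "l2_nth u 1 = 0"
  shows "u = 0"
proof -
  have eq: "conj_transpose (a (n - 1)) *v l2_nth u (n - 1) + b n *v l2_nth u n + a n *v l2_nth u (n + 1) = E *s l2_nth u n" for n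
    using arg_cong[OF ev, of "\<lambda>v. l2_nth v n"] by (simp add: J_eq plus_l2.rep_eq nth_simps cscale.rep_eq)
  have up: "l2_nth u (int k) = 0 \<and> l2_nth u (int k + 1) = 0" for k
  proof (induction k)
    case (Suc k)
    then have "a (int k + 1) *v l2_nth u (int k + 2) = 0" using eq[of "int k + 1"] by (simp add: add.assoc)
    then have "l2_nth u (int k + 2) = 0" by (rule a_injective)
    then show ?case using Suc by (simp add: add.commute add.left_commute)
  qed (simp add: 0)
  have down: "l2_nth u (- int k) = 0 \<and> l2_nth u (- int k + 1) = 0" for k
  proof (induction k)
    case (Suc k)
    then have "conj_transpose (a (- int k - 1)) *v l2_nth u (- int k - 1) = 0" using eq[of "- int k"] by simp
    then have "l2_nth u (- int k - 1) = 0" by (rule a_adjoint_injective)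
    moreover have "- int (Suc k) = - int k - 1" "- int (Suc k) + 1 = - int k" by simp_all
    ultimately show ?case using Suc by (simp only:)
  qed (simp add: 0)
  have "l2_nth u n = 0" for n
    using up[of "nat n"] down[of "nat (- n)"] by (cases "n \<ge> 0") auto
  then show ?thesis by (intro l2_eqI) (simp add: zero_l2.rep_eq)
qed

text \<open>Moving by \<open>q\<close> sites multiplies the norm of an entry by
  \<open>cmod z\<close> or its inverse, so in one direction the norms never decrease; a nonzero
  entry would then recur infinitely often with at least its size, against
  square-summability.\<close>

lemma S_no_eigenvector:
  assumes "S u = cscale z u"
  shows "u = 0"
proof -
  have eq: "norm (l2_nth u (n - int q)) = cmod z * norm (l2_nth u n)" for n
    using arg_cong[OF assms, of "\<lambda>v. norm (l2_nth v n)"] by (simp add: nth_simps cscale.rep_eq norm_vector_scalar_mult)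
  have "l2_nth u n = 0" for n
  proof -
    define d where "d = (if cmod z \<ge> 1 then - int q else int q)"
    have step: "norm (l2_nth u n) \<le> norm (l2_nth u (n + d))" for n
    proof (cases "cmod z \<ge> 1")
      case True
      then show ?thesis using eq[of n] mult_right_mono[OF True, of "norm (l2_nth u n)"] by (simp add: d_def)
    next
      case False
      then show ?thesis using eq[of "n + int q"] mult_right_mono[of "cmod z" 1 "norm (l2_nth u (n + int q))"] by (simp add: d_def)
    qed
    have mono: "norm (l2_nth u n) \<le> norm (l2_nth u (n + d * int k))" for k
    proof (induction k)
      case (Suc k)
      then show ?case using step[of "n + d * int k"] by (simp add: algebra_simps)
    qed simp
    have bd: "real N * (norm (l2_nth u n))\<^sup>2 \<le> (norm u)\<^sup>2" for N
    proof -
      have inj: "inj_on (\<lambda>k. n + d * int k) {..<N}" using q by (auto simp: inj_on_def d_def split: if_splits)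
      have "real N * (norm (l2_nth u n))\<^sup>2 = (\<Sum>k<N. (norm (l2_nth u n))\<^sup>2)" by simp
      also have "\<dots> \<le> (\<Sum>k<N. (norm (l2_nth u (n + d * int k)))\<^sup>2)" by (intro sum_mono power_mono mono) auto
      also have "\<dots> = (\<Sum>n\<in>(\<lambda>k. n + d * int k) ` {..<N}. (norm (l2_nth u n))\<^sup>2)" by (simp add: sum.reindex[OF inj])
      also have "\<dots> \<le> (norm u)\<^sup>2" by (rule sum_norm_l2_le) simp
      finally show ?thesis .
    qed
    show ?thesis
    proof (rule ccontr)
      assume "l2_nth u n \<noteq> 0"
      then obtain N where "(norm u)\<^sup>2 < real N * (norm (l2_nth u n))\<^sup>2"
        using reals_Archimedean3[of "(norm (l2_nth u n))\<^sup>2"] by auto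
      then show False using bd[of N] by simp
    qed
  qed
  then show ?thesis by (intro l2_eqI) (simp add: zero_l2.rep_eq)
qed

lemma bounded_operator_J: "bounded_operator J" by (rule bounded_selfadjointD[OF J_selfadjoint])
lemmas linear_S = bounded_operatorD(1)[OF bounded_operators(4)]
lemmas linear_S' = bounded_operatorD(1)[OF bounded_operators(5)]
lemmas linear_J = bounded_operatorD(1)[OF bounded_operator_J]

text \<open>
  An eigenspace of \<open>J\<close> has dimension at most \<open>2m\<close> and is invariant under the shift \<open>S\<close>, so the translates of an
  eigenvector are linearly dependent; but no nonzero polynomial in \<open>S\<close> annihilates a vector.
\<close>

lemma J_no_eigenvector:
  assumes ev: "J u = cscale E u"
  shows "u = 0"
proof -
  define W where "W v = (l2_nth v 0, l2_nth v 1)" for v :: "'m l2"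
  have evk: "J ((S ^^ k) u) = cscale E ((S ^^ k) u)" for k
    by (induction k) (simp_all add: ev J_S bounded_operatorD bounded_operators)
  \<comment> \<open>Real dimension of the data at sites 0 and 1; the indices from 0 to
    \<open>?D\<close> supply one translate more than that.\<close>
  let ?D = "card (Basis :: ((complex ^ 'm) \<times> (complex ^ 'm)) set)"
  obtain c where c: "\<exists>k\<in>{..?D}. c k \<noteq> 0" "(\<Sum>k\<in>{..?D}. c k *\<^sub>R W ((S ^^ k) u)) = 0"
    by (rule linear_dependence[of "{..?D}" "Basis :: ((complex ^ 'm) \<times> (complex ^ 'm)) set" "\<lambda>k. W ((S ^^ k) u)"]) auto
  define p where "p = (\<Sum>k\<le>?D. monom (complex_of_real (c k)) k)"
  interpret S: operator_module cscale S by (rule operator_module_cscale[OF bounded_operators(4)])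
  have p: "gact cscale S p u = (\<Sum>k\<le>?D. c k *\<^sub>R (S ^^ k) u)"
  proof -
    have "(S ^^ k) (r *\<^sub>R u) = r *\<^sub>R (S ^^ k) u" for k r
      by (induction k) (simp_all add: linear_simps[OF linear_S])
    then show ?thesis unfolding p_def by (simp add: S.gact_sum S.gact_monom)
  qed
  have "gact cscale S p u = 0"
  proof (rule eigenvector_unique)
    show "J (gact cscale S p u) = cscale E (gact cscale S p u)"
    proof -
      have "J (gact cscale S p u) = gact cscale S p (J u)"
        by (rule S.gact_commute) (simp_all add: linear_simps[OF linear_J] bounded_operatorD[OF bounded_operator_J] J_S)
      then show ?thesis by (simp add: ev S.f_gact)
    qed
 have Wl: "W (x + y) = W x + W y" "W (r *\<^sub>R x) = r *\<^sub>R W x" "W 0 = 0" for x y r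
      by (auto simp: W_def plus_l2.rep_eq scaleR_l2.rep_eq zero_l2.rep_eq zero_prod_def)
    have "W (\<Sum>k\<in>F. c k *\<^sub>R (S ^^ k) u) = (\<Sum>k\<in>F. c k *\<^sub>R W ((S ^^ k) u))" if "finite F" for F
      using that by (induction F rule: finite_induct) (auto simp: Wl)
    then have "W (gact cscale S p u) = 0" using c(2) by (simp add: p)
    then show "l2_nth (gact cscale S p u) 0 = 0" "l2_nth (gact cscale S p u) 1 = 0" by (auto simp: W_def zero_prod_def)
  qed
  moreover have "p \<noteq> 0"
  proof
    assume "p = 0"
    obtain k where k: "k \<le> ?D" "c k \<noteq> 0" using c(1) by auto
    have "coeff p k = (\<Sum>i\<le>?D. if i = k then complex_of_real (c i) else 0)"
      by (simp add: p_def coeff_sum)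
    also have "\<dots> = of_real (c k)" using k by simp
    finally show False using k \<open>p = 0\<close> by simp
  qed
  ultimately show ?thesis
    using gact_cscale_injective[OF bounded_operators(4)] S_no_eigenvector by blast
qed

subsection \<open>An algebraic relation between the shift and J\<close>

text \<open>Real coefficients make these operators self-adjoint, so the adjoint of a polynomial in
  \<open>S\<close> over them is the same polynomial in \<open>S'\<close>. The relation between
  \<open>S\<close> and \<open>J\<close> is accordingly found by counting real dimensions.\<close>

definition aJ :: "real poly \<Rightarrow> 'm l2 \<Rightarrow> 'm l2" where "aJ = gact scaleR J"
definition aS :: "real poly poly \<Rightarrow> 'm l2 \<Rightarrow> 'm l2" where "aS = gact aJ S"
definition aS' :: "real poly poly \<Rightarrow> 'm l2 \<Rightarrow> 'm l2" where "aS' = gact aJ S'"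

sublocale J: operator_module scaleR J
  rewrites "gact scaleR J = aJ"
  by (intro operator_module_scaleR bounded_linear.linear linear_J) (simp add: aJ_def)

sublocale S: operator_module aJ S
  rewrites "gact aJ S = aS"
proof -
  show "operator_module aJ S"
    by (rule J.operator_module_gact) (simp_all add: linear_simps[OF linear_S] J_S)
qed (simp add: aS_def)

sublocale S': operator_module aJ S'
  rewrites "gact aJ S' = aS'"
proof -
  show "operator_module aJ S'"
    by (rule J.operator_module_gact) (simp_all add: linear_simps[OF linear_S'] J_S')
qed (simp add: aS'_def)

lemma aJ_bounded: "bounded_linear (aJ d)"
proof (induction d)
  case (pCons c d)
  have "aJ (pCons c d) = (\<lambda>v. c *\<^sub>R v + J (aJ d v))" by (simp add: fun_eq_iff J.gact_pCons)
  then show ?case by (auto intro!: bounded_linear_add bounded_linear_scaleR_right bounded_linear_compose[OF linear_J] pCons)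
qed (simp add: J.gact_zero[abs_def])

lemma aS_bounded: "bounded_linear (aS p)"
proof (induction p)
  case (pCons c d)
  have "aS (pCons c d) = (\<lambda>v. aJ c v + S (aS d v))" by (simp add: fun_eq_iff S.gact_pCons)
  then show ?case by (auto intro!: bounded_linear_add aJ_bounded bounded_linear_compose[OF linear_S] pCons)
qed (simp add: S.gact_zero[abs_def])

lemma aJ_adjoint: "inner (aJ d u) v = inner u (aJ d v)"
proof (induction d arbitrary: u v)
  case (pCons c d)
  have "inner (J (aJ d u)) v = inner u (J (aJ d v))"
    by (simp add: bounded_selfadjointD(4)[OF J_selfadjoint] pCons.IH J.T_gact)
  then show ?case by (simp add: J.gact_pCons inner_add_left inner_add_right)
qed (simp add: J.gact_zero)

lemma aS_adjoint: "inner (aS p u) v = inner u (aS' p v)"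
proof (induction p arbitrary: u v)
  case (pCons c p)
  have "inner (S (aS p u)) v = inner u (S' (aS' p v))"
    by (simp add: S_adjoint pCons.IH S'.T_gact)
  then show ?case by (simp add: S.gact_pCons S'.gact_pCons inner_add_left inner_add_right aJ_adjoint)
qed (simp add: S.gact_zero S'.gact_zero)

text \<open>\<open>S\<close>, \<open>S'\<close> and \<open>J\<close> commute. With
  \<open>r = p\<close> this is normality of \<open>aS p\<close>.\<close>

lemma aS_aS': "aS p (aS' r v) = aS' r (aS p v)"
  by (rule S.gact_commute[symmetric]) (simp_all add: S'.gact_add_right S'.f_gact,
      simp add: S'.gact_commute[of S] linear_simps[OF linear_S] S.T_f)

text \<open>For a normal operator, a vector killed by it is killed by its adjoint; applied to
  \<open>aS p u\<close>, this makes \<open>aS p u\<close> orthogonal to itself.\<close>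

lemma aS_square_zero:
  assumes "aS p (aS p u) = 0"
  shows "aS p u = 0"
proof -
  have "inner (aS' p (aS p u)) (aS' p (aS p u)) = inner (aS p (aS' p (aS p u))) (aS p u)"
    by (simp add: aS_adjoint)
  also have "\<dots> = 0" by (simp add: aS_aS' assms S'.gact_zero)
  finally have "aS' p (aS p u) = 0" by simp
  then have "inner (aS p u) (aS p u) = 0" by (simp add: aS_adjoint)
  then show ?thesis by simp
qed

text \<open>The coefficients are read as complex ones, so that factorization applies together with
  the absence of eigenvectors of \<open>J\<close>.\<close>

lemma aJ_injective:
  assumes "d \<noteq> 0" "aJ d u = 0"
  shows "u = 0"
proof -
  interpret C: operator_module cscale J by (rule operator_module_cscale[OF bounded_operator_J])
  have "aJ d u = gact cscale J (map_poly of_real d) u" for d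
    by (induction d) (simp_all add: J.gact_zero C.gact_zero map_poly_pCons J.gact_pCons C.gact_pCons)
  then have "gact cscale J (map_poly of_real d) u = 0" using assms(2) by simp
  moreover have "map_poly complex_of_real d \<noteq> 0" using assms(1) by (simp add: map_poly_eq_0_iff)
  ultimately show ?thesis
    using gact_cscale_injective[OF bounded_operator_J] J_no_eigenvector by blast
qed

definition supported :: "int \<Rightarrow> int \<Rightarrow> 'm l2 \<Rightarrow> bool" where
  "supported lo hi u \<longleftrightarrow> (\<forall>n. n < lo \<or> n > hi \<longrightarrow> l2_nth u n = 0)"

lemma supported_J: "supported lo hi u \<Longrightarrow> supported (lo - 1) (hi + 1) (J u)"
  by (auto simp: supported_def J_eq plus_l2.rep_eq nth_simps)

lemma supported_S: "supported lo hi u \<Longrightarrow> supported (lo + int q) (hi + int q) (S u)"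
  by (auto simp: supported_def nth_simps)

lemma supported_span:
  assumes "supported lo hi u"
  shows "u \<in> span ((\<lambda>(n, b). single n b) ` ({lo..hi} \<times> Basis))"
proof -
  have nth: "l2_nth (\<Sum>n\<in>F. single n (l2_nth u n)) k = (if k \<in> F then l2_nth u k else 0)" if "finite F" for F k
    using that by (induction F rule: finite_induct) (auto simp: plus_l2.rep_eq zero_l2.rep_eq single.rep_eq)
  have "u = (\<Sum>n\<in>{lo..hi}. single n (l2_nth u n))"
    using assms by (intro l2_eqI) (auto simp: nth supported_def)
  also have "\<dots> = (\<Sum>n\<in>{lo..hi}. \<Sum>b\<in>Basis. (inner (l2_nth u n) b) *\<^sub>R single n b)"
  proof (intro sum.cong refl)
    fix n
    have "single n (l2_nth u n) = single n (\<Sum>b\<in>Basis. (inner (l2_nth u n) b) *\<^sub>R b)" by (simp add: euclidean_representation)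
    then show "single n (l2_nth u n) = (\<Sum>b\<in>Basis. (inner (l2_nth u n) b) *\<^sub>R single n b)"
      by (simp add: linear_sum[OF single_linear])
  qed
  finally have eq: "u = (\<Sum>n\<in>{lo..hi}. \<Sum>b\<in>Basis. (inner (l2_nth u n) b) *\<^sub>R single n b)" .
  show ?thesis by (subst eq, intro span_sum span_scale span_base) auto
qed

text \<open>The translates of iterates of \<open>J\<close> on one vector are more numerous than the
  real dimension of the window of sites containing all their supports.\<close>

lemma single_relation: "\<exists>p. p \<noteq> 0 \<and> aS p (single k x) = 0"
proof -
  define D where "D = card (Basis :: (complex ^ 'm) set)"
  \<comment> \<open>There are \<open>(M + 1) * (N + 1)\<close> vectors in a window of dimension
    \<open>(2 * N + M * q + 1) * D\<close>. With \<open>N = D * q\<close> the terms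
    \<open>M * N\<close> and \<open>M * q * D\<close> agree, and the next choice makes
    \<open>M\<close> equal to the remainder \<open>(2 * N + 1) * D\<close>, leaving a surplus of
    \<open>N + 1\<close>.\<close>
  define N where "N = D * q"
  define M where "M = 2 * D * D * q + D"
  define \<delta> where "\<delta> = (single k x :: 'm l2)"
  define v where "v = (\<lambda>(i, l). (S ^^ i) ((J ^^ l) \<delta>))"
  have sJ: "supported (k - int l) (k + int l) ((J ^^ l) \<delta>)" for l
  proof (induction l)
    case 0 show ?case by (simp add: \<delta>_def supported_def single.rep_eq)
  next
    case (Suc l)
    from supported_J[OF Suc] show ?case by (simp add: algebra_simps)
  qed
  have sS: "supported (k - int l + int (i * q)) (k + int l + int (i * q)) ((S ^^ i) ((J ^^ l) \<delta>))" for i l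
  proof (induction i)
    case 0 show ?case using sJ by simp
  next
    case (Suc i)
    from supported_S[OF Suc] show ?case by (simp add: algebra_simps)
  qed
  let ?B = "(\<lambda>(n, b). single n b) ` ({k - int N..k + int N + int (M * q)} \<times> (Basis :: (complex ^ 'm) set))"
  have card_B: "card ?B \<le> (2 * N + M * q + 1) * D"
  proof -
    have "card {k - int N..k + int N + int (M * q)} = nat (int (2 * N + M * q + 1))" by (simp add: algebra_simps)
    then have "card ({k - int N..k + int N + int (M * q)} \<times> (Basis :: (complex ^ 'm) set)) = (2 * N + M * q + 1) * D"
      unfolding card_cartesian_product D_def nat_int by (simp only:)
    then show ?thesis by (metis card_image_le finite_Basis finite_atLeastAtMost_int finite_cartesian_product)
  qed
  have vB: "v x \<in> span ?B" if x: "x \<in> {..M} \<times> {..N}" for x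
  proof -
    obtain i l where il: "x = (i, l)" "i \<le> M" "l \<le> N" using x by auto
    have "i * q \<le> M * q" using il by simp
    then have "int (i * q) \<le> int (M * q)" by (simp only: of_nat_le_iff)
    then have "supported (k - int N) (k + int N + int (M * q)) (v x)"
      unfolding supported_def
    proof (intro allI impI)
      fix n assume "n < k - int N \<or> n > k + int N + int (M * q)"
      then have "n < k - int l + int (i * q) \<or> n > k + int l + int (i * q)"
        using il(2,3) \<open>int (i * q) \<le> int (M * q)\<close> of_nat_0_le_iff[of "i * q", where 'a = int] by linarith
      then show "l2_nth (v x) n = 0" using sS[of l i] unfolding supported_def il(1) v_def by auto
    qed
    then show ?thesis by (rule supported_span)
  qed
  have "(2 * N + M * q + 1) * D < (M + 1) * (N + 1)"
  proof -
    have "(M + 1) * (N + 1) = M * (D * q) + M + N + 1" by (simp add: N_def algebra_simps)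
    moreover have "(2 * N + M * q + 1) * D = M * (D * q) + 2 * D * D * q + D" by (simp add: N_def algebra_simps)
    ultimately show ?thesis using M_def by linarith
  qed
  then have "card ?B < card ({..M} \<times> {..N})" using card_B by (simp add: card_cartesian_product)
  then obtain c where c: "\<exists>x\<in>{..M} \<times> {..N}. c x \<noteq> 0" "(\<Sum>x\<in>{..M} \<times> {..N}. c x *\<^sub>R v x) = 0"
    using linear_dependence[of "{..M} \<times> {..N}" ?B v, OF _ _ _ vB] by auto
  define p where "p = (\<Sum>i\<le>M. monom (\<Sum>l\<le>N. monom (c (i, l)) l) i)"
  have cf: "coeff (coeff p i) l = c (i, l)" if "i \<le> M" "l \<le> N" for i l
    using that by (simp add: p_def coeff_sum if_distrib[of "\<lambda>p. coeff p _"] cong: if_cong)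
  have "aS p \<delta> = (\<Sum>i\<le>M. (S ^^ i) (\<Sum>l\<le>N. (J ^^ l) (c (i, l) *\<^sub>R \<delta>)))"
    by (simp add: p_def S.gact_sum S.gact_monom J.gact_sum J.gact_monom)
  also have "\<dots> = (\<Sum>i\<le>M. \<Sum>l\<le>N. c (i, l) *\<^sub>R v (i, l))"
  proof (intro sum.cong refl)
    fix i
    have J: "(J ^^ l) (r *\<^sub>R u) = r *\<^sub>R (J ^^ l) u" for l r u
      by (induction l) (simp_all add: linear_simps[OF linear_J])
    have Si: "linear (S ^^ i)"
    proof (induction i)
      case 0 then show ?case using linear_id by (simp add: id_def)
    next
      case (Suc i) then show ?case using linear_compose[OF Suc bounded_linear.linear[OF linear_S]] by (simp only: funpow.simps)
    qed
    show "(S ^^ i) (\<Sum>l\<le>N. (J ^^ l) (c (i, l) *\<^sub>R \<delta>)) = (\<Sum>l\<le>N. c (i, l) *\<^sub>R v (i, l))"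
      by (simp add: J v_def linear_sum[OF Si] linear_cmul[OF Si])
  qed
  also have "\<dots> = 0" using c(2) by (simp add: sum.cartesian_product)
  finally have "aS p \<delta> = 0" .
  moreover have "p \<noteq> 0" using c(1) cf by fastforce
  ultimately show ?thesis by (auto simp: \<delta>_def)
qed

text \<open>Relations for the finitely many basis vectors of a cell are multiplied together. The
  product commutes with translations, so it kills all single-site vectors, and by continuity
  everything.\<close>

lemma algebraic_relation: "\<exists>p. p \<noteq> 0 \<and> (\<forall>u. aS p u = 0)"
proof -
  let ?F = "{0..<int q} \<times> (Basis :: (complex ^ 'm) set)"
  have "\<exists>p. p \<noteq> 0 \<and> (\<forall>(n, x)\<in>F. aS p (single n x) = 0)" if "finite F" for F
    using that
  proof (induction F rule: finite_induct)
    case empty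
    show ?case by (rule exI[of _ 1]) simp
  next
    case (insert y F)
    obtain n x where y: "y = (n, x)" by force
    obtain p r where pr: "p \<noteq> 0" "\<forall>(n, x)\<in>F. aS p (single n x) = 0" "r \<noteq> 0" "aS r (single n x) = 0"
      using insert.IH single_relation by metis
    have "aS (r * p) (single n' x') = 0" if "(n', x') \<in> insert y F" for n' x'
    proof (cases "(n', x') = y")
      case True
      then show ?thesis using pr(4) y by (simp add: mult.commute[of r p] S.gact_mult S.gact_zero)
    next
      case False
      then have "aS p (single n' x') = 0" using pr(2) that by auto
      then show ?thesis by (simp add: S.gact_mult S.gact_zero)
    qed
    then show ?case using pr by (intro exI[of _ "r * p"]) auto
  qed
  from this[of ?F] obtain p where p: "p \<noteq> 0" "\<And>n x. n \<in> {0..<int q} \<Longrightarrow> x \<in> Basis \<Longrightarrow> aS p (single n x) = 0"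
    by auto
  have "aS p u = 0" for u
  proof (rule l2_dense_induct[where P = "\<lambda>u. aS p u = 0"])
    show "closed {u. aS p u = 0}"
      by (intro closed_Collect_eq linear_continuous_on aS_bounded continuous_on_const)
    show "aS p (single k x) = 0" for k x
    proof -
      have 1: "aS p (single (k mod int q) x) = 0"
      proof -
        have "single (k mod int q) x = single (k mod int q) (\<Sum>b\<in>Basis. (inner x b) *\<^sub>R b)" by (simp add: euclidean_representation)
        then have "aS p (single (k mod int q) x) = (\<Sum>b\<in>Basis. (inner x b) *\<^sub>R aS p (single (k mod int q) b))"
          by (simp only: linear_sum[OF single_linear] single_simps linear_sum[OF bounded_linear.linear[OF aS_bounded]]
              linear_simps[OF aS_bounded])
        then show ?thesis using p(2)[of "k mod int q"] q by simp
      qed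
      have "single k x = shift (k div int q) (single (k mod int q) x)"
        by (rule l2_eqI) (auto simp: shift_nth single.rep_eq, (metis add.commute add_diff_cancel_right' diff_eq_eq mult_div_mod_eq)+)
      then have "aS p (single k x) = shift (k div int q) (aS p (single (k mod int q) x))"
        using shift_commute[of "aS p"] S.T_gact by simp
      then show ?thesis unfolding 1 by (intro l2_eqI) (simp add: shift_nth zero_l2.rep_eq)
    qed
  qed (simp_all add: S.gact_zero S.gact_add_right)
  then show ?thesis using p(1) by blast
qed

subsection \<open>Injectivity of the asymptotic velocity\<close>

text \<open>Carries an operator along with the limit of its time averages, so that averaged
  commutators can be computed by induction on a polynomial.\<close>

definition averages_to :: "('m l2 \<Rightarrow> 'm l2) \<Rightarrow> ('m l2 \<Rightarrow> 'm l2) \<Rightarrow> bool" where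
  "averages_to B L \<longleftrightarrow> bounded_linear B \<and> (\<forall>u. ((\<lambda>t. avg B t u) \<longlongrightarrow> L u) at_top)"

lemma averages_to_A: "averages_to A Q"
  by (simp add: averages_to_def A_linear avg_Q)

lemma averages_to_add:
  assumes "averages_to B L" "averages_to B' L'"
  shows "averages_to (\<lambda>u. B u + B' u) (\<lambda>u. L u + L' u)"
proof -
  have "avg (\<lambda>u. B u + B' u) t u = avg B t u + avg B' t u" for t u
    using assms by (simp add: avg_def evint_def averages_to_def linear_simps[OF bounded_linear_U] integral_add evint_integrable scaleR_right_distrib)
  then show ?thesis using assms by (auto simp: averages_to_def intro!: bounded_linear_add tendsto_add)
qed

lemma averages_to_left:
  assumes "averages_to B L" and D: "bounded_linear D" and DU: "\<And>t u. D (U t u) = U t (D u)"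
  shows "averages_to (\<lambda>u. D (B u)) (\<lambda>u. D (L u))"
proof -
  have B: "bounded_linear B" using assms by (simp add: averages_to_def)
  have "avg (\<lambda>u. D (B u)) t u = D (avg B t u)" for t u
  proof -
    have "D (evint B t u) = integral {0..t} (D \<circ> (\<lambda>s. U s (B (U (- s) u))))"
      unfolding evint_def by (rule integral_linear[OF evint_integrable[OF B] D, symmetric])
    then show ?thesis by (simp add: avg_def evint_def o_def DU linear_simps[OF D])
  qed
  then show ?thesis using assms
    by (auto simp: averages_to_def intro!: bounded_linear_compose[OF D] bounded_linear.tendsto[OF D])
qed

lemma averages_to_right:
  assumes "averages_to B L" and D: "bounded_linear D" and DU: "\<And>t u. D (U t u) = U t (D u)"
  shows "averages_to (\<lambda>u. B (D u)) (\<lambda>u. L (D u))"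
  using assms bounded_linear_compose[of B D] by (auto simp: averages_to_def avg_def evint_def DU)

lemma averages_to_commuting:
  assumes D: "bounded_linear D" and DU: "\<And>t u. D (U t u) = U t (D u)"
  shows "averages_to D D"
proof -
  have "\<forall>\<^sub>F t in at_top. avg D t u = D u" for u
    using eventually_gt_at_top[of 0] by eventually_elim (simp add: avg_def evint_def DU U_inverse)
  then show ?thesis using D by (auto simp: averages_to_def intro: tendsto_eventually)
qed

lemma aJ_U: "aJ d (U t u) = U t (aJ d u)"
  by (rule J.gact_commute[symmetric]) (simp_all add: U_linear U_J)

lemma aS_U: "aS p (U t u) = U t (aS p u)"
  by (rule S.gact_commute[symmetric]) (simp_all add: U_linear aJ_U U_S)

lemma Q_S: "Q (S u) = S (Q u)"
  by (rule Q_commute) (simp_all add: linear_S U_S A_S)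

lemmas linear_Q = bounded_selfadjointD(2)[OF Q_selfadjoint]

text \<open>Starting the average at time \<open>s\<close> costs a fixed vector divided by
  \<open>t\<close> and a factor \<open>(s + t) / t\<close>, both harmless in the limit; negative
  \<open>s\<close> follows by inversion.\<close>

lemma Q_U: "Q (U s u) = U s (Q u)"
proof -
  have pos: "U s (Q (U (- s) u)) = Q u" if s: "s \<ge> 0" for s u
  proof -
    have "((\<lambda>t. ((s + t) / t) *\<^sub>R avg A (s + t) u - (1 / t) *\<^sub>R evint A s u) \<longlongrightarrow> 1 *\<^sub>R Q u - 0 *\<^sub>R evint A s u) at_top"
    proof (intro tendsto_diff tendsto_scaleR tendsto_const)
      show "((\<lambda>t. (s + t) / t) \<longlongrightarrow> 1) at_top" "((\<lambda>t::real. 1 / t) \<longlongrightarrow> 0) at_top" by real_asymp+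
      show "((\<lambda>t. avg A (s + t) u) \<longlongrightarrow> Q u) at_top"
        by (rule filterlim_compose[OF avg_Q]) real_asymp
    qed
    moreover have "\<forall>\<^sub>F t in at_top. ((s + t) / t) *\<^sub>R avg A (s + t) u - (1 / t) *\<^sub>R evint A s u = U s (avg A t (U (- s) u))"
      using eventually_gt_at_top[of 0]
    proof eventually_elim
      case (elim t)
      then show ?case using evint_cocycle[OF A_linear s, of t u] s
        by (simp add: avg_def U_linear scaleR_right_distrib)
    qed
    ultimately have "((\<lambda>t. U s (avg A t (U (- s) u))) \<longlongrightarrow> Q u) at_top"
      by (auto intro: Lim_transform_eventually)
    moreover have "((\<lambda>t. U s (avg A t (U (- s) u))) \<longlongrightarrow> U s (Q (U (- s) u))) at_top"
      by (intro bounded_linear.tendsto[OF bounded_linear_U] avg_Q)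
    ultimately show ?thesis using tendsto_unique trivial_limit_at_top_linorder by blast
  qed
  show ?thesis
  proof (cases "s \<ge> 0")
    case True
    then show ?thesis using pos[of s "U s u"] by simp
  next
    case False
    then show ?thesis using pos[of "- s" u] by (metis U_inverse(1) neg_0_le_iff_le linear minus_minus)
  qed
qed

text \<open>Differentiation at time 0 of the commutation with \<open>U\<close>.\<close>

lemma Q_J: "Q (J u) = J (Q u)"
proof -
  have "((\<lambda>t. Q (U t u)) has_vector_derivative Q (G (U 0 u))) (at 0)"
    by (intro bounded_linear.has_vector_derivative[OF linear_Q] U_deriv)
  moreover have "((\<lambda>t. Q (U t u)) has_vector_derivative G (U 0 (Q u))) (at 0)"
    unfolding Q_U by (rule U_deriv)
  ultimately have "Q (G u) = G (Q u)" using vector_derivative_unique_at by fastforce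
  then have "cscale (- \<i>) (cscale \<i> (Q (J u))) = cscale (- \<i>) (cscale \<i> (J (Q u)))"
    by (simp add: G_def bounded_selfadjointD[OF Q_selfadjoint])
  then show ?thesis by simp
qed

lemma Q_aJ: "Q (aJ d u) = aJ d (Q u)"
  by (rule J.gact_commute) (simp_all add: linear_simps[OF linear_Q] Q_J)

lemma Q_aS: "Q (aS p u) = aS p (Q u)"
  by (rule S.gact_commute) (simp_all add: linear_simps[OF linear_Q] Q_aJ Q_S)

text \<open>Product rule: \<open>[X, J d(J)] = [X, J] d(J) + J [X, d(J)]\<close> with
  \<open>[X, J] = i A\<close>. The average of \<open>A\<close> is \<open>Q\<close>, which commutes
  with \<open>J\<close>, so on the kernel of \<open>Q\<close> each term of the limit
  vanishes.\<close>

lemma pos_commutator_aJ: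
  "\<exists>C L. averages_to C L \<and> (\<forall>\<phi>\<in>pos_dom. aJ d \<phi> \<in> pos_dom \<and> pos_op (aJ d \<phi>) = aJ d (pos_op \<phi>) + C \<phi>) \<and>
     (\<forall>\<psi>. Q \<psi> = 0 \<longrightarrow> L \<psi> = 0)"
proof (induction d)
  case 0
  have "averages_to (\<lambda>u. 0) (\<lambda>u. 0)" by (rule averages_to_commuting) (simp_all add: linear_simps[OF bounded_linear_U])
  then show ?case by (intro exI[of _ "\<lambda>u. 0"]) (simp add: J.gact_zero pos_op_zero)
next
  case (pCons c d)
  then obtain C L where CL: "averages_to C L" "\<And>\<phi>. \<phi> \<in> pos_dom \<Longrightarrow> aJ d \<phi> \<in> pos_dom"
    "\<And>\<phi>. \<phi> \<in> pos_dom \<Longrightarrow> pos_op (aJ d \<phi>) = aJ d (pos_op \<phi>) + C \<phi>" "\<And>\<psi>. Q \<psi> = 0 \<Longrightarrow> L \<psi> = 0" by blast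
  have iA: "cscale \<i> (A u) = down u - up u" for u
    by (simp add: A_def cscale_minus)
  have "averages_to (\<lambda>u. cscale \<i> (A (aJ d u)) + J (C u)) (\<lambda>u. cscale \<i> (Q (aJ d u)) + J (L u))"
    by (intro averages_to_add averages_to_left[OF _ bounded_linear_cscale] averages_to_right[OF averages_to_A aJ_bounded]
        averages_to_left[OF CL(1) linear_J]) (simp_all add: U_cscale aJ_U U_J)
  moreover have "aJ (pCons c d) \<phi> \<in> pos_dom \<and>
     pos_op (aJ (pCons c d) \<phi>) = aJ (pCons c d) (pos_op \<phi>) + (cscale \<i> (A (aJ d \<phi>)) + J (C \<phi>))" if "\<phi> \<in> pos_dom" for \<phi>
    using that CL(2,3)[OF that] pos_op_J[OF CL(2)[OF that]]
    by (simp add: J.gact_pCons pos_op_add pos_op_scaleR iA linear_simps[OF linear_J])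
  moreover have "cscale \<i> (Q (aJ d \<psi>)) + J (L \<psi>) = 0" if "Q \<psi> = 0" for \<psi>
    using that CL(4)[OF that] by (simp add: Q_aJ J.gact_zero linear_simps[OF linear_J])
  ultimately show ?case by blast
qed

text \<open>
  Averaging the commutator \<open>[X, p(S, J)]\<close> over the evolution gives
  \<open>q S (\<partial>\<^sub>S p)(S, J) + i (\<partial>\<^sub>J p)(S, J) Q\<close>, whose second term vanishes on the kernel of \<open>Q\<close>.
\<close>

lemma pos_commutator_aS:
  "\<exists>C L. averages_to C L \<and> (\<forall>\<phi>\<in>pos_dom. aS p \<phi> \<in> pos_dom \<and> pos_op (aS p \<phi>) = aS p (pos_op \<phi>) + C \<phi>) \<and>
     (\<forall>\<psi>. Q \<psi> = 0 \<longrightarrow> L \<psi> = real q *\<^sub>R S (aS (pderiv p) \<psi>))"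
proof (induction p)
  case 0
  have "averages_to (\<lambda>u. 0) (\<lambda>u. 0)" by (rule averages_to_commuting) (simp_all add: linear_simps[OF bounded_linear_U])
  then show ?case by (intro exI[of _ "\<lambda>u. 0"]) (simp add: S.gact_zero S.T_zero pos_op_zero)
next
  case (pCons d p)
  then obtain C L where CL: "averages_to C L" "\<And>\<phi>. \<phi> \<in> pos_dom \<Longrightarrow> aS p \<phi> \<in> pos_dom"
    "\<And>\<phi>. \<phi> \<in> pos_dom \<Longrightarrow> pos_op (aS p \<phi>) = aS p (pos_op \<phi>) + C \<phi>"
    "\<And>\<psi>. Q \<psi> = 0 \<Longrightarrow> L \<psi> = real q *\<^sub>R S (aS (pderiv p) \<psi>)" by blast
  obtain C' L' where CL': "averages_to C' L'" "\<And>\<phi>. \<phi> \<in> pos_dom \<Longrightarrow> aJ d \<phi> \<in> pos_dom"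
    "\<And>\<phi>. \<phi> \<in> pos_dom \<Longrightarrow> pos_op (aJ d \<phi>) = aJ d (pos_op \<phi>) + C' \<phi>" "\<And>\<psi>. Q \<psi> = 0 \<Longrightarrow> L' \<psi> = 0"
    using pos_commutator_aJ[of d] by blast
  \<comment> \<open>The commutator \<open>[X, S] = q S\<close> commutes with the evolution and
    survives averaging unchanged; it is the source of the derivative in \<open>S\<close>.\<close>
  have "averages_to (\<lambda>u. real q *\<^sub>R S (aS p u)) (\<lambda>u. real q *\<^sub>R S (aS p u))"
    by (intro averages_to_commuting bounded_linear_compose[OF bounded_linear_scaleR_right] bounded_linear_compose[OF linear_S] aS_bounded)
      (simp add: aS_U U_S U_linear)
  then have "averages_to (\<lambda>u. C' u + (real q *\<^sub>R S (aS p u) + S (C u))) (\<lambda>u. L' u + (real q *\<^sub>R S (aS p u) + S (L u)))"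
    by (intro averages_to_add CL'(1) averages_to_left[OF CL(1) linear_S]) (simp_all add: U_S)
  moreover have "aS (pCons d p) \<phi> \<in> pos_dom \<and>
     pos_op (aS (pCons d p) \<phi>) = aS (pCons d p) (pos_op \<phi>) + (C' \<phi> + (real q *\<^sub>R S (aS p \<phi>) + S (C \<phi>)))" if "\<phi> \<in> pos_dom" for \<phi>
    using that CL(2,3)[OF that] CL'(2,3)[OF that] pos_op_S[OF CL(2)[OF that]]
    by (simp add: S.gact_pCons pos_op_add linear_simps[OF linear_S])
  moreover have "L' \<psi> + (real q *\<^sub>R S (aS p \<psi>) + S (L \<psi>)) = real q *\<^sub>R S (aS (pderiv (pCons d p)) \<psi>)" if "Q \<psi> = 0" for \<psi>
    using CL(4)[OF that] CL'(4)[OF that]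
    by (simp add: pderiv_pCons S.gact_add_left S.gact_pCons J.gact_zero linear_simps[OF linear_S] scaleR_right_distrib)
  ultimately show ?case by blast
qed

text \<open>The commutator of position with the zero operator vanishes on single-site vectors and,
  being bounded, everywhere; so its time average vanishes too. Invertibility of \<open>S\<close> and
  \<open>q \<noteq> 0\<close> then isolate the derivative.\<close>

lemma derivative_relation:
  assumes p: "\<And>u. aS p u = 0" and \<psi>: "Q \<psi> = 0"
  shows "aS (pderiv p) \<psi> = 0"
proof -
  obtain C L where CL: "averages_to C L" "\<And>\<phi>. \<phi> \<in> pos_dom \<Longrightarrow> pos_op (aS p \<phi>) = aS p (pos_op \<phi>) + C \<phi>"
    "\<And>\<psi>. Q \<psi> = 0 \<Longrightarrow> L \<psi> = real q *\<^sub>R S (aS (pderiv p) \<psi>)"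
    using pos_commutator_aS[of p] by blast
  have bl: "bounded_linear C" using CL(1) by (simp add: averages_to_def)
  have "C u = 0" for u
  proof (rule l2_dense_induct[where P = "\<lambda>u. C u = 0"])
    show "closed {u. C u = 0}" by (intro closed_Collect_eq linear_continuous_on bl continuous_on_const)
    show "C (single k x) = 0" for k x
      using CL(2)[OF pos_op_single(1), of k x] by (simp add: p pos_op_zero)
  qed (simp_all add: linear_simps[OF bl])
  then have "avg C t \<psi> = 0" for t by (simp add: avg_def evint_def linear_simps[OF bounded_linear_U])
  then have "L \<psi> = 0" using CL(1) by (auto simp: averages_to_def tendsto_const_iff dest!: spec[of _ \<psi>])
  then have "S (aS (pderiv p) \<psi>) = 0" using CL(3)[OF \<psi>] q by simp
  then have "S' (S (aS (pderiv p) \<psi>)) = 0" by (simp only: S'.T_zero)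
  then show ?thesis by simp
qed

text \<open>\<open>p\<close> has least degree among relations valid everywhere, \<open>r\<close>
  among polynomials killing some nonzero vector of the kernel. Up to factors
  \<open>p = r * h\<close>; differentiation and minimality of \<open>r\<close> give
  \<open>aS h \<psi> = 0\<close>, so \<open>r\<close> divides \<open>h\<close> as well, and
  normality shows that \<open>h\<close>, up to a factor, is already a relation of smaller degree
  than \<open>p\<close>.\<close>

theorem Q_injective:
  assumes "Q \<psi>\<^sub>0 = 0"
  shows "\<psi>\<^sub>0 = 0"
proof (rule ccontr)
  assume "\<psi>\<^sub>0 \<noteq> 0"
  \<comment> \<open>The vector may depend on \<open>r\<close>: below \<open>\<psi>\<close> is
    replaced by \<open>aS h \<psi>\<close>, which stays in the kernel because \<open>Q\<close>
    commutes with \<open>S\<close> and \<open>J\<close>.\<close>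
  define R where "R r \<longleftrightarrow> r \<noteq> 0 \<and> (\<exists>\<psi>. \<psi> \<noteq> 0 \<and> Q \<psi> = 0 \<and> aS r \<psi> = 0)" for r
  define I where "I p \<longleftrightarrow> p \<noteq> 0 \<and> (\<forall>u. aS p u = 0)" for p
  obtain p0 where p0: "I p0" using algebraic_relation by (auto simp: I_def)
  then obtain p where p: "I p" "\<And>p'. I p' \<Longrightarrow> degree p \<le> degree p'"
    using ex_has_least_nat[of I p0 degree] by blast
  have "R p0" using p0 assms \<open>\<psi>\<^sub>0 \<noteq> 0\<close> by (auto simp: I_def R_def)
  then obtain r where r: "R r" "\<And>r'. R r' \<Longrightarrow> degree r \<le> degree r'"
    using ex_has_least_nat[of R p0 degree] by blast
  then obtain \<psi> where \<psi>: "r \<noteq> 0" "\<psi> \<noteq> 0" "Q \<psi> = 0" "aS r \<psi> = 0" by (auto simp: R_def)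
  have deg: "degree r > 0"
  proof (rule ccontr)
    assume "\<not> degree r > 0"
    then obtain d where d: "r = [:d:]" by (metis degree_eq_zeroE neq0_conv)
    then have "aJ d \<psi> = 0" using \<psi>(4) by (simp add: S.gact_pCons S.gact_zero S.T_zero)
    then show False using aJ_injective[of d \<psi>] d \<psi>(1,2) by auto
  qed
  \<comment> \<open>Coefficients are polynomials in \<open>J\<close> and do not form a field, so
    pseudo-division is used, leaving a nonzero factor \<open>c\<close>. The remainder kills
    \<open>\<psi>\<close> and has smaller degree than \<open>r\<close>, hence it is zero.\<close>
  have divide: "\<exists>c h. c \<noteq> 0 \<and> smult c f = r * h" if "aS f \<psi> = 0" for f
  proof -
    define s where "s = pseudo_mod f r"
    obtain c h where ch: "c \<noteq> 0" "smult c f = r * h + s" and s: "s = 0 \<or> degree s < degree r"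
      using pseudo_mod[OF \<psi>(1), of f] by (auto simp: s_def)
    have "aS s \<psi> = 0"
      using arg_cong[OF ch(2), of "\<lambda>p. aS p \<psi>"] that
      by (simp add: S.gact_smult S.gact_add_left mult.commute[of r h] S.gact_mult \<psi>(4) S.gact_zero S.f_zero)
    then have "R s" if "s \<noteq> 0" using that \<psi> by (auto simp: R_def)
    then have "s = 0" using r(2)[of s] s by force
    then show ?thesis using ch by auto
  qed
  obtain c h where ch: "c \<noteq> 0" "smult c p = r * h" using divide[of p] p(1) by (auto simp: I_def)
  have rh: "aS (r * h) u = 0" for u using p(1) by (simp add: S.gact_smult S.f_zero I_def flip: ch(2))
  have "aS (pderiv (r * h)) \<psi> = 0" by (rule derivative_relation[OF rh \<psi>(3)])
  then have 1: "aS (pderiv r) (aS h \<psi>) = 0"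
  proof -
    have "pderiv (r * h) = pderiv h * r + pderiv r * h"
      unfolding pderiv_mult by (simp only: mult.commute)
    then show ?thesis
      using \<open>aS (pderiv (r * h)) \<psi> = 0\<close> by (simp add: S.gact_add_left S.gact_mult \<psi>(4) S.gact_zero)
  qed
  have "aS h \<psi> = 0"
  proof (rule ccontr)
    assume "aS h \<psi> \<noteq> 0"
    moreover have "pderiv r \<noteq> 0" using deg by (simp add: pderiv_eq_0_iff)
    ultimately have "R (pderiv r)" using 1 \<psi>(3) by (auto simp: R_def Q_aS S.gact_zero intro!: exI[of _ "aS h \<psi>"])
    then show False using r(2)[of "pderiv r"] deg by (simp add: degree_pderiv)
  qed
  then obtain c' h' where ch': "c' \<noteq> 0" "smult c' h = r * h'" using divide[of h] by auto
  \<comment> \<open>The square is a multiple of \<open>p\<close>, so it acts as zero;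
    \<open>aS_square_zero\<close> then removes the square.\<close>
  have sq: "(r * h') * (r * h') = smult c' (smult c p) * h'"

  proof -
    have "(r * h') * (r * h') = smult c' h * (r * h')" by (simp only: ch'(2))
    also have "\<dots> = smult c' (r * h) * h'" by (simp only: mult_smult_left mult_smult_right mult_ac)
    finally show ?thesis by (simp only: ch(2))
  qed
  have "aS (r * h') u = 0" for u
  proof (rule aS_square_zero)
    show "aS (r * h') (aS (r * h') u) = 0"
      unfolding S.gact_mult[symmetric] sq using p(1) by (simp add: S.gact_mult S.gact_smult S.f_zero I_def)
  qed
  then have "I (smult c' h)" using ch' ch p(1) by (auto simp: I_def)
  then have "degree p \<le> degree h" using p(2) ch'(1) by fastforce
  moreover have "degree p = degree r + degree h"
  proof -
    have "degree (smult c p) = degree p" "smult c p \<noteq> 0" using ch(1) p(1) by (simp_all add: I_def)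
    then show ?thesis unfolding ch(2) by (metis degree_mult_eq mult_zero_left mult_zero_right)
  qed
  ultimately show False using deg by simp
qed

end

subsection \<open>Transport exponents\<close>

lemma power_le_fact_exp: "x ^ n \<le> fact n * exp x" if "x \<ge> 0" for x :: real
proof -
  have s: "summable (\<lambda>k. inverse (fact k) * x ^ k)" by (rule summable_exp)
  have "(\<Sum>k\<in>{n}. inverse (fact k) * x ^ k) \<le> (\<Sum>k. inverse (fact k) * x ^ k)"
    by (rule sum_le_suminf[OF s]) (use that in auto)
  also have "\<dots> = exp x" by (simp add: exp_def)
  finally show ?thesis by (simp add: field_simps)
qed

lemma summable_on_int_exp:
  fixes d :: real
  assumes "d > 0"
  shows "(\<lambda>n::int. exp (- d * \<bar>of_int n\<bar>)) summable_on UNIV"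
proof -
  have g: "summable (\<lambda>k. exp (- d) ^ k)" using assms by (intro summable_geometric) simp
  have N: "(\<lambda>k::nat. exp (- d * real k)) summable_on UNIV"
  proof (rule norm_summable_imp_summable_on)
    have "exp (- d * real k) = exp (- d) ^ k" for k by (simp add: exp_of_nat_mult[symmetric] mult.commute)
    then show "summable (\<lambda>k. norm (exp (- d * real k)))" using g by simp
  qed
  have "(\<lambda>n::int. exp (- d * \<bar>of_int n\<bar>)) summable_on range int"
    using N by (subst summable_on_reindex) (auto simp: o_def)
  moreover have "(\<lambda>n::int. exp (- d * \<bar>of_int n\<bar>)) summable_on range (\<lambda>k. - int k)"
    using N by (subst summable_on_reindex) (auto simp: o_def inj_on_def)
  moreover have "range int \<union> range (\<lambda>k. - int k) = UNIV"
    by (metis (no_types, lifting) UNIV_eq_I UnCI int_cases2 range_eqI)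
  ultimately show ?thesis using summable_on_union by metis
qed

text \<open>Half of the exponential rate absorbs the power, the other half is summable.\<close>

lemma summable_on_int_powr_exp:
  fixes d s :: real
  assumes "d > 0"
  shows "(\<lambda>n::int. \<bar>of_int n\<bar> powr s * exp (- d * \<bar>of_int n\<bar>)) summable_on UNIV"
proof -
  obtain N :: nat where N: "s \<le> real N" using real_arch_simple by blast
  define C where "C = (2 / d) ^ N * fact N"
  have "\<bar>of_int n\<bar> powr s * exp (- d * \<bar>of_int n\<bar>) \<le> C * exp (- (d / 2) * \<bar>of_int n\<bar>)" for n :: int
  proof (cases "n = 0")
    case False
    define x where "x = \<bar>real_of_int n\<bar>"
    have x: "x \<ge> 1" using False by (simp add: x_def)
    have "x powr s \<le> x powr real N" using x N by (intro powr_mono) auto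
    also have "\<dots> = (2 / d) ^ N * (d / 2 * x) ^ N" using x assms by (simp add: powr_realpow power_mult_distrib flip: power_mult_distrib)
    also have "\<dots> \<le> (2 / d) ^ N * (fact N * exp (d / 2 * x))"
      using x assms by (intro mult_left_mono power_le_fact_exp) auto
    finally have "x powr s \<le> C * exp (d / 2 * x)" by (simp add: C_def)
    then have "x powr s * exp (- d * x) \<le> C * exp (d / 2 * x) * exp (- d * x)" by (intro mult_right_mono) auto
    also have "\<dots> = C * exp (- (d / 2) * x)"
      by (simp add: mult.assoc flip: exp_add)
    finally show ?thesis by (simp add: x_def)
  qed (use assms in \<open>simp add: C_def\<close>)
  then show ?thesis
    by (intro summable_on_le[OF summable_on_cmult_right[OF summable_on_int_exp[of "d / 2"], of C]]) (use assms in auto)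
qed

lemma l2_weighted_summable:
  fixes u :: "'m::finite l2" and s :: real
  assumes "\<And>n. norm (l2_nth u n) \<le> K * exp (- c * \<bar>of_int n\<bar>)" "c > 0"
  shows "(\<lambda>n. \<bar>of_int n\<bar> powr s * (norm (l2_nth u n))\<^sup>2) summable_on UNIV"
proof (rule summable_on_le)
  show "(\<lambda>n::int. K\<^sup>2 * (\<bar>of_int n\<bar> powr s * exp (- (2 * c) * \<bar>of_int n\<bar>))) summable_on UNIV"
    using assms(2) by (intro summable_on_cmult_right summable_on_int_powr_exp) auto
  fix n :: int
  have "(norm (l2_nth u n))\<^sup>2 \<le> (K * exp (- c * \<bar>of_int n\<bar>))\<^sup>2" using assms(1) by (intro power_mono) auto
  also have "\<dots> = K\<^sup>2 * exp (- (2 * c) * \<bar>of_int n\<bar>)" by (simp add: power_mult_distrib power2_eq_square flip: exp_add)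
  finally show "\<bar>\<bar>of_int n\<bar> powr s * (norm (l2_nth u n))\<^sup>2\<bar> \<le> K\<^sup>2 * (\<bar>of_int n\<bar> powr s * exp (- (2 * c) * \<bar>of_int n\<bar>))"
    using mult_left_mono[of "(norm (l2_nth u n))\<^sup>2" "K\<^sup>2 * exp (- (2 * c) * \<bar>of_int n\<bar>)" "\<bar>of_int n\<bar> powr s"]
    by (simp add: mult.left_commute)
qed

text \<open>Constant factors add a bounded term to the logarithm, which disappears after division by
  \<open>p * ln t\<close>.\<close>

lemma growth_exponent:
  fixes m :: "real \<Rightarrow> real"
  assumes p: "p > 0" and c: "c1 > 0" "c2 > 0"
    and lo: "\<forall>\<^sub>F t in at_top. c1 * t powr p \<le> m t" and hi: "\<forall>\<^sub>F t in at_top. m t \<le> c2 * t powr p"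
  shows "((\<lambda>t. ln (m t) / (p * ln t)) \<longlongrightarrow> 1) at_top"
proof (rule tendsto_sandwich)
  show "((\<lambda>t. (ln c1 + p * ln t) / (p * ln t)) \<longlongrightarrow> 1) at_top" using p by real_asymp
  show "((\<lambda>t. (ln c2 + p * ln t) / (p * ln t)) \<longlongrightarrow> 1) at_top" using p by real_asymp
  have ln: "ln (c * t powr p) = ln c + p * ln t" if "c > 0" "t > 1" for c t
    using that by (simp add: ln_mult ln_powr)
  show "\<forall>\<^sub>F t in at_top. (ln c1 + p * ln t) / (p * ln t) \<le> ln (m t) / (p * ln t)"
    using lo eventually_gt_at_top[of 1]
  proof eventually_elim
    case (elim t)
    then have "0 < c1 * t powr p" using c by simp
    then have "ln (c1 * t powr p) \<le> ln (m t)" using elim by simp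
    then show ?case using elim p by (simp add: ln c divide_right_mono)
  qed
  show "\<forall>\<^sub>F t in at_top. ln (m t) / (p * ln t) \<le> (ln c2 + p * ln t) / (p * ln t)"
    using lo hi eventually_gt_at_top[of 1]
  proof eventually_elim
    case (elim t)
    then have "0 < c1 * t powr p" using c by simp
    then have "ln (m t) \<le> ln (c2 * t powr p)" using elim by simp
    then show ?case using elim p by (simp add: ln c divide_right_mono)
  qed
qed

context periodic_jacobi
begin

text \<open>\<open>G\<close> couples only neighbouring sites, so it maps the weight
  \<open>exp (- c * \<bar>n\<bar>)\<close> into \<open>V\<close> times itself, and the exponential
  series sums to growth \<open>exp (V * \<bar>t\<bar>)\<close>. \<open>V\<close> depends only on
  \<open>c\<close> and the coefficients, not on the vector.\<close>

lemma U_exp_decay: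
  assumes c: "c > 0"
  obtains V where "V > 0" "\<And>\<psi> K t n. (\<And>n. norm (l2_nth \<psi> n) \<le> K * exp (- c * \<bar>of_int n\<bar>)) \<Longrightarrow>
     norm (l2_nth (U t \<psi>) n) \<le> K * exp (V * \<bar>t\<bar> - c * \<bar>of_int n\<bar>)"
proof -
  obtain C1 C2 C3 where C: "linear_family (\<lambda>n. (*v) (a n)) C1" "linear_family (\<lambda>n. (*v) (b n)) C2"
    "linear_family (\<lambda>n. (*v) (conj_transpose (a (n - 1)))) C3" using families by blast
  define B where "B = C1 + C2 + C3 + 1"
  have C0: "C1 \<ge> 0" "C2 \<ge> 0" "C3 \<ge> 0" using C by (auto simp: linear_family_def)
  have bd: "norm (a n *v x) \<le> B * norm x" "norm (b n *v x) \<le> B * norm x"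
    "norm (conj_transpose (a (n - 1)) *v x) \<le> B * norm x" for n x
    using C[unfolded linear_family_def] C0 mult_right_mono[of C1 B "norm x"] mult_right_mono[of C2 B "norm x"]
      mult_right_mono[of C3 B "norm x"] unfolding B_def by (smt (verit) norm_ge_zero)+
  have B: "B > 0" using C0 by (simp add: B_def)
  \<comment> \<open>One diagonal term and two neighbours, each neighbour costing at most a factor
    \<open>exp c\<close> of the weight.\<close>
  define V where "V = B * (1 + 2 * exp c)"
  have step: "norm (l2_nth (G \<phi>) n) \<le> (M * V) * exp (- c * \<bar>of_int n\<bar>)"
    if \<phi>: "\<And>n. norm (l2_nth \<phi> n) \<le> M * exp (- c * \<bar>of_int n\<bar>)" for \<phi> M n
  proof -
    have M: "M \<ge> 0" using order_trans[OF norm_ge_zero \<phi>[of 0]] by simp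
    have near: "norm (l2_nth \<phi> k) \<le> M * exp c * exp (- c * \<bar>of_int n\<bar>)" if "\<bar>k - n\<bar> \<le> 1" for k
    proof -
      have "\<bar>real_of_int n\<bar> \<le> \<bar>of_int k\<bar> + 1" using that by linarith
      then have "c * \<bar>real_of_int n\<bar> \<le> c * (\<bar>of_int k\<bar> + 1)" using c by (intro mult_left_mono) auto
      then have "exp (- c * \<bar>of_int k\<bar>) \<le> exp (c + - c * \<bar>of_int n\<bar>)" by (simp add: algebra_simps)
      then have "M * exp (- c * \<bar>of_int k\<bar>) \<le> M * exp (c + - c * \<bar>of_int n\<bar>)" using M by (rule mult_left_mono)
      then show ?thesis using \<phi>[of k] unfolding exp_add by (simp add: mult.assoc)
    qed
    have "norm (l2_nth (G \<phi>) n) = norm (conj_transpose (a (n - 1)) *v l2_nth \<phi> (n - 1) + b n *v l2_nth \<phi> n + a n *v l2_nth \<phi> (n + 1))"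
      unfolding G_def cscale.rep_eq norm_vector_scalar_mult by (simp add: J_eq plus_l2.rep_eq nth_simps)
    also have "\<dots> \<le> B * norm (l2_nth \<phi> (n - 1)) + B * norm (l2_nth \<phi> n) + B * norm (l2_nth \<phi> (n + 1))"
      by (intro norm_triangle_le add_mono bd)
    also have "\<dots> \<le> B * (M * exp c * exp (- c * \<bar>of_int n\<bar>)) + B * (M * exp (- c * \<bar>of_int n\<bar>)) + B * (M * exp c * exp (- c * \<bar>of_int n\<bar>))"
      using B \<phi>[of n] by (intro add_mono mult_left_mono near) auto
    also have "\<dots> = (M * V) * exp (- c * \<bar>of_int n\<bar>)" by (simp add: V_def algebra_simps)
    finally show ?thesis .
  qed
  show ?thesis
  proof (rule that[of V])
    show "V > 0" using B by (simp add: V_def add_pos_pos)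
    fix \<psi> :: "'m l2" and K t :: real and n :: int assume \<psi>: "\<And>n. norm (l2_nth \<psi> n) \<le> K * exp (- c * \<bar>of_int n\<bar>)"
    have Gk: "norm (l2_nth ((G ^^ k) \<psi>) n) \<le> (K * V ^ k) * exp (- c * \<bar>of_int n\<bar>)" for k n
    proof (induction k arbitrary: n)
      case (Suc k) show ?case using step[OF Suc] by (simp add: algebra_simps)
    qed (use \<psi> in simp)
    obtain C where C: "\<And>k u. norm ((G ^^ k) u) \<le> norm u * C ^ k" using G_bound by metis
    let ?E = "exp (- c * \<bar>of_int n\<bar>)"
    have "l2_nth (U t \<psi>) n = (\<Sum>k. (t ^ k / fact k) *\<^sub>R l2_nth ((G ^^ k) \<psi>) n)"
      unfolding U_series exp_series_def
      by (subst bounded_linear.suminf[OF bounded_linear_l2_nth summable_exp_series[OF C]]) (simp add: scaleR_l2.rep_eq)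
    also have "norm \<dots> \<le> (\<Sum>k. norm ((t ^ k / fact k) *\<^sub>R l2_nth ((G ^^ k) \<psi>) n))"
    proof (rule summable_norm)
      show "summable (\<lambda>k. norm ((t ^ k / fact k) *\<^sub>R l2_nth ((G ^^ k) \<psi>) n))"
      proof (rule summable_comparison_test[OF _ summable_exp_bound[of t "K * ?E" V]], intro exI allI impI)
        fix k show "norm (norm ((t ^ k / fact k) *\<^sub>R l2_nth ((G ^^ k) \<psi>) n)) \<le> \<bar>t\<bar> ^ k / fact k * (K * ?E * V ^ k)"
          using mult_left_mono[OF Gk[of k n], of "\<bar>t\<bar> ^ k / fact k"] by (simp add: power_abs mult_ac)
      qed
    qed
    also have "\<dots> \<le> (\<Sum>k. K * ?E * ((\<bar>t\<bar> * V) ^ k /\<^sub>R fact k))"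
    proof (rule suminf_le)
      show le: "norm ((t ^ k / fact k) *\<^sub>R l2_nth ((G ^^ k) \<psi>) n) \<le> K * ?E * ((\<bar>t\<bar> * V) ^ k /\<^sub>R fact k)" for k
      proof -
        have "norm ((t ^ k / fact k) *\<^sub>R l2_nth ((G ^^ k) \<psi>) n) = \<bar>t\<bar> ^ k / fact k * norm (l2_nth ((G ^^ k) \<psi>) n)"
          by (simp add: power_abs)
        also have "\<dots> \<le> \<bar>t\<bar> ^ k / fact k * ((K * V ^ k) * ?E)" by (intro mult_left_mono Gk) auto
        finally show ?thesis by (simp add: power_mult_distrib divide_inverse mult_ac)
      qed
      show 2: "summable (\<lambda>k. K * ?E * ((\<bar>t\<bar> * V) ^ k /\<^sub>R fact k))"
        by (intro summable_mult summable_exp_generic)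
      show "summable (\<lambda>k. norm ((t ^ k / fact k) *\<^sub>R l2_nth ((G ^^ k) \<psi>) n))"
        by (rule summable_comparison_test[OF _ 2]) (use le in auto)
    qed
    also have "\<dots> = K * ?E * exp (\<bar>t\<bar> * V)"
      unfolding exp_def by (rule suminf_mult) (rule summable_exp_generic)
    also have "\<dots> = K * exp (V * \<bar>t\<bar> - c * \<bar>of_int n\<bar>)"
      by (simp add: mult.assoc mult.commute[of V] flip: exp_add)
    finally show "norm (l2_nth (U t \<psi>) n) \<le> K * exp (V * \<bar>t\<bar> - c * \<bar>of_int n\<bar>)" .
  qed
qed

theorem transport_exponents:
  assumes \<psi>0: "\<psi> \<noteq> 0" and decay: "exp_decaying \<psi>" and p: "p > 0"
  shows "beta_upper J \<psi> p = 1 \<and> beta_lower J \<psi> p = 1"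
proof -
  obtain K c where K: "K > 0" "c > 0" "\<And>n. norm (l2_nth \<psi> n) \<le> K * exp (- c * \<bar>of_int n\<bar>)"
    using decay by (auto simp: exp_decaying_def)
  obtain V where V: "V > 0" "\<And>t n. norm (l2_nth (U t \<psi>) n) \<le> K * exp (V * \<bar>t\<bar> - c * \<bar>of_int n\<bar>)"
    using U_exp_decay[OF K(2)] K(3) by metis
  define w where "w t n = (norm (l2_nth (U (- t) \<psi>) n))\<^sup>2" for t n
  have w0: "w t n \<ge> 0" for t n by (simp add: w_def)
  have dec: "norm (l2_nth (U t \<psi>) n) \<le> (K * exp (V * \<bar>t\<bar>)) * exp (- c * \<bar>of_int n\<bar>)" for t n
    using V(2)[of t n] by (simp add: mult.assoc flip: exp_add)
  have sw: "(\<lambda>n. \<bar>of_int n\<bar> powr s * w t n) summable_on UNIV" for s t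
    unfolding w_def using l2_weighted_summable[OF dec K(2)] .
  have sw1: "w t summable_on UNIV" for t unfolding w_def by (rule l2_summable)
  have w1: "infsum (w t) UNIV = (norm \<psi>)\<^sup>2" for t
    unfolding w_def norm_l2_sq[symmetric] by simp
  \<comment> \<open>Majorant for the sites outside the cone
    \<open>\<bar>n\<bar> \<le> R * t\<close>; it does not depend on time, so neither does its sum
    \<open>T s\<close>.\<close>
  define E where "E s = (\<lambda>n::int. K\<^sup>2 * (\<bar>of_int n\<bar> powr s * exp (- c * \<bar>of_int n\<bar>)))" for s
  have sE: "E s summable_on UNIV" for s
    unfolding E_def by (intro summable_on_cmult_right summable_on_int_powr_exp K)
  have E0: "E s n \<ge> 0" for s n by (simp add: E_def)
  define T where "T s = infsum (E s) UNIV" for s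
  have T0: "T s \<ge> 0" for s unfolding T_def by (rule infsum_nonneg) (simp add: E0)
  define m where "m s t = (\<Sum>\<^sub>\<infinity>n. \<bar>of_int n\<bar> powr s * w t n)" for s t
  have moment: "moment J p \<psi> t = m p t" for t
  proof -
    let ?u = "U (- t) \<psi>"
    have "(\<lambda>n. (norm ((\<bar>of_int n\<bar> powr p) *\<^sub>R l2_nth ?u n))\<^sup>2) summable_on UNIV"
    proof -
      have "(norm ((\<bar>of_int n\<bar> powr p) *\<^sub>R l2_nth ?u n))\<^sup>2 = \<bar>of_int n\<bar> powr (p + p) * w t n" for n
        unfolding powr_add by (simp add: w_def power_mult_distrib power2_eq_square)
      then show ?thesis using sw[of "p + p" t] by (simp only:)
    qed
    then have "l2_nth (abs_pos_pow p ?u) n = (\<bar>of_int n\<bar> powr p) *\<^sub>R l2_nth ?u n" for n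
      unfolding abs_pos_pow_def by (subst Abs_l2_inverse) auto
    then show ?thesis
      by (simp add: moment_def Re_cinner inner_l2_def m_def w_def power2_norm_eq_inner)
  qed
  \<comment> \<open>Speed of the cone: outside it, half of the decay rate \<open>2 * c\<close> of
    the squared amplitude pays for the growth \<open>exp (2 * V * t)\<close>.\<close>
  define R where "R = max 1 (2 * V / c)"
  have R: "R \<ge> 1" "2 * V \<le> c * R" using K(2) by (auto simp: R_def max_def field_simps)
  have far: "\<bar>of_int n\<bar> powr s * w t n \<le> E s n" if "\<bar>of_int n\<bar> > R * t" "t \<ge> 0" for n s t
  proof -
    have "w t n \<le> (K * exp (V * t - c * \<bar>of_int n\<bar>))\<^sup>2"
      unfolding w_def using V(2)[of "- t" n] that by (intro power_mono) auto
    also have "\<dots> = K\<^sup>2 * exp (2 * V * t - 2 * c * \<bar>of_int n\<bar>)"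
      by (simp add: power_mult_distrib power2_eq_square algebra_simps flip: exp_add)
    also have "\<dots> \<le> K\<^sup>2 * exp (- c * \<bar>of_int n\<bar>)"
    proof -
      have "2 * V * t \<le> c * R * t" using R(2) that(2) by (rule mult_right_mono)
      also have "\<dots> \<le> c * \<bar>of_int n\<bar>" using that(1) K(2) by (simp add: mult.assoc)
      finally show ?thesis by (intro mult_left_mono) auto
    qed
    finally have "\<bar>of_int n\<bar> powr s * w t n \<le> \<bar>of_int n\<bar> powr s * (K\<^sup>2 * exp (- c * \<bar>of_int n\<bar>))"
      by (rule mult_left_mono) simp
    then show ?thesis by (simp add: E_def mult_ac)
  qed
  \<comment> \<open>Inside the cone \<open>\<bar>n\<bar>\<close> is at most \<open>R * t\<close>,
    and the total mass is conserved.\<close>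
  have upper: "m p t \<le> (R powr p * (norm \<psi>)\<^sup>2 + T p) * t powr p" if t: "t \<ge> 1" for t
  proof -
    have "m p t \<le> (\<Sum>\<^sub>\<infinity>n. (R * t) powr p * w t n + E p n)"
      unfolding m_def
    proof (rule infsum_mono[OF sw])
      show "(\<lambda>n. (R * t) powr p * w t n + E p n) summable_on UNIV"
        by (intro summable_on_add summable_on_cmult_right sw1 sE)
      fix n
      show "\<bar>of_int n\<bar> powr p * w t n \<le> (R * t) powr p * w t n + E p n"
      proof (cases "\<bar>of_int n\<bar> > R * t")
        case True
        then show ?thesis using far[OF True, of p] t w0 by (simp add: add_increasing)
      next
        case False
        then have "\<bar>of_int n\<bar> powr p * w t n \<le> (R * t) powr p * w t n"
          using p w0 by (intro mult_right_mono powr_mono2) auto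
        then show ?thesis using E0[of p n] by linarith
      qed
    qed
    also have "\<dots> = (R * t) powr p * (norm \<psi>)\<^sup>2 + T p"
      unfolding T_def w1[of t, symmetric]
      by (simp add: infsum_add infsum_cmult_right' summable_on_cmult_right sw1 sE)
    also have "\<dots> \<le> (R * t) powr p * (norm \<psi>)\<^sup>2 + T p * t powr p"
      using t p T0[of p] by (simp add: mult_left_le ge_one_powr_ge_zero mult_le_cancel_left1)
    finally show ?thesis using R t by (simp add: powr_mult algebra_simps)
  qed
  have \<psi>dom: "\<psi> \<in> pos_dom"
    using sw[of 2 0] by (simp add: pos_dom_def w_def power_mult_distrib powr_numeral)
  define g where "g = (norm (Q \<psi>))\<^sup>2"
  have g: "g > 0" using Q_injective[of \<psi>] \<psi>0 by (auto simp: g_def)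
  \<comment> \<open>Sites with \<open>\<bar>n\<bar> \<le> \<epsilon> * t\<close> then contribute at
    most \<open>g / 4\<close> to the second moment of \<open>X(t)/t\<close>.\<close>
  define \<epsilon> where "\<epsilon> = sqrt (g / 4) / norm \<psi>"
  have \<epsilon>: "\<epsilon> > 0" "\<epsilon>\<^sup>2 * (norm \<psi>)\<^sup>2 = g / 4" using g \<psi>0 by (auto simp: \<epsilon>_def power_divide)
  \<comment> \<open>On \<open>[\<epsilon>, R]\<close> the function \<open>x powr (2 - p)\<close> is
    increasing or decreasing according to \<open>p\<close>; the sum of its endpoint values bounds it
    in both cases and converts the \<open>p\<close>-th moment into the second.\<close>
  define D where "D = \<epsilon> powr (2 - p) + R powr (2 - p)"
  have D: "D > 0" using \<epsilon> by (simp add: D_def add_pos_nonneg)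
  have pw: "x powr (2 - p) \<le> D" if "\<epsilon> \<le> x" "x \<le> R" for x
  proof (cases "p \<le> 2")
    case True
    then have "x powr (2 - p) \<le> R powr (2 - p)" using that \<epsilon>(1) by (intro powr_mono2) auto
    then show ?thesis by (simp add: D_def add_increasing)
  next
    case False
    then have "x powr (2 - p) \<le> \<epsilon> powr (2 - p)" using that \<epsilon>(1) by (intro powr_mono2') auto
    then show ?thesis by (simp add: D_def add_increasing2)
  qed
  \<comment> \<open>Three zones: near the origin, a middle zone where second and \<open>p\<close>-th
    moments are comparable, and outside the cone.\<close>
  have lower: "(norm ((1 / t) *\<^sub>R heis_op J t \<psi>))\<^sup>2 \<le> g / 4 + D * (m p t / t powr p) + T 2 / t\<^sup>2" if t: "t \<ge> 1" for t
  proof -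
    have "(norm (heis_op J t \<psi>))\<^sup>2 = (\<Sum>\<^sub>\<infinity>n. \<bar>of_int n\<bar> powr 2 * w t n)"
      unfolding heis_op_def norm_U norm_l2_sq
      by (simp add: pos_op_nth[OF U_pos_dom[OF \<psi>dom]] w_def power_mult_distrib powr_numeral)
    also have "\<dots> \<le> (\<Sum>\<^sub>\<infinity>n. (\<epsilon> * t)\<^sup>2 * w t n + (D * t powr (2 - p)) * (\<bar>of_int n\<bar> powr p * w t n) + E 2 n)"
    proof (rule infsum_mono[OF sw])
      show "(\<lambda>n. (\<epsilon> * t)\<^sup>2 * w t n + (D * t powr (2 - p)) * (\<bar>of_int n\<bar> powr p * w t n) + E 2 n) summable_on UNIV"
        by (intro summable_on_add summable_on_cmult_right sw1 sw sE)
      fix n :: int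
      define x where "x = \<bar>real_of_int n\<bar>"
      have nn: "(\<epsilon> * t)\<^sup>2 * w t n \<ge> 0" "(D * t powr (2 - p)) * (x powr p * w t n) \<ge> 0" using D w0 by auto
      consider "x > R * t" | "x \<le> \<epsilon> * t" | "x \<le> R * t" "x > \<epsilon> * t" by linarith
      then have "x powr 2 * w t n \<le> (\<epsilon> * t)\<^sup>2 * w t n + (D * t powr (2 - p)) * (x powr p * w t n) + E 2 n"
      proof cases
        case 1
        then have "x powr 2 * w t n \<le> E 2 n" unfolding x_def using far[of t n 2] t by simp
        then show ?thesis using nn by linarith
      next
        case 2
        then have "x\<^sup>2 * w t n \<le> (\<epsilon> * t)\<^sup>2 * w t n" using w0 by (intro mult_right_mono power_mono) (auto simp: x_def)
        then show ?thesis using nn E0[of 2 n] by (simp add: x_def powr_numeral)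
      next
        case 3
        have x0: "x > 0" using 3 \<epsilon>(1) t by (smt (verit) mult_pos_pos)
        have "x powr 2 = (x / t) powr (2 - p) * t powr (2 - p) * x powr p"
          using x0 t by (simp add: powr_divide flip: powr_add)
        also have "\<dots> \<le> D * t powr (2 - p) * x powr p"
          using 3 t by (intro mult_right_mono pw) (auto simp: field_simps)
        finally have "x powr 2 * w t n \<le> (D * t powr (2 - p) * x powr p) * w t n" using w0 by (rule mult_right_mono)
        then show ?thesis using nn E0[of 2 n] by (simp add: mult.assoc)
      qed
      then show "\<bar>of_int n\<bar> powr 2 * w t n \<le> (\<epsilon> * t)\<^sup>2 * w t n + (D * t powr (2 - p)) * (\<bar>of_int n\<bar> powr p * w t n) + E 2 n"
        by (simp add: x_def)
    qed
    also have "\<dots> = (\<epsilon> * t)\<^sup>2 * (norm \<psi>)\<^sup>2 + (D * t powr (2 - p)) * m p t + T 2"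
      unfolding T_def m_def w1[of t, symmetric]
      by (simp add: infsum_add infsum_cmult_right' summable_on_add summable_on_cmult_right sw1 sw sE)
    finally have "(norm (heis_op J t \<psi>))\<^sup>2 / t\<^sup>2 \<le> ((\<epsilon> * t)\<^sup>2 * (norm \<psi>)\<^sup>2 + (D * t powr (2 - p)) * m p t + T 2) / t\<^sup>2"
      by (rule divide_right_mono) simp
    also have "\<dots> = g / 4 + D * (m p t / t powr p) + T 2 / t\<^sup>2"
      using t by (simp add: add_divide_distrib power_mult_distrib \<epsilon>(2)[symmetric] powr_diff powr_numeral)
    finally show ?thesis using t by (simp add: power_mult_distrib power_divide)
  qed
  have "((\<lambda>t. (norm ((1 / t) *\<^sub>R heis_op J t \<psi>))\<^sup>2) \<longlongrightarrow> g) at_top"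
    unfolding g_def by (intro tendsto_power tendsto_norm heis_Q \<psi>dom)
  then have ev1: "\<forall>\<^sub>F t in at_top. 3 * g / 4 < (norm ((1 / t) *\<^sub>R heis_op J t \<psi>))\<^sup>2"
    by (rule order_tendstoD) (use g in simp)
  have "((\<lambda>t. T 2 / t\<^sup>2) \<longlongrightarrow> 0) at_top" by real_asymp
  then have ev2: "\<forall>\<^sub>F t in at_top. T 2 / t\<^sup>2 < g / 4" by (rule order_tendstoD) (use g in simp)
  \<comment> \<open>From \<open>3 * g / 4\<close> the inner and outer zones take at most
    \<open>g / 4\<close> each, so \<open>g / 4\<close> is left for the middle zone.\<close>
  have lo: "\<forall>\<^sub>F t in at_top. (g / (4 * D)) * t powr p \<le> m p t"
    using ev1 ev2 eventually_ge_at_top[of 1]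
  proof eventually_elim
    case (elim t)
    then have "g / 4 \<le> D * (m p t / t powr p)" using lower[of t] by linarith
    then show ?case using D elim(3) by (simp add: field_simps)
  qed
  have hi: "\<forall>\<^sub>F t in at_top. m p t \<le> (R powr p * (norm \<psi>)\<^sup>2 + T p) * t powr p"
    using eventually_ge_at_top[of 1] by eventually_elim (rule upper)
  have "((\<lambda>t. ln (m p t) / (p * ln t)) \<longlongrightarrow> 1) at_top"
    by (rule growth_exponent[OF p _ _ lo hi]) (use g D R \<psi>0 T0 in \<open>auto intro!: add_pos_nonneg\<close>)
  then have lim: "((\<lambda>t. ereal (ln (moment J p \<psi> t) / (p * ln t))) \<longlongrightarrow> 1) at_top"
    unfolding moment one_ereal_def by (rule tendsto_ereal)
  show ?thesis
    using lim_imp_Limsup[OF _ lim] lim_imp_Liminf[OF _ lim] by (simp add: beta_upper_def beta_lower_def)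
qed

end

subsection \<open>Forms and monotone limits of self-adjoint operators\<close>

lemma form_eq_imp_eq:
  assumes S: "bounded_selfadjoint S" and T: "bounded_selfadjoint T"
    and eq: "\<And>u. inner u (S u) = inner u (T u)"
  shows "S u = T u"
proof -
  have "inner v (S u) = inner v (T u)" for v
    using eq[of "u + v"] eq[of u] eq[of v] bounded_selfadjointD(4)[OF S, of u v] bounded_selfadjointD(4)[OF T, of u v]
    by (simp add: linear_simps[OF bounded_selfadjointD(2)[OF S]] linear_simps[OF bounded_selfadjointD(2)[OF T]]
        inner_add_left inner_add_right inner_commute)
  from this[of "S u - T u"] have "inner (S u - T u) (S u - T u) = 0" by (simp add: inner_diff_right)
  then show ?thesis by simp
qed

text \<open>The form of \<open>D\<close> at \<open>u - D u\<close> is nonnegative; expanding it and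
  bounding the form at \<open>D u\<close> by the squared norm gives
  \<open>D\<^sup>2 \<le> D\<close>.\<close>

lemma norm_sq_le_form:
  assumes D: "bounded_selfadjoint D" and bd: "\<And>u. 0 \<le> inner u (D u)" "\<And>u. inner u (D u) \<le> (norm u)\<^sup>2"
  shows "(norm (D u))\<^sup>2 \<le> inner u (D u)"
proof -
  have "0 \<le> inner (u - D u) (D (u - D u))" by (rule bd)
  also have "\<dots> = inner u (D u) - 2 * (norm (D u))\<^sup>2 + inner (D u) (D (D u))"
    by (simp add: linear_simps[OF bounded_selfadjointD(2)[OF D]] inner_diff_left inner_diff_right power2_norm_eq_inner
        bounded_selfadjointD(4)[OF D, of u "D u", symmetric])
  also have "inner (D u) (D (D u)) \<le> (norm (D u))\<^sup>2" by (rule bd)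
  finally show ?thesis by simp
qed

lemma selfadjoint_combination:
  assumes "bounded_selfadjoint S" "bounded_selfadjoint T"
  shows "bounded_selfadjoint (\<lambda>u. S u + T u)" "bounded_selfadjoint (\<lambda>u. S u - T u)"
  using bounded_selfadjointD[OF assms(1)] bounded_selfadjointD[OF assms(2)]
  by (auto intro!: bounded_selfadjointI bounded_operatorI bounded_linear_add bounded_linear_sub
      simp: inner_add_left inner_add_right inner_diff_left inner_diff_right)

lemma selfadjoint_const: "bounded_selfadjoint (\<lambda>u. u)" "bounded_selfadjoint (\<lambda>u. 0)"
  by (auto intro!: bounded_selfadjointI bounded_operatorI bounded_linear_ident)

lemma selfadjoint_limit:
  assumes T: "\<And>n. bounded_selfadjoint (T n)" and bd: "\<And>n u. norm (T n u) \<le> K * norm u"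
    and lim: "\<And>u. ((\<lambda>n. T n u) \<longlongrightarrow> L u) F" and F: "F \<noteq> bot"
  shows "bounded_selfadjoint L"
proof (intro bounded_selfadjointI bounded_operatorI)
  note lin = linear_simps[OF bounded_selfadjointD(2)[OF T]]
  have u: "L u = l" if "((\<lambda>n. T n u) \<longlongrightarrow> l) F" for u l using lim that F tendsto_unique by blast
  show "bounded_linear L"
  proof (rule bounded_linear_intro[of _ K])
    show "L (u + v) = L u + L v" for u v by (rule u) (simp add: lin tendsto_add lim)
    show "L (r *\<^sub>R v) = r *\<^sub>R L v" for r v by (rule u) (simp add: lin tendsto_scaleR lim)
    show "norm (L v) \<le> norm v * K" for v
      by (rule tendsto_upperbound[OF tendsto_norm[OF lim] _ F]) (use bd in \<open>simp add: mult.commute\<close>)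
  qed
  show "L (cscale \<i> v) = cscale \<i> (L v)" for v
    by (rule u) (simp add: bounded_selfadjointD(3)[OF T] bounded_linear.tendsto[OF bounded_linear_cscale lim])
  show "inner (L v) w = inner v (L w)" for v w
    using tendsto_inner[OF lim[of v] tendsto_const[of w]] tendsto_inner[OF tendsto_const[of v] lim[of w]] F
    by (simp add: bounded_selfadjointD(4)[OF T] tendsto_unique)
qed

text \<open>Differences lie between 0 and 1, so \<open>norm_sq_le_form\<close> bounds their squared
  norm on \<open>u\<close> by increments of a convergent numerical sequence.\<close>

lemma increasing_selfadjoint_limit:
  fixes T :: "nat \<Rightarrow> 'm::finite l2 \<Rightarrow> 'm l2"
  assumes T: "\<And>n. bounded_selfadjoint (T n)"
    and inc: "\<And>u. incseq (\<lambda>n. inner u (T n u))"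
    and bd: "\<And>n u. 0 \<le> inner u (T n u)" "\<And>n u. inner u (T n u) \<le> (norm u)\<^sup>2"
  obtains L where "bounded_selfadjoint L" "\<And>u. (\<lambda>n. T n u) \<longlonglongrightarrow> L u"
proof -
  have diff: "(norm (T n u - T m u))\<^sup>2 \<le> inner u (T n u) - inner u (T m u)" if "m \<le> n" for m n u
  proof -
    have "(norm (T n u - T m u))\<^sup>2 \<le> inner u (T n u - T m u)"
    proof (rule norm_sq_le_form[OF selfadjoint_combination(2)[OF T T]])
      fix v show "0 \<le> inner v (T n v - T m v)" using incseqD[OF inc that] by (simp add: inner_diff_right)
      show "inner v (T n v - T m v) \<le> (norm v)\<^sup>2"
        using bd(1)[of v m] bd(2)[of v n] by (simp add: inner_diff_right)
    qed
    then show ?thesis by (simp add: inner_diff_right)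
  qed
  have "Cauchy (\<lambda>n. T n u)" for u
  proof (rule metric_CauchyI)
    fix e :: real assume e: "e > 0"
    obtain l where l: "(\<lambda>n. inner u (T n u)) \<longlonglongrightarrow> l"
      using incseq_convergent[OF inc[of u]] bd(2) by metis
    then have "Cauchy (\<lambda>n. inner u (T n u))" using LIMSEQ_imp_Cauchy by blast
    from metric_CauchyD[OF this, of "e\<^sup>2"] e obtain M
      where M: "\<And>m n. m \<ge> M \<Longrightarrow> n \<ge> M \<Longrightarrow> \<bar>inner u (T m u) - inner u (T n u)\<bar> < e\<^sup>2" by (auto simp: dist_real_def)
    have *: "norm (T n u - T m u) < e" if "M \<le> m" "m \<le> n" for m n
    proof -
      have "(norm (T n u - T m u))\<^sup>2 < e\<^sup>2" using diff[OF that(2), of u] M[of n m] that by linarith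
      then show ?thesis by (rule power2_less_imp_less) (use e in simp)
    qed
    have "dist (T m u) (T n u) < e" if "M \<le> m" "M \<le> n" for m n
      using *[of m n] *[of n m] that by (cases "m \<le> n") (auto simp: dist_norm norm_minus_commute)
    then show "\<exists>M. \<forall>m\<ge>M. \<forall>n\<ge>M. dist (T m u) (T n u) < e" by blast
  qed
  then have "\<forall>u. \<exists>l. (\<lambda>n. T n u) \<longlonglongrightarrow> l" using Cauchy_convergent convergent_def by blast
  then obtain L where L: "\<And>u. (\<lambda>n. T n u) \<longlonglongrightarrow> L u" by metis
  have "norm (T n u) \<le> 1 * norm u" for n u
  proof -
    have "(norm (T n u))\<^sup>2 \<le> (norm u)\<^sup>2" by (rule order_trans[OF norm_sq_le_form[OF T bd] bd(2)])
    then show ?thesis using power2_le_imp_le by fastforce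
  qed
  from selfadjoint_limit[OF T this L] show ?thesis using that L by simp
qed

subsection \<open>Projection-valued measures and their scalar measures\<close>

lemma Int_stable_rays: "Int_stable (range (greaterThan :: real \<Rightarrow> _))"
proof -
  have "{x<..} \<inter> {y<..} = {max x y<..}" for x y :: real by auto
  then show ?thesis by (auto simp: Int_stable_def)
qed

lemma rays_Pow: "range (greaterThan :: real \<Rightarrow> _) \<subseteq> Pow UNIV"
  by simp

lemmas rays_induct =
  sigma_sets_induct_disjoint[OF Int_stable_rays rays_Pow, consumes 1, case_names basic empty compl union]

text \<open>A positive operator measure given by its forms, without multiplicativity. This separates
  what follows from the scalar measures alone from the projection property, which
  \<open>projection_valued_measureI\<close> adds.\<close>

locale form_measure =
  fixes E :: "real set \<Rightarrow> 'm::finite l2 \<Rightarrow> 'm l2" and M :: "'m l2 \<Rightarrow> real measure"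
  assumes fin: "finite_measure (M u)" and sets_M [measurable_cong]: "sets (M u) = sets borel"
    and total: "measure (M u) UNIV = (norm u)\<^sup>2"
    and sa: "B \<in> sets borel \<Longrightarrow> bounded_selfadjoint (E B)"
    and form: "B \<in> sets borel \<Longrightarrow> inner u (E B u) = measure (M u) B"
begin

lemma space_M [simp]: "space (M u) = UNIV"
  using sets_eq_imp_space_eq[OF sets_M] by simp

lemma measure_le: "measure (M u) B \<le> (norm u)\<^sup>2"
  using finite_measure.bounded_measure[OF fin, of u B] by (simp add: total)

lemma spectral_measure_eq: "spectral_measure E u = M u"
proof -
  have "spectral_measure E u = measure_of (space (M u)) (sets (M u)) (emeasure (M u))"
    unfolding spectral_measure_def sets_M space_M
  proof (rule measure_of_eq)
    fix B :: "real set" assume "B \<in> sigma_sets UNIV (sets borel)"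
    then have "B \<in> sets borel" by (metis sets.sigma_sets_eq space_borel)
    then show "ennreal (Re (cinner u (E B u))) = emeasure (M u) B"
      by (simp add: Re_cinner form finite_measure.emeasure_eq_measure[OF fin])
  qed simp
  then show ?thesis by (simp only: measure_of_of_measure)
qed

lemma eqI: "B \<in> sets borel \<Longrightarrow> bounded_selfadjoint T \<Longrightarrow> (\<And>u. inner u (T u) = measure (M u) B) \<Longrightarrow> E B u = T u"
  by (rule form_eq_imp_eq) (auto simp: sa form)

lemma E_empty: "E {} u = 0"
  by (rule eqI) (auto simp: selfadjoint_const)

lemma E_UNIV: "E UNIV u = u"
  by (rule eqI) (auto simp: selfadjoint_const total power2_norm_eq_inner)

lemma E_Diff: "B \<in> sets borel \<Longrightarrow> C \<in> sets borel \<Longrightarrow> C \<subseteq> B \<Longrightarrow> E (B - C) u = E B u - E C u"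
  by (rule eqI) (auto intro!: selfadjoint_combination sa simp: inner_diff_right form finite_measure.finite_measure_Diff[OF fin] sets_M)

text \<open>Partial sums increase and stay below the identity, so they converge strongly; countable
  additivity of the scalar measures identifies the form of the limit.\<close>

lemma E_sums:
  assumes B: "range B \<subseteq> sets borel" "disjoint_family B"
  shows "(\<lambda>k. E (B k) u) sums E (\<Union>k. B k) u"
proof -
  have Bk: "B k \<in> sets borel" for k using B by auto
  define T where "T n u = (\<Sum>k<n. E (B k) u)" for n u
  have T: "bounded_selfadjoint (T n)" for n
    unfolding T_def
    by (induction n) (simp_all add: selfadjoint_const selfadjoint_combination(1) sa Bk)
  have formT: "inner u (T n u) = (\<Sum>k<n. measure (M u) (B k))" for n u
    by (simp add: T_def inner_sum_right form Bk)
  have s: "(\<lambda>k. measure (M u) (B k)) sums measure (M u) (\<Union>k. B k)" for u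
    by (rule finite_measure.finite_measure_UNION[OF fin]) (use B sets_M in auto)
  obtain L where L: "bounded_selfadjoint L" "\<And>u. (\<lambda>n. T n u) \<longlonglongrightarrow> L u"
  proof (rule increasing_selfadjoint_limit[OF T])
    show "incseq (\<lambda>n. inner u (T n u))" for u
      unfolding formT by (auto intro!: incseq_SucI)
    show "0 \<le> inner u (T n u)" for n u unfolding formT by (simp add: sum_nonneg)
    show "inner u (T n u) \<le> (norm u)\<^sup>2" for n u
      unfolding formT using sum_le_suminf[OF sums_summable[OF s]] sums_unique[OF s] measure_le order_trans
      by (metis finite_lessThan measure_nonneg)
  qed blast
  have "inner v (L v) = measure (M v) (\<Union>k. B k)" for v
    using tendsto_inner[OF tendsto_const[of v] L(2)[of v]] s[of v] LIMSEQ_unique unfolding formT sums_def by blast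
  then have "E (\<Union>k. B k) u = L u" by (intro eqI L) (use B in auto)
  then show ?thesis using L(2)[of u] by (simp add: sums_def T_def)
qed

text \<open>Dynkin's argument in one variable at a time: first \<open>B\<close> varies against a
  ray, then \<open>C\<close> varies with \<open>B\<close> fixed.\<close>

lemma mult_from_rays:
  assumes base: "\<And>x y u. E ({x<..} \<inter> {y<..}) u = E {x<..} (E {y<..} u)"
    and B: "B \<in> sets borel" and C: "C \<in> sets borel"
  shows "E (B \<inter> C) u = E B (E C u)"
proof -
  have gen: "sets (borel :: real measure) = sigma_sets UNIV (range greaterThan)"
    by (subst borel_Ioi, subst sets_measure_of) auto
  have rays: "{x<..} \<in> sets borel" for x :: real by simp
  have step1: "E (B \<inter> {y<..}) u = E B (E {y<..} u)" if "B \<in> sets borel" for B y u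
    using that unfolding gen
  proof (induction arbitrary: u rule: rays_induct)
    case (compl A)
    then have A: "A \<in> sets borel" by (simp add: gen)
    have "(UNIV - A) \<inter> {y<..} = {y<..} - A \<inter> {y<..}" by auto
    then show ?case using compl.IH A by (simp add: E_Diff E_UNIV)
  next
    case (union A)
    then have A: "A i \<in> sets borel" for i by (auto simp: gen)
    have "(\<lambda>k. E (A k \<inter> {y<..}) u) sums E (\<Union>k. A k \<inter> {y<..}) u"
      by (rule E_sums) (use A union.hyps(1) in \<open>auto simp: disjoint_family_on_def\<close>)
    moreover have "(\<lambda>k. E (A k) (E {y<..} u)) sums E (\<Union>k. A k) (E {y<..} u)"
      by (rule E_sums) (use A union.hyps(1) in auto)
    moreover have "(\<Union>k. A k) \<inter> {y<..} = (\<Union>k. A k \<inter> {y<..})" by auto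
    ultimately show ?case using sums_unique2 unfolding union.IH by metis
  qed (auto simp: base E_empty)
  show ?thesis
    using C unfolding gen
  proof (induction arbitrary: u rule: rays_induct)
    case (basic A)
    then show ?case using step1[OF B] by auto
  next
    case (compl A)
    then have A: "A \<in> sets borel" by (simp add: gen)
    have "B \<inter> (UNIV - A) = B - B \<inter> A" by auto
    then show ?case using compl.IH A B
      by (simp add: E_Diff E_UNIV linear_simps[OF bounded_selfadjointD(2)[OF sa[OF B]]])
  next
    case (union A)
    then have A: "A i \<in> sets borel" for i by (auto simp: gen)
    have "(\<lambda>k. E (B \<inter> A k) u) sums E (\<Union>k. B \<inter> A k) u"
      by (rule E_sums) (use A B union.hyps(1) in \<open>auto simp: disjoint_family_on_def\<close>)
    moreover have "(\<lambda>k. E B (E (A k) u)) sums E B (E (\<Union>k. A k) u)"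
      by (rule bounded_linear.sums[OF bounded_selfadjointD(2)[OF sa[OF B]]], rule E_sums) (use A union.hyps(1) in auto)
    moreover have "B \<inter> (\<Union>k. A k) = (\<Union>k. B \<inter> A k)" by auto
    ultimately show ?case using sums_unique2 unfolding union.IH by metis
  qed (auto simp: E_empty linear_simps[OF bounded_selfadjointD(2)[OF sa[OF B]]])
qed

lemma projection_valued_measureI:
  assumes "\<And>B C u. B \<in> sets borel \<Longrightarrow> C \<in> sets borel \<Longrightarrow> E (B \<inter> C) u = E B (E C u)"
  shows "projection_valued_measure E"
  unfolding projection_valued_measure_def
  using assms[of B B for B] by (auto simp: sa E_empty E_UNIV assms intro!: E_sums)

end

text \<open>The sets whose measure is the form of some operator are closed under complements, by
  subtracting from the identity, and under disjoint unions, by monotone limits.\<close>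

lemma form_measure_from_rays:
  fixes M :: "'m::finite l2 \<Rightarrow> real measure"
  assumes fin: "\<And>u. finite_measure (M u)" and sets_M: "\<And>u. sets (M u) = sets borel"
    and total: "\<And>u. measure (M u) UNIV = (norm u)\<^sup>2"
    and rays: "\<And>x. \<exists>T. bounded_selfadjoint T \<and> (\<forall>u. inner u (T u) = measure (M u) {x<..})"
  obtains E where "form_measure E M"
proof -
  have gen: "sets (borel :: real measure) = sigma_sets UNIV (range greaterThan)"
    by (subst borel_Ioi, subst sets_measure_of) auto
  have sp: "space (M u) = UNIV" for u using sets_eq_imp_space_eq[OF sets_M] by simp
  have le: "measure (M u) B \<le> (norm u)\<^sup>2" for u B
    using finite_measure.bounded_measure[OF fin, of u B] by (simp add: total sp)
  have "\<exists>T. bounded_selfadjoint T \<and> (\<forall>u. inner u (T u) = measure (M u) B)" if "B \<in> sets borel" for B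
    using that unfolding gen
  proof (induction rule: rays_induct)
    case basic then show ?case using rays by auto
  next
    case empty then show ?case by (intro exI[of _ "\<lambda>u. 0"]) (simp add: selfadjoint_const)
  next
    case (compl A)
    then have A: "A \<in> sets borel" by (simp add: gen)
    obtain T where T: "bounded_selfadjoint T" "\<And>u. inner u (T u) = measure (M u) A" using compl.IH by blast
    have "inner u (u - T u) = measure (M u) (UNIV - A)" for u
      using finite_measure.finite_measure_Diff[OF fin, of UNIV u A] A
      by (simp add: inner_diff_right T total power2_norm_eq_inner sets_M)
    then show ?case using selfadjoint_combination(2)[OF selfadjoint_const(1) T(1)] by blast
  next
    case (union A)
    then have A: "A i \<in> sets borel" for i by (auto simp: gen)
    from union.IH obtain T' where T': "\<And>k. bounded_selfadjoint (T' k)" "\<And>k u. inner u (T' k u) = measure (M u) (A k)" by metis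
    define T where "T n u = (\<Sum>k<n. T' k u)" for n u
    have T: "bounded_selfadjoint (T n)" for n
      unfolding T_def by (induction n) (simp_all add: selfadjoint_const selfadjoint_combination(1) T')
    have formT: "inner u (T n u) = (\<Sum>k<n. measure (M u) (A k))" for n u
      by (simp add: T_def inner_sum_right T')
    have s: "(\<lambda>k. measure (M u) (A k)) sums measure (M u) (\<Union>k. A k)" for u
      by (rule finite_measure.finite_measure_UNION[OF fin]) (use A sets_M union.hyps(1) in auto)
    obtain L where L: "bounded_selfadjoint L" "\<And>u. (\<lambda>n. T n u) \<longlonglongrightarrow> L u"
    proof (rule increasing_selfadjoint_limit[OF T])
      show "incseq (\<lambda>n. inner u (T n u))" for u unfolding formT by (auto intro!: incseq_SucI)
      show "0 \<le> inner u (T n u)" for n u unfolding formT by (simp add: sum_nonneg)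
      show "inner u (T n u) \<le> (norm u)\<^sup>2" for n u
        unfolding formT using sum_le_suminf[OF sums_summable[OF s]] sums_unique[OF s] le order_trans
        by (metis finite_lessThan measure_nonneg)
    qed blast
    have "inner v (L v) = measure (M v) (\<Union>k. A k)" for v
      using tendsto_inner[OF tendsto_const[of v] L(2)[of v]] s[of v] LIMSEQ_unique unfolding formT sums_def by blast
    then show ?case using L by blast
  qed
  then obtain E where "\<And>B. B \<in> sets borel \<Longrightarrow> bounded_selfadjoint (E B) \<and> (\<forall>u. inner u (E B u) = measure (M u) B)"
    by metis
  then have "form_measure E M" by (intro form_measure.intro) (auto simp: fin sets_M total)
  then show ?thesis by (rule that)
qed

lemma projection_valued_measureD:
  assumes "projection_valued_measure E"
  shows "B \<in> sets borel \<Longrightarrow> bounded_selfadjoint (E B)"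
    "B \<in> sets borel \<Longrightarrow> C \<in> sets borel \<Longrightarrow> E B (E C u) = E (B \<inter> C) u"
    "E {} u = 0" "E UNIV u = u"
    "range A \<subseteq> sets borel \<Longrightarrow> disjoint_family A \<Longrightarrow> (\<lambda>k. E (A k) u) sums E (\<Union>k. A k) u"
  using assms unfolding projection_valued_measure_def by auto

lemma pvm_form:
  assumes E: "projection_valued_measure E" and B: "B \<in> sets borel"
  shows "inner u (E B u) = (norm (E B u))\<^sup>2"
  using projection_valued_measureD(2)[OF E B B, of u]
    bounded_selfadjointD(4)[OF projection_valued_measureD(1)[OF E B], of u "E B u"]
  by (simp add: power2_norm_eq_inner)

text \<open>\<open>measure_of\<close> returns a trivial measure unless the set function is countably
  additive, so this has to be established first; positivity holds because the form of a projection
  is a squared norm.\<close>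

lemma pvm_form_measure:
  assumes E: "projection_valued_measure E"
  shows "form_measure E (spectral_measure E)"
proof -
  note D = projection_valued_measureD[OF E]
  have sets: "sets (spectral_measure E u) = sets borel" and space: "space (spectral_measure E u) = UNIV" for u
    using sets.sigma_sets_eq[of "borel :: real measure"] by (simp_all add: spectral_measure_def)
  have em: "emeasure (spectral_measure E u) B = ennreal (inner u (E B u))" if B: "B \<in> sets borel" for u B
  proof -
    have "emeasure (spectral_measure E u) B = ennreal (Re (cinner u (E B u)))"
    proof (rule emeasure_measure_of[OF spectral_measure_def])
      show "positive (sets (spectral_measure E u)) (\<lambda>B. ennreal (Re (cinner u (E B u))))"
        by (simp add: positive_def Re_cinner D)
      show "countably_additive (sets (spectral_measure E u)) (\<lambda>B. ennreal (Re (cinner u (E B u))))"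
        unfolding countably_additive_def sets Re_cinner
      proof (intro allI impI)
        fix A :: "nat \<Rightarrow> real set" assume A: "range A \<subseteq> sets borel" "disjoint_family A"
        have "(\<lambda>k. inner u (E (A k) u)) sums inner u (E (\<Union>k. A k) u)"
          by (rule bounded_linear.sums[OF bounded_linear_inner_right D(5)[OF A]])
        then show "(\<Sum>k. ennreal (inner u (E (A k) u))) = ennreal (inner u (E (\<Union>k. A k) u))"
          using A pvm_form[OF E] by (subst suminf_ennreal2) (auto simp: sums_iff)
      qed
    qed (use B sets in auto)
    then show ?thesis by (simp add: Re_cinner)
  qed
  show ?thesis
  proof (rule form_measure.intro)
    show "finite_measure (spectral_measure E u)" for u
      by (rule finite_measureI) (simp add: space em)
    show "sets (spectral_measure E u) = sets borel" for u by (rule sets)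
    show m: "inner u (E B u) = measure (spectral_measure E u) B" if "B \<in> sets borel" for u B
      using em[OF that, of u] pvm_form[OF E that] by (simp add: measure_def)
    show "measure (spectral_measure E u) UNIV = (norm u)\<^sup>2" for u
      using m[of UNIV u] by (simp add: D power2_norm_eq_inner)
  qed (rule D)
qed

subsection \<open>Uniqueness of the spectral resolution\<close>

locale symmetric_domain =
  fixes D :: "'m::finite l2 set" and A :: "'m l2 \<Rightarrow> 'm l2"
  assumes D_add: "u \<in> D \<Longrightarrow> v \<in> D \<Longrightarrow> u + v \<in> D" and D_cscale: "u \<in> D \<Longrightarrow> cscale c u \<in> D"
    and A_add: "u \<in> D \<Longrightarrow> v \<in> D \<Longrightarrow> A (u + v) = A u + A v"
    and A_cscale: "u \<in> D \<Longrightarrow> A (cscale c u) = cscale c (A u)"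

text \<open>The resolution fixes only the quadratic form of \<open>A\<close> on \<open>D\<close>.
  Symmetry, commutation with \<open>E\<close> and norm bounds on spectral subspaces are recovered
  from that form.\<close>

locale resolved_operator = symmetric_domain D A
  for D :: "'m::finite l2 set" and A :: "'m l2 \<Rightarrow> 'm l2" and E :: "real set \<Rightarrow> 'm l2 \<Rightarrow> 'm l2" +
  assumes res: "spectral_resolution D A E"
begin

lemma pvm: "projection_valued_measure E"
  using res by (simp add: spectral_resolution_def)

sublocale form_measure E "spectral_measure E" by (rule pvm_form_measure[OF pvm])

abbreviation \<mu> :: "'m l2 \<Rightarrow> real measure" where "\<mu> \<equiv> spectral_measure E"

lemma D_iff: "u \<in> D \<longleftrightarrow> (\<integral>\<^sup>+x. ennreal (x\<^sup>2) \<partial>\<mu> u) < \<infinity>"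
  using res by (auto simp: spectral_resolution_def)

lemma A_form: "u \<in> D \<Longrightarrow> inner u (A u) = (\<integral>x. x \<partial>\<mu> u)" and A_form_Im: "u \<in> D \<Longrightarrow> inner (cscale \<i> u) (A u) = 0"
  using res by (auto simp: spectral_resolution_def cinner_eq complex_eq_iff)

lemma E_mult: "B \<in> sets borel \<Longrightarrow> C \<in> sets borel \<Longrightarrow> E B (E C u) = E (B \<inter> C) u"
  by (rule projection_valued_measureD(2)[OF pvm])

lemma E_linear: "B \<in> sets borel \<Longrightarrow> bounded_linear (E B)"
  using sa bounded_selfadjointD(2) by blast

lemma E_inner: "B \<in> sets borel \<Longrightarrow> inner (E B u) v = inner u (E B v)"
  using sa bounded_selfadjointD(4) by blast

lemma D_scaleR: "u \<in> D \<Longrightarrow> r *\<^sub>R u \<in> D"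
  and A_scaleR: "u \<in> D \<Longrightarrow> A (r *\<^sub>R u) = r *\<^sub>R A u" and D_diff: "u \<in> D \<Longrightarrow> v \<in> D \<Longrightarrow> u - v \<in> D"
  and A_diff: "u \<in> D \<Longrightarrow> v \<in> D \<Longrightarrow> A (u - v) = A u - A v"
proof -
  show s: "r *\<^sub>R u \<in> D" "A (r *\<^sub>R u) = r *\<^sub>R A u" if "u \<in> D" for u r
    using D_cscale[OF that, of "of_real r"] A_cscale[OF that, of "of_real r"] by simp_all
  show "u - v \<in> D" "A (u - v) = A u - A v" if "u \<in> D" "v \<in> D"
    using s[OF that(2), of "- 1"] D_add[OF that(1), of "(- 1) *\<^sub>R v"] A_add[OF that(1), of "(- 1) *\<^sub>R v"] by simp_all
qed

text \<open>Sandwiching \<open>E B\<close> between two copies of \<open>E C\<close> gives the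
  projection of the intersection, so projecting a vector restricts its measure.\<close>

lemma restricted_measure:
  assumes C: "C \<in> sets borel"
  shows "\<mu> (E C u) = density (\<mu> u) (indicator C)"
proof (rule measure_eqI)
  fix B assume "B \<in> sets (\<mu> (E C u))"
  then have B: "B \<in> sets borel" by (simp add: sets_M)
  have "measure (\<mu> (E C u)) B = inner u (E C (E B (E C u)))"
    by (simp add: E_inner[OF C] flip: form[OF B])
  also have "\<dots> = measure (\<mu> u) (C \<inter> B)"
  proof -
    have "C \<inter> (B \<inter> C) = C \<inter> B" by auto
    then show ?thesis using B C by (simp add: E_mult form)
  qed
  finally have "emeasure (\<mu> (E C u)) B = emeasure (\<mu> u) (C \<inter> B)"
    by (simp add: finite_measure.emeasure_eq_measure[OF fin])
  also have "\<dots> = emeasure (density (\<mu> u) (indicator C)) B"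
    using B C by (simp add: emeasure_density sets_M indicator_inter_arith[symmetric])
  finally show "emeasure (\<mu> (E C u)) B = emeasure (density (\<mu> u) (indicator C)) B" .
qed (simp add: sets_M)

lemma integrable_id: "u \<in> D \<Longrightarrow> integrable (\<mu> u) (\<lambda>x. x)"
proof -
  assume "u \<in> D"
  then have "integrable (\<mu> u) (\<lambda>x. x\<^sup>2)"
    unfolding D_iff by (intro integrableI_nonneg) auto
  then have "integrable (\<mu> u) (\<lambda>x. 1 + x\<^sup>2)"
    using finite_measure.integrable_const[OF fin] by (intro Bochner_Integration.integrable_add) auto
  then show ?thesis
  proof (rule Bochner_Integration.integrable_bound)
    show "AE x in \<mu> u. norm x \<le> norm (1 + x\<^sup>2)"
    proof (intro AE_I2)
      fix x :: real
      have "0 \<le> (\<bar>x\<bar> - 1)\<^sup>2 + \<bar>x\<bar>" by simp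
      then show "norm x \<le> norm (1 + x\<^sup>2)" by (simp add: power2_diff)
    qed
  qed simp
qed

lemma E_D: "u \<in> D \<Longrightarrow> C \<in> sets borel \<Longrightarrow> E C u \<in> D"
proof -
  assume u: "u \<in> D" and C: "C \<in> sets borel"
  have "(\<integral>\<^sup>+x. ennreal (x\<^sup>2) \<partial>\<mu> (E C u)) = (\<integral>\<^sup>+x. indicator C x * ennreal (x\<^sup>2) \<partial>\<mu> u)"
    unfolding restricted_measure[OF C] using C by (subst nn_integral_density) (auto simp: sets_M)
  also have "\<dots> \<le> (\<integral>\<^sup>+x. ennreal (x\<^sup>2) \<partial>\<mu> u)"
    by (intro nn_integral_mono) (auto simp: indicator_def)
  finally show ?thesis using u unfolding D_iff by (rule le_less_trans)
qed

lemma E_bounded_D: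
  assumes C: "C \<in> sets borel" and bd: "\<And>x. x \<in> C \<Longrightarrow> \<bar>x\<bar> \<le> K"
  shows "E C u \<in> D"
proof -
  have "(\<integral>\<^sup>+x. ennreal (x\<^sup>2) \<partial>\<mu> (E C u)) = (\<integral>\<^sup>+x. indicator C x * ennreal (x\<^sup>2) \<partial>\<mu> u)"
    unfolding restricted_measure[OF C] using C by (subst nn_integral_density) (auto simp: sets_M)
  also have "\<dots> \<le> (\<integral>\<^sup>+x. ennreal (K\<^sup>2) \<partial>\<mu> u)"
    using power_mono[OF bd abs_ge_zero, of _ 2] by (intro nn_integral_mono) (auto simp: indicator_def intro!: ennreal_leI)
  also have "\<dots> < \<infinity>"
    using finite_measure.emeasure_finite[OF fin, of u UNIV] by (simp add: ennreal_mult_eq_top_iff less_top[symmetric])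
  finally show ?thesis by (simp add: D_iff)
qed

text \<open>Polarization of the reality of the form, at \<open>v - \<i> u\<close>.\<close>

lemma A_symmetric:
  assumes "u \<in> D" "v \<in> D"
  shows "inner u (A v) = inner v (A u)"
proof -
  have i: "cscale (- \<i>) u \<in> D" using assms(1) by (rule D_cscale)
  have "inner (cscale \<i> (cscale (- \<i>) u + v)) (A (cscale (- \<i>) u + v)) = 0"
    by (intro A_form_Im D_add i assms)
  then have "inner u (A v) + inner (cscale \<i> v) (cscale (- \<i>) (A u)) = 0"
    using A_form_Im[OF i] A_form_Im[OF assms(2)] i assms
    by (simp add: A_add A_cscale inner_add_left inner_add_right)
  moreover have "inner (cscale \<i> v) (cscale (- \<i>) (A u)) = - inner v (A u)"
    by (simp add: inner_cscale_i)
  ultimately show ?thesis by simp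
qed

text \<open>Testing \<open>w\<close> against its own spectral truncations to \<open>[-n, n]\<close>,
  which lie in \<open>D\<close>, shows that its spectral measure vanishes.\<close>

lemma D_orthogonal_zero:
  assumes "\<And>v. v \<in> D \<Longrightarrow> inner v w = 0"
  shows "w = 0"
proof -
  have "emeasure (\<mu> w) {- real n..real n} = 0" for n
  proof -
    have "inner (E {- real n..real n} w) w = 0" by (intro assms E_bounded_D[of _ "real n"]) auto
    then have "measure (\<mu> w) {- real n..real n} = 0" by (simp add: inner_commute form flip: form)
    then show ?thesis by (simp add: finite_measure.emeasure_eq_measure[OF fin])
  qed
  then have "emeasure (\<mu> w) (\<Union>n. {- real n..real n}) = 0"
    by (intro emeasure_UN_eq_0) (auto simp: sets_M)
  moreover have "(\<Union>n. {- real n..real n}) = UNIV"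
  proof -
    have "\<exists>n. \<bar>x\<bar> \<le> real n" for x :: real by (rule real_arch_simple)
    then show ?thesis by (auto simp: abs_le_iff) (metis minus_le_iff)
  qed
  ultimately have "measure (\<mu> w) UNIV = 0" by (simp add: measure_def)
  then show ?thesis by (simp add: total)
qed

lemma A_form_split:
  assumes u: "u \<in> D" and C: "C \<in> sets borel"
  shows "inner u (A u) = inner (E C u) (A (E C u)) + inner (E (- C) u) (A (E (- C) u))"
proof -
  have r: "(\<integral>x. x \<partial>\<mu> (E B u)) = (\<integral>x. indicator B x * x \<partial>\<mu> u)" if B: "B \<in> sets borel" for B
  proof -
    have "density (\<mu> u) (indicator B) = density (\<mu> u) (\<lambda>x. ennreal (indicator B x))"
      by (intro arg_cong[of _ _ "density (\<mu> u)"]) (auto simp: indicator_def)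
    then show ?thesis unfolding restricted_measure[OF B] using B by (simp add: integral_density sets_M)
  qed
  have C': "- C \<in> sets borel" using C by auto
  have int: "integrable (\<mu> u) (\<lambda>x. indicator B x * x)" if "B \<in> sets borel" for B
    using integrable_mult_indicator[OF _ integrable_id[OF u], of B] that by (simp add: sets_M)
  have "(\<integral>x. x \<partial>\<mu> u) = (\<integral>x. indicator C x * x + indicator (- C) x * x \<partial>\<mu> u)"
    by (intro Bochner_Integration.integral_cong) (auto simp: indicator_def)
  also have "\<dots> = (\<integral>x. indicator C x * x \<partial>\<mu> u) + (\<integral>x. indicator (- C) x * x \<partial>\<mu> u)"
    using int[OF C] int[OF C'] by (rule Bochner_Integration.integral_add)
  finally show ?thesis using u C C' by (simp add: A_form E_D r)
qed

lemma E_Compl: "C \<in> sets borel \<Longrightarrow> E (- C) u = u - E C u"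
  using E_Diff[of UNIV C u] by (simp add: Compl_eq_Diff_UNIV E_UNIV)

text \<open>The form has no cross terms between \<open>C\<close> and its complement. At
  \<open>E C w + v\<close> with \<open>E C v = 0\<close> the two cross terms are equal by symmetry,
  so both vanish; hence \<open>A\<close> preserves the kernel of each projection.\<close>

lemma E_A:
  assumes u: "u \<in> D" and C: "C \<in> sets borel"
  shows "E C (A u) = A (E C u)"
proof -
  have key: "E C (A v) = 0" if v: "v \<in> D" "E C v = 0" and C: "C \<in> sets borel" for v C
  proof (rule D_orthogonal_zero)
    fix w assume w: "w \<in> D"
    let ?w = "E C w"
    have wD: "?w \<in> D" using w C by (rule E_D)
    have 1: "E C (?w + v) = ?w" "E (- C) (?w + v) = v"
      using v C by (simp_all add: E_Compl linear_simps[OF E_linear[OF C]] E_mult)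
    have "inner (?w + v) (A (?w + v)) = inner ?w (A ?w) + inner v (A v)"
      using A_form_split[OF D_add[OF wD v(1)] C] unfolding 1 .
    then have "inner ?w (A v) + inner v (A ?w) = 0"
      using wD v by (simp add: A_add inner_add_left inner_add_right)
    then have "inner ?w (A v) = 0" using A_symmetric[OF wD v(1)] by simp
    then show "inner w (E C (A v)) = 0" by (simp add: E_inner[OF C])
  qed
  have C': "- C \<in> sets borel" using C by auto
  have uC: "E C u \<in> D" "E (- C) u \<in> D" using u C C' by (auto intro: E_D)
  have "A u = A (E C u) + A (E (- C) u)"
    using A_add[OF uC] C by (simp add: E_Compl)
  moreover have "E C (A (E (- C) u)) = 0"
    by (rule key[OF uC(2) _ C]) (simp add: E_mult C C' E_empty)
  moreover have "E (- C) (A (E C u)) = 0"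
    by (rule key[OF uC(1) _ C']) (simp add: E_mult C C' E_empty)
  ultimately show ?thesis using C by (simp add: linear_simps[OF E_linear[OF C]] E_Compl)
qed

text \<open>The spectral measure of \<open>u\<close> lives on \<open>C\<close>, so the pointwise
  bound can be integrated; \<open>d = 1\<close> and \<open>d = -1\<close> give bounds from below and
  from above.\<close>

lemma form_lower:
  assumes C: "C \<in> sets borel" and u: "u \<in> D" "E C u = u" and s: "\<And>x. x \<in> C \<Longrightarrow> s \<le> d * (x - c)"
  shows "s * (norm u)\<^sup>2 \<le> d * inner u (A u - c *\<^sub>R u)"
proof -
  have "emeasure (\<mu> u) (- C) = 0"
  proof -
    have "measure (\<mu> u) (- C) = 0"
      using form[of "- C" u] C E_Compl[OF C, of u] u(2) by simp
    then show ?thesis by (simp add: finite_measure.emeasure_eq_measure[OF fin])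
  qed
  then have ae: "AE x in \<mu> u. x \<in> C"
    using C by (intro AE_I[of _ _ "- C"]) (auto simp: sets_M)
  have int: "integrable (\<mu> u) (\<lambda>x. d * (x - c))"
    using integrable_id[OF u(1)] finite_measure.integrable_const[OF fin]
    by (intro integrable_mult_right Bochner_Integration.integrable_diff) auto
  have "s * (norm u)\<^sup>2 = (\<integral>x. s \<partial>\<mu> u)" by (simp add: total)
  also have "\<dots> \<le> (\<integral>x. d * (x - c) \<partial>\<mu> u)"
    using ae s by (intro integral_mono_AE int finite_measure.integrable_const[OF fin]) auto
  also have "\<dots> = d * ((\<integral>x. x \<partial>\<mu> u) - c * (norm u)\<^sup>2)"
    using Bochner_Integration.integral_diff[OF integrable_id[OF u(1)] finite_measure.integrable_const[OF fin, of u c]]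
    by (simp add: total mult.commute)
  finally show ?thesis using u by (simp add: A_form inner_diff_right power2_norm_eq_inner)
qed

definition shifted :: "real \<Rightarrow> 'm l2 \<Rightarrow> 'm l2" where "shifted c u = A u - c *\<^sub>R u"

lemma E_shifted: "u \<in> D \<Longrightarrow> C \<in> sets borel \<Longrightarrow> E C (shifted c u) = shifted c (E C u)"
  by (simp add: shifted_def E_A linear_simps[OF E_linear])

lemma norm_lower:
  assumes C: "C \<in> sets borel" and u: "u \<in> D" "E C u = u" and s: "\<And>x. x \<in> C \<Longrightarrow> s \<le> d * (x - c)" and d: "\<bar>d\<bar> = 1"
  shows "s * norm u \<le> norm (shifted c u)"
proof (cases "u = 0")
  case False
  have "s * (norm u)\<^sup>2 \<le> d * inner u (shifted c u)"
    unfolding shifted_def by (rule form_lower[OF C u s])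
  also have "\<dots> \<le> \<bar>d\<bar> * \<bar>inner u (shifted c u)\<bar>" by (metis abs_ge_self abs_mult)
  also have "\<dots> \<le> norm u * norm (shifted c u)" unfolding d using Cauchy_Schwarz_ineq2 by simp
  finally have "norm u * (s * norm u) \<le> norm u * norm (shifted c u)" by (simp add: power2_eq_square mult_ac)
  then show ?thesis using False by simp
qed simp

text \<open>The passage from form bound to norm bound for symmetric operators, carried out on the
  range of \<open>E C\<close>, which lies in \<open>D\<close> and is invariant.\<close>

lemma norm_upper:
  assumes C: "C \<in> sets borel" and bd: "\<And>x. x \<in> C \<Longrightarrow> \<bar>x - c\<bar> \<le> r" and r: "r \<ge> 0" and u: "E C u = u"
  shows "norm (shifted c u) \<le> r * norm u"
proof -
  have inD: "v \<in> D" if "E C v = v" for v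
    using E_bounded_D[OF C, of "r + \<bar>c\<bar>" v] bd that by force
  have q: "\<bar>inner v (shifted c v)\<bar> \<le> r * (norm v)\<^sup>2" if v: "E C v = v" for v
  proof -
    have "- r * (norm v)\<^sup>2 \<le> 1 * inner v (A v - c *\<^sub>R v)"
      by (rule form_lower[OF C inD[OF v] v]) (use bd in force)
    moreover have "- r * (norm v)\<^sup>2 \<le> - 1 * inner v (A v - c *\<^sub>R v)"
      by (rule form_lower[OF C inD[OF v] v]) (use bd in force)
    ultimately show ?thesis by (simp add: shifted_def)
  qed
  have Tu: "E C (shifted c u) = shifted c u" using E_shifted[OF inD[OF u] C] u by simp
  show ?thesis
  proof (cases "shifted c u = 0 \<or> u = 0")
    case True
    have "shifted c 0 = 0" using inD[OF u] A_scaleR[OF inD[OF u], of 0] by (simp add: shifted_def)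
    then show ?thesis using True r by auto
  next
    case False
    \<comment> \<open>The image rescaled to the length of \<open>u\<close>: its inner product with
      the image is then the product of the norms, and the parallelogram law applies to
      \<open>u + w\<close> and \<open>u - w\<close>.\<close>
    define w where "w = (norm u / norm (shifted c u)) *\<^sub>R shifted c u"
    have w: "E C w = w" by (simp add: w_def Tu linear_simps[OF E_linear[OF C]])
    have nw: "norm w = norm u" using False by (simp add: w_def)
    have D: "u \<in> D" "w \<in> D" using u w inD by auto
    have sum: "E C (u + w) = u + w" "E C (u - w) = u - w" using u w by (simp_all add: linear_simps[OF E_linear[OF C]])
    have sh: "shifted c (u + w) = shifted c u + shifted c w" "shifted c (u - w) = shifted c u - shifted c w"
      using D by (simp_all add: shifted_def A_add A_diff algebra_simps)
    have sym: "inner u (shifted c w) = inner w (shifted c u)"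
      using A_symmetric[OF D] by (simp add: shifted_def inner_diff_right inner_commute)
    have "4 * inner w (shifted c u) = inner (u + w) (shifted c (u + w)) - inner (u - w) (shifted c (u - w))"
      unfolding sh using sym by (simp add: inner_add_left inner_add_right inner_diff_left inner_diff_right)
    also have "\<dots> \<le> r * (norm (u + w))\<^sup>2 + r * (norm (u - w))\<^sup>2"
      using q[OF sum(1)] q[OF sum(2)] by linarith
    also have "\<dots> = r * (2 * (norm u)\<^sup>2 + 2 * (norm w)\<^sup>2)"
      by (simp add: power2_norm_eq_inner inner_add_left inner_add_right inner_diff_left inner_diff_right algebra_simps)
    finally have "inner w (shifted c u) \<le> r * (norm u)\<^sup>2" by (simp add: nw)
    moreover have "inner w (shifted c u) = norm u * norm (shifted c u)"
      using False by (simp add: w_def power2_norm_eq_inner[symmetric] power2_eq_square)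
    ultimately have "norm u * norm (shifted c u) \<le> norm u * (r * norm u)" by (simp add: power2_eq_square mult_ac)
    then show ?thesis using False by simp
  qed
qed

lemma iterate_upper:
  assumes u: "E {c - r..c + r} u = u" and r: "r \<ge> 0"
  shows "(shifted c ^^ k) u \<in> D \<and> norm ((shifted c ^^ k) u) \<le> r ^ k * norm u"
proof -
  let ?C = "{c - r..c + r}"
  have inD: "v \<in> D" if "E ?C v = v" for v
  proof -
    have "\<bar>x\<bar> \<le> \<bar>c\<bar> + r" if "x \<in> ?C" for x
      using that unfolding atLeastAtMost_iff by linarith
    then have "E ?C v \<in> D" by (intro E_bounded_D[of ?C "\<bar>c\<bar> + r" v]) auto
    then show ?thesis using that by simp
  qed
  have "E ?C ((shifted c ^^ k) u) = (shifted c ^^ k) u \<and> norm ((shifted c ^^ k) u) \<le> r ^ k * norm u" for k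
  proof (induction k)
    case (Suc k)
    let ?v = "(shifted c ^^ k) u"
    have "norm (shifted c ?v) \<le> r * norm ?v"
      by (rule norm_upper[of ?C]) (use Suc r in \<open>auto simp: abs_le_iff\<close>)
    also have "\<dots> \<le> r * (r ^ k * norm u)" using Suc r by (intro mult_left_mono) auto
    finally show ?case using Suc E_shifted[OF inD, of ?v ?C c] by simp
  qed (simp add: u)
  then show ?thesis using inD by blast
qed

lemma iterate_lower:
  assumes D: "\<And>k. (shifted c ^^ k) u \<in> D" and C: "C \<in> sets borel"
    and s: "\<And>x. x \<in> C \<Longrightarrow> s \<le> d * (x - c)" "\<bar>d\<bar> = 1" "s \<ge> 0"
  shows "s ^ k * norm (E C u) \<le> norm ((shifted c ^^ k) u)"
proof -
  have comm: "E C ((shifted c ^^ k) u) = (shifted c ^^ k) (E C u)" for k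
    by (induction k) (simp_all add: E_shifted D C)
  have CD: "(shifted c ^^ k) (E C u) \<in> D" for k using comm D[of k] C E_D by metis
  have "s ^ k * norm (E C u) \<le> norm ((shifted c ^^ k) (E C u))"
  proof (induction k)
    case (Suc k)
    have "E C ((shifted c ^^ k) (E C u)) = (shifted c ^^ k) (E C u)"
      by (simp add: comm[symmetric] E_mult C)
    from norm_lower[OF C CD this s(1,2)] have "s * norm ((shifted c ^^ k) (E C u)) \<le> norm ((shifted c ^^ Suc k) (E C u))" by simp
    then show ?case using mult_left_mono[OF Suc s(3)] by (simp add: mult_ac)
  qed simp
  also have "norm ((shifted c ^^ k) (E C u)) \<le> norm ((shifted c ^^ k) u)"
  proof -
    have "(norm (E C v))\<^sup>2 \<le> (norm v)\<^sup>2" for v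
      using pvm_form[OF pvm C, of v] form[OF C, of v] measure_le[of v C] by simp
    then show ?thesis using comm[of k] by (metis norm_ge_zero power2_le_imp_le)
  qed
  finally show ?thesis .
qed

end

text \<open>
  The range of \<open>E [c - r, c + r]\<close> consists of the vectors \<open>u\<close> with
  \<open>\<parallel>(A - c)\<^sup>k u\<parallel> \<le> r\<^sup>k \<parallel>u\<parallel>\<close> for all \<open>k\<close>, a description that does not involve \<open>E\<close>.
\<close>

lemma spectral_measure_unique:
  assumes E: "resolved_operator D A E" and F: "resolved_operator D A F"
  shows "spectral_measure E u = spectral_measure F u"
proof -
  have range: "F {c - r..c + r} u = u"
    if "resolved_operator D A E" "resolved_operator D A F" and u: "E {c - r..c + r} u = u" and r: "r \<ge> 0" for E F c r u
  proof -
    interpret E: resolved_operator D A E by fact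
    interpret F: resolved_operator D A F by fact
    have up: "(E.shifted c ^^ k) u \<in> D \<and> norm ((E.shifted c ^^ k) u) \<le> r ^ k * norm u" for k
      by (rule E.iterate_upper[OF u r])
    \<comment> \<open>A component at spectral distance \<open>s > r\<close> from \<open>c\<close>
      would grow like \<open>s ^ k\<close>, faster than the bound \<open>r ^ k\<close> obtained
      through the other resolution.\<close>
    have zero: "F C u = 0" if C: "C \<in> sets borel" "\<And>x. x \<in> C \<Longrightarrow> s \<le> d * (x - c)" "\<bar>d\<bar> = 1" and s: "s > r" for C s d
    proof (rule ccontr)
      assume "F C u \<noteq> 0"
      have le: "s ^ k * norm (F C u) \<le> r ^ k * norm u" for k
        using F.iterate_lower[OF _ C, of u k] up s r by (meson less_imp_le order_trans)
      have "norm (F C u) \<le> (r / s) ^ k * norm u" for k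
        using le[of k] s r by (simp add: power_divide field_simps)
      moreover have "(\<lambda>k. (r / s) ^ k * norm u) \<longlonglongrightarrow> 0 * norm u"
        using s r by (intro tendsto_mult tendsto_const LIMSEQ_realpow_zero) auto
      ultimately have "norm (F C u) \<le> 0" using LIMSEQ_le_const by fastforce
      then show False using \<open>F C u \<noteq> 0\<close> by simp
    qed
    \<comment> \<open>Rays at distance \<open>1 / (n + 1)\<close> from the interval, where the
      strict inequality \<open>s > r\<close> holds; together they exhaust its complement.\<close>
    define P N where "P n = {c + r + 1 / real (Suc n)..}" and "N n = {..c - (r + 1 / real (Suc n))}" for n
    have null: "emeasure (spectral_measure F u) (P n \<union> N n) = 0" for n
    proof -
      have "F (P n) u = 0" by (rule zero[of _ "r + 1 / real (Suc n)" 1]) (auto simp: P_def)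
      moreover have "F (N n) u = 0" by (rule zero[of _ "r + 1 / real (Suc n)" "- 1"]) (auto simp: N_def)
      ultimately have "measure (spectral_measure F u) (P n) = 0" "measure (spectral_measure F u) (N n) = 0"
        using F.form[of "P n" u] F.form[of "N n" u] by (simp_all add: P_def N_def)
      then have "emeasure (spectral_measure F u) (P n) = 0" "emeasure (spectral_measure F u) (N n) = 0"
        by (simp_all add: finite_measure.emeasure_eq_measure[OF F.fin])
      then show ?thesis by (intro emeasure_Un_null_set[THEN trans] null_setsI) (auto simp: P_def N_def F.sets_M)
    qed
    have "- {c - r..c + r} = (\<Union>n. P n \<union> N n)"
    proof
      show "(\<Union>n. P n \<union> N n) \<subseteq> - {c - r..c + r}" by (auto simp: P_def N_def) (smt (verit) divide_pos_pos of_nat_0_less_iff zero_less_Suc of_nat_Suc of_nat_0_le_iff)+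
      show "- {c - r..c + r} \<subseteq> (\<Union>n. P n \<union> N n)"
      proof
        fix x assume "x \<in> - {c - r..c + r}"
        then have "0 < \<bar>x - c\<bar> - r" by auto
        then obtain n where n: "1 / real (Suc n) < \<bar>x - c\<bar> - r" using nat_approx_posE by blast
        then have "x \<in> P n \<union> N n" unfolding P_def N_def Un_iff atLeast_iff atMost_iff by linarith
        then show "x \<in> (\<Union>n. P n \<union> N n)" by blast
      qed
    qed
    moreover have "emeasure (spectral_measure F u) (\<Union>n. P n \<union> N n) = 0"
      by (rule emeasure_UN_eq_0[OF null]) (auto simp: P_def N_def F.sets_M)
    ultimately have "measure (spectral_measure F u) (- {c - r..c + r}) = 0" by (simp add: measure_def)
    then have "(norm (F (- {c - r..c + r}) u))\<^sup>2 = 0"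
      using F.form[of "- {c - r..c + r}" u] pvm_form[OF F.pvm, of "- {c - r..c + r}" u] by simp
    then show ?thesis by (simp add: F.E_Compl)
  qed
  interpret E: resolved_operator D A E by fact
  interpret F: resolved_operator D A F by fact
  \<comment> \<open>Projections with equal ranges: \<open>F E = E\<close> and
    \<open>E F = F\<close>, and self-adjointness then gives \<open>E = F\<close>.\<close>
  have eq: "E {c - r..c + r} v = F {c - r..c + r} v" if r: "r \<ge> 0" for c r v
  proof -
    let ?C = "{c - r..c + r}"
    have FE: "F ?C (E ?C w) = E ?C w" for w by (rule range[OF E F _ r]) (simp add: E.E_mult)
    have EF: "E ?C (F ?C w) = F ?C w" for w by (rule range[OF F E _ r]) (simp add: F.E_mult)
    have "inner w (E ?C v) = inner w (F ?C v)" for w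
      by (metis FE EF E.E_inner F.E_inner borel_closed closed_atLeastAtMost)
    from this[of "E ?C v - F ?C v"] have "inner (E ?C v - F ?C v) (E ?C v - F ?C v) = 0" by (simp add: inner_diff_right)
    then show ?thesis by simp
  qed
  have Icc: "emeasure (spectral_measure E u) {x..y} = emeasure (spectral_measure F u) {x..y}" for x y
  proof (cases "x \<le> y")
    case True
    have e: "(x + y) / 2 - (y - x) / 2 = x" "(x + y) / 2 + (y - x) / 2 = y" by (simp_all add: field_simps)
    have "E {x..y} u = F {x..y} u" using eq[of "(y - x) / 2" "(x + y) / 2" u] True unfolding e by simp
    then show ?thesis
      using E.form[of "{x..y}" u] F.form[of "{x..y}" u]
      by (simp add: finite_measure.emeasure_eq_measure[OF E.fin] finite_measure.emeasure_eq_measure[OF F.fin])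
  qed simp
  show ?thesis
  proof (rule measure_eqI_generator_eq[where \<Omega> = UNIV and E = "range (\<lambda>(x, y). {x..y::real})" and A = "\<lambda>n. {- real n..real n}"])
    show "Int_stable (range (\<lambda>(x, y). {x..y::real}))" by (auto simp: Int_stable_def)
    have "sets borel = sigma_sets UNIV (range (\<lambda>(x, y). {x..y::real}))" by (simp add: borel_eq_atLeastAtMost)
    then show "sets (spectral_measure E u) = sigma_sets UNIV (range (\<lambda>(x, y). {x..y::real}))"
      "sets (spectral_measure F u) = sigma_sets UNIV (range (\<lambda>(x, y). {x..y::real}))"
      by (simp_all add: E.sets_M F.sets_M)
    show "(\<Union>n. {- real n..real n}) = UNIV"
    proof -
      have "\<exists>n. \<bar>x\<bar> \<le> real n" for x :: real by (rule real_arch_simple)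
      then show ?thesis by (auto simp: abs_le_iff) (metis minus_le_iff)
    qed
    show "emeasure (spectral_measure E u) {- real n..real n} \<noteq> \<infinity>" for n
      using finite_measure.emeasure_finite[OF E.fin] by simp
  qed (auto simp: Icc)
qed

text \<open>\<open>fun_calc\<close> ranges over bounded operators that are not assumed self-adjoint,
  so the polarization must use complex scalars.\<close>

lemma cform_eq_imp_eq:
  assumes S: "bounded_operator S" and T: "bounded_operator T" and eq: "\<And>u. cinner u (S u) = cinner u (T u)"
  shows "S = T"
proof
  fix v
  define R where "R u = S u - T u" for u
  have R: "R (u + w) = R u + R w" "R (cscale c u) = cscale c (R u)" for u w c
    by (simp_all add: R_def linear_simps[OF bounded_operatorD(1)[OF S]] linear_simps[OF bounded_operatorD(1)[OF T]]
        bounded_operatorD(2)[OF S] bounded_operatorD(2)[OF T])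
  have 0: "inner u (R u) = 0" "inner (cscale \<i> u) (R u) = 0" for u
    using eq[of u] by (auto simp: cinner_eq R_def inner_diff_right complex_eq_iff)
  have 1: "inner u (R w) + inner w (R u) = 0" and 2: "inner (cscale \<i> u) (R w) + inner (cscale \<i> w) (R u) = 0" for u w
    using 0[of "u + w"] 0[of u] 0[of w] by (simp_all add: R inner_add_left inner_add_right)
  have "inner (cscale \<i> u) (R v) = 0" for u
    using 1[of "cscale \<i> u" v] 2[of u v] by (simp add: R inner_cscale_i)
  from this[of "cscale (- \<i>) (R v)"] have "inner (R v) (R v) = 0" by simp
  then show "S v = T v" by (simp add: R_def)
qed

text \<open>Any competing resolution has the same scalar measures, so the operator it defines has
  the same form as \<open>T\<close>.\<close>

lemma fun_calc_eq:
  assumes E: "resolved_operator D A E" and T: "bounded_operator T"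
    and form: "\<And>u. cinner u (T u) = of_real (\<integral>x. f x \<partial>spectral_measure E u)"
  shows "fun_calc D A f = T"
  unfolding fun_calc_def
proof (rule the_equality)
  show "bounded_operator T \<and> (\<exists>E. spectral_resolution D A E \<and> (\<forall>\<psi>. cinner \<psi> (T \<psi>) = of_real (\<integral>x. f x \<partial>spectral_measure E \<psi>)))"
    using T form E by (auto simp: resolved_operator_def resolved_operator_axioms_def)
  fix S assume "bounded_operator S \<and> (\<exists>E. spectral_resolution D A E \<and> (\<forall>\<psi>. cinner \<psi> (S \<psi>) = of_real (\<integral>x. f x \<partial>spectral_measure E \<psi>)))"
  then obtain F where S: "bounded_operator S" and F: "spectral_resolution D A F"
    and SF: "\<And>\<psi>. cinner \<psi> (S \<psi>) = of_real (\<integral>x. f x \<partial>spectral_measure F \<psi>)" by blast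
  have "resolved_operator D A F" using E F by (simp add: resolved_operator_def resolved_operator_axioms_def)
  from spectral_measure_unique[OF E this] show "S = T"
    using S T SF form by (intro cform_eq_imp_eq) auto
qed

subsection \<open>Bounded functions of the scaled position operator\<close>

text \<open>The limits of the approximants may vary with \<open>e\<close>; closeness to functions
  that have limits makes \<open>f\<close> Cauchy at infinity.\<close>

lemma at_top_limit_by_approximation:
  fixes f :: "real \<Rightarrow> 'a::{real_normed_vector, complete_space}"
  assumes "\<And>e. e > 0 \<Longrightarrow> \<exists>g L. (g \<longlongrightarrow> L) at_top \<and> (\<forall>\<^sub>F t in at_top. norm (f t - g t) \<le> e)"
  shows "\<exists>L. (f \<longlongrightarrow> L) at_top"
proof -
  have C: "\<exists>T. \<forall>s\<ge>T. \<forall>t\<ge>T. norm (f s - f t) < e" if e: "e > 0" for e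
  proof -
    from assms[of "e / 5"] e obtain g L where g: "(g \<longlongrightarrow> L) at_top" "\<forall>\<^sub>F t in at_top. norm (f t - g t) \<le> e / 5" by auto
    from tendstoD[OF g(1), of "e / 5"] e have "\<forall>\<^sub>F t in at_top. norm (g t - L) < e / 5" by (simp add: dist_norm)
    with g(2) have "\<forall>\<^sub>F t in at_top. norm (f t - L) < 2 * e / 5"
    proof eventually_elim
      case (elim t)
      then show ?case using norm_triangle_ineq[of "f t - g t" "g t - L"] by simp
    qed
    then obtain T where T: "\<And>t. t \<ge> T \<Longrightarrow> norm (f t - L) < 2 * e / 5" by (auto simp: eventually_at_top_linorder)
    have "norm (f s - f t) < e" if "s \<ge> T" "t \<ge> T" for s t
      using T[OF that(1)] T[OF that(2)] norm_triangle_ineq4[of "f s - L" "f t - L"] e by simp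
    then show ?thesis by blast
  qed
  have "Cauchy (\<lambda>n. f (real n))"
  proof (rule metric_CauchyI)
    fix e :: real assume "e > 0"
    from C[OF this] obtain T where T: "\<And>s t. s \<ge> T \<Longrightarrow> t \<ge> T \<Longrightarrow> norm (f s - f t) < e" by blast
    obtain N :: nat where "T \<le> real N" using real_arch_simple by blast
    then show "\<exists>M. \<forall>m\<ge>M. \<forall>n\<ge>M. dist (f (real m)) (f (real n)) < e"
      using T by (intro exI[of _ N]) (auto simp: dist_norm)
  qed
  then obtain L where L: "(\<lambda>n. f (real n)) \<longlonglongrightarrow> L" using Cauchy_convergent convergent_def by blast
  have "(f \<longlongrightarrow> L) at_top"
  proof (rule tendstoI)
    fix e :: real assume e: "e > 0"
    from C[of "e / 2"] e obtain T where T: "\<And>s t. s \<ge> T \<Longrightarrow> t \<ge> T \<Longrightarrow> norm (f s - f t) < e / 2" by auto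
    from LIMSEQ_D[OF L, of "e / 2"] e obtain N where N: "\<And>n. n \<ge> N \<Longrightarrow> norm (f (real n) - L) < e / 2" by auto
    obtain n :: nat where n: "n \<ge> N" "real n \<ge> T" by (metis max.cobounded1 max.cobounded2 nat_ceiling_le_eq of_nat_mono order_trans real_nat_ceiling_ge)
    have "dist (f t) L < e" if "t \<ge> T" for t
      using T[OF that n(2)] N[OF n(1)] norm_triangle_ineq[of "f t - f (real n)" "f (real n) - L"] by (simp add: dist_norm)
    then show "\<forall>\<^sub>F t in at_top. dist (f t) L < e" by (auto simp: eventually_at_top_linorder)
  qed
  then show ?thesis by blast
qed

lemma norm_l2_mono:
  assumes "\<And>n. norm (l2_nth u n) \<le> norm (l2_nth v n)"
  shows "norm u \<le> norm v"
proof (rule norm_l2_leI)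
  fix F :: "int set" assume F: "finite F"
  have "(\<Sum>n\<in>F. (norm (l2_nth u n))\<^sup>2) \<le> (\<Sum>n\<in>F. (norm (l2_nth v n))\<^sup>2)"
    using assms by (intro sum_mono power_mono) auto
  also have "\<dots> \<le> (norm v)\<^sup>2" by (rule sum_norm_l2_le[OF F])
  finally show "(\<Sum>n\<in>F. (norm (l2_nth u n))\<^sup>2) \<le> (norm v)\<^sup>2" .
qed simp

definition bounded_by :: "('a \<Rightarrow> complex) \<Rightarrow> real \<Rightarrow> bool" where
  "bounded_by f C \<longleftrightarrow> (\<forall>x. cmod (f x) \<le> C)"

lemma bounded_by_nonneg: "bounded_by f C \<Longrightarrow> C \<ge> 0"
  unfolding bounded_by_def using norm_ge_zero order_trans by blast

lemma bounded_by_add: "bounded_by f C \<Longrightarrow> bounded_by g D \<Longrightarrow> bounded_by (\<lambda>x. f x + g x) (C + D)"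
  by (auto simp: bounded_by_def intro: norm_triangle_mono)

lemma bounded_by_mult: "bounded_by f C \<Longrightarrow> bounded_by g D \<Longrightarrow> bounded_by (\<lambda>x. f x * g x) (C * D)"
  using bounded_by_nonneg[of f C] by (auto simp: bounded_by_def norm_mult intro!: mult_mono)

lemma bounded_by_const: "bounded_by (\<lambda>x. c) (cmod c)"
  by (simp add: bounded_by_def)

section \<open>Functions of the scaled position as multiplication operators, and their strong
  limits\<close>

context periodic_jacobi
begin

definition mulop :: "(int \<Rightarrow> complex) \<Rightarrow> 'm l2 \<Rightarrow> 'm l2" where "mulop f = bandop (\<lambda>n x. f n *s x) 0"

lemma mulop_family: "bounded_by f C \<Longrightarrow> linear_family (\<lambda>n x. f n *s x) C"
  using bounded_by_nonneg[of f C]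
  by (auto simp: linear_family_def bounded_by_def vector_add_ldistrib vector_smult_assoc norm_vector_scalar_mult
      intro: mult_right_mono)

lemma mulop_nth: "bounded_by f C \<Longrightarrow> l2_nth (mulop f u) n = f n *s l2_nth u n"
  unfolding mulop_def by (simp add: bandop_nth[OF mulop_family])

text \<open>This is \<open>f(X(t)/t)\<close>. Complex values admit resolvents; agreement with
  \<open>fun_calc\<close> is shown later for real bounded continuous \<open>f\<close>.\<close>

definition fc :: "(real \<Rightarrow> complex) \<Rightarrow> real \<Rightarrow> 'm l2 \<Rightarrow> 'm l2" where
  "fc f t u = U t (mulop (\<lambda>n. f (of_int n / t)) (U (- t) u))"

lemma bounded_by_scaled: "bounded_by f C \<Longrightarrow> bounded_by (\<lambda>n::int. f (of_int n / t)) C"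
  by (simp add: bounded_by_def)

lemma fc_bounded_operator:
  assumes "bounded_by f C"
  shows "bounded_operator (fc f t)"
proof -
  have 1: "bounded_operator (mulop (\<lambda>n. f (of_int n / t)))"
    unfolding mulop_def by (rule bandop_bounded[OF mulop_family[OF bounded_by_scaled[OF assms]]])
  show ?thesis
  proof (rule bounded_operatorI)
    show "bounded_linear (fc f t)" unfolding fc_def[abs_def]
      by (intro bounded_linear_compose[OF bounded_linear_U] bounded_linear_compose[OF bounded_operatorD(1)[OF 1]] bounded_linear_U)
    show "fc f t (cscale \<i> u) = cscale \<i> (fc f t u)" for u
      by (simp add: fc_def U_cscale bounded_operatorD(2)[OF 1])
  qed
qed

lemmas fc_linear = linear_simps[OF bounded_operatorD(1)[OF fc_bounded_operator]]

lemma norm_fc: "bounded_by f C \<Longrightarrow> norm (fc f t u) \<le> C * norm u"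
  unfolding fc_def norm_U mulop_def by (metis norm_bandop[OF mulop_family[OF bounded_by_scaled]] norm_U)

lemma fc_eqI:
  assumes "\<And>n. l2_nth (mulop (\<lambda>n. f (of_int n / t)) (U (- t) u)) n = l2_nth (U (- t) v) n"
  shows "fc f t u = v"
proof -
  have "mulop (\<lambda>n. f (of_int n / t)) (U (- t) u) = U (- t) v" by (rule l2_eqI) (rule assms)
  then show ?thesis by (simp add: fc_def)
qed

lemma fc_nth: "bounded_by f C \<Longrightarrow> l2_nth (U (- t) (fc f t u)) n = f (of_int n / t) *s l2_nth (U (- t) u) n"
  by (simp add: fc_def mulop_nth[OF bounded_by_scaled])

lemma fc_add:
  assumes f: "bounded_by f C" and g: "bounded_by g D"
  shows "fc (\<lambda>x. f x + g x) t u = fc f t u + fc g t u"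
  by (rule fc_eqI)
    (simp add: mulop_nth[OF bounded_by_scaled[OF bounded_by_add[OF f g]]] U_linear plus_l2.rep_eq fc_nth[OF f] fc_nth[OF g]
      vector_sadd_rdistrib)

lemma fc_mult:
  assumes f: "bounded_by f C" and g: "bounded_by g D"
  shows "fc (\<lambda>x. f x * g x) t u = fc f t (fc g t u)"
  by (rule fc_eqI)
    (simp add: mulop_nth[OF bounded_by_scaled[OF bounded_by_mult[OF f g]]] fc_nth[OF f] fc_nth[OF g] vector_smult_assoc)

lemma fc_const: "fc (\<lambda>_. c) t u = cscale c u"
  by (rule fc_eqI) (simp add: mulop_nth[OF bounded_by_scaled[OF bounded_by_const]] U_cscale cscale.rep_eq)

lemma fc_diff_bound:
  assumes f: "bounded_by f C" and g: "bounded_by g D" and e: "bounded_by (\<lambda>x. f x - g x) e"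
  shows "norm (fc f t u - fc g t u) \<le> e * norm u"
proof -
  have "fc (\<lambda>x. (f x - g x) + g x) t u = fc (\<lambda>x. f x - g x) t u + fc g t u" by (rule fc_add[OF e g])
  then have "fc f t u - fc g t u = fc (\<lambda>x. f x - g x) t u" by simp
  then show ?thesis using norm_fc[OF e] by simp
qed

lemma fc_selfadjoint:
  assumes f: "bounded_by (\<lambda>x. of_real (f x)) C"
  shows "bounded_selfadjoint (fc (\<lambda>x. of_real (f x)) t)"
proof (rule bounded_selfadjointI[OF fc_bounded_operator[OF f]])
  fix u v
  note L = mulop_family[OF bounded_by_scaled[OF f, of t]]
  have "inner (mulop (\<lambda>n. of_real (f (of_int n / t))) u) v = inner u (mulop (\<lambda>n. of_real (f (of_int n / t))) v)" for u v
    using bandop_adjoint[OF L L, of 0 u v] unfolding mulop_def scaleR_eq_smult[symmetric] by simp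
  then show "inner (fc (\<lambda>x. of_real (f x)) t u) v = inner u (fc (\<lambda>x. of_real (f x)) t v)"
    by (simp add: fc_def U_adjoint)
qed

text \<open>Multiplication by \<open>f\<close> is compared entrywise with multiplication by
  position; this is the Chebyshev estimate behind tightness.\<close>

lemma fc_tail_bound:
  assumes f: "bounded_by f C" and K: "\<And>x. cmod (f x) \<le> K * \<bar>x\<bar>" "K \<ge> 0" and u: "u \<in> pos_dom" and t: "t > 0"
  shows "norm (fc f t u) \<le> K * norm ((1 / t) *\<^sub>R heis_op J t u)"
proof -
  have "norm (U (- t) (fc f t u)) \<le> norm ((K / t) *\<^sub>R pos_op (U (- t) u))"
  proof (rule norm_l2_mono)
    fix n
    have "cmod (f (of_int n / t)) * norm (l2_nth (U (- t) u) n) \<le> (K * \<bar>of_int n / t\<bar>) * norm (l2_nth (U (- t) u) n)"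
      by (intro mult_right_mono K) auto
    then show "norm (l2_nth (U (- t) (fc f t u)) n) \<le> norm (l2_nth ((K / t) *\<^sub>R pos_op (U (- t) u)) n)"
      using K t by (simp add: fc_nth[OF f] norm_vector_scalar_mult scaleR_l2.rep_eq pos_op_nth[OF U_pos_dom[OF u]] abs_mult)
  qed
  then show ?thesis using K t by (simp add: heis_op_def)
qed

text \<open>These functions form an algebra closed under uniform limits, as the Stone-Weierstrass
  argument requires.\<close>

definition conv :: "(real \<Rightarrow> complex) \<Rightarrow> bool" where
  "conv f \<longleftrightarrow> (\<exists>C. bounded_by f C) \<and> (\<forall>u. \<exists>L. ((\<lambda>t. fc f t u) \<longlongrightarrow> L) at_top)"

lemma conv_dense:
  assumes f: "bounded_by f C" and Z: "\<And>u e. e > 0 \<Longrightarrow> \<exists>v\<in>Z. norm (v - u) < e"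
    and lim: "\<And>v. v \<in> Z \<Longrightarrow> \<exists>L. ((\<lambda>t. fc f t v) \<longlongrightarrow> L) at_top"
  shows "conv f"
  unfolding conv_def
proof (intro conjI allI)
  show "\<exists>C. bounded_by f C" using f by blast
  fix u
  show "\<exists>L. ((\<lambda>t. fc f t u) \<longlongrightarrow> L) at_top"
  proof (rule at_top_limit_by_approximation)
    fix e :: real assume e: "e > 0"
    have C: "C + 1 > 0" using bounded_by_nonneg[OF f] by simp
    obtain v where v: "v \<in> Z" "norm (v - u) < e / (C + 1)" using Z[of "e / (C + 1)" u] e C by auto
    obtain L where L: "((\<lambda>t. fc f t v) \<longlongrightarrow> L) at_top" using lim v by blast
    have "norm (fc f t u - fc f t v) \<le> e" for t
    proof -
      have "norm (fc f t u - fc f t v) \<le> C * norm (u - v)" using norm_fc[OF f, of t "u - v"] by (simp add: fc_linear[OF f])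
      also have "\<dots> \<le> (C + 1) * (e / (C + 1))" using v bounded_by_nonneg[OF f] C by (intro mult_mono) (auto simp: norm_minus_commute)
      finally show ?thesis using C by simp
    qed
    then show "\<exists>g L. (g \<longlongrightarrow> L) at_top \<and> (\<forall>\<^sub>F t in at_top. norm (fc f t u - g t) \<le> e)"
      using L by (intro exI[of _ "\<lambda>t. fc f t v"] exI[of _ L]) auto
  qed
qed

lemma conv_uniform:
  assumes f: "bounded_by f C" and app: "\<And>e. e > 0 \<Longrightarrow> \<exists>g. conv g \<and> bounded_by (\<lambda>x. f x - g x) e"
  shows "conv f"
  unfolding conv_def
proof (intro conjI allI)
  show "\<exists>C. bounded_by f C" using f by blast
  fix u
  show "\<exists>L. ((\<lambda>t. fc f t u) \<longlongrightarrow> L) at_top"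
  proof (rule at_top_limit_by_approximation)
    fix e :: real assume e: "e > 0"
    have "norm u + 1 > 0" by (simp add: add_nonneg_pos)
    then obtain g where g: "conv g" "bounded_by (\<lambda>x. f x - g x) (e / (norm u + 1))" using app[of "e / (norm u + 1)"] e by auto
    then obtain D where D: "bounded_by g D" by (auto simp: conv_def)
    obtain L where L: "((\<lambda>t. fc g t u) \<longlongrightarrow> L) at_top" using g(1) unfolding conv_def by blast
    have "norm (fc f t u - fc g t u) \<le> e" for t
    proof -
      have "norm (fc f t u - fc g t u) \<le> e / (norm u + 1) * norm u" by (rule fc_diff_bound[OF f D g(2)])
      also have "\<dots> \<le> e / (norm u + 1) * (norm u + 1)" using e by (intro mult_left_mono) auto
      finally show ?thesis using \<open>norm u + 1 > 0\<close> by simp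
    qed
    then show "\<exists>g L. (g \<longlongrightarrow> L) at_top \<and> (\<forall>\<^sub>F t in at_top. norm (fc f t u - g t) \<le> e)"
      using L by (intro exI[of _ "\<lambda>t. fc g t u"] exI[of _ L]) auto
  qed
qed

lemma conv_add: "conv f \<Longrightarrow> conv g \<Longrightarrow> conv (\<lambda>x. f x + g x)"
proof -
  assume "conv f" "conv g"
  then obtain C D where f: "bounded_by f C" and g: "bounded_by g D"
    and lf: "\<And>u. \<exists>L. ((\<lambda>t. fc f t u) \<longlongrightarrow> L) at_top" and lg: "\<And>u. \<exists>L. ((\<lambda>t. fc g t u) \<longlongrightarrow> L) at_top"
    by (auto simp: conv_def)
  have "\<exists>L. ((\<lambda>t. fc (\<lambda>x. f x + g x) t u) \<longlongrightarrow> L) at_top" for u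
    unfolding fc_add[OF f g] using tendsto_add lf lg by metis
  then show ?thesis using bounded_by_add[OF f g] by (auto simp: conv_def)
qed

lemma fc_tendsto_compose:
  assumes f: "bounded_by f C" and v: "(v \<longlongrightarrow> l) F" and L: "((\<lambda>t. fc f t l) \<longlongrightarrow> L) F"
  shows "((\<lambda>t. fc f t (v t)) \<longlongrightarrow> L) F"
proof -
  have "((\<lambda>t. fc f t (v t) - fc f t l) \<longlongrightarrow> 0) F"
  proof (rule Lim_null_comparison)
    show "\<forall>\<^sub>F t in F. norm (fc f t (v t) - fc f t l) \<le> C * norm (v t - l)"
      using norm_fc[OF f] by (intro always_eventually allI) (simp flip: fc_linear[OF f])
    show "((\<lambda>t. C * norm (v t - l)) \<longlongrightarrow> 0) F"
      using tendsto_mult[OF tendsto_const tendsto_norm[OF Lim_null[THEN iffD1, OF v]], of C] by simp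
  qed
  from tendsto_add[OF this L] show ?thesis by simp
qed

lemma conv_mult: "conv f \<Longrightarrow> conv g \<Longrightarrow> conv (\<lambda>x. f x * g x)"
proof -
  assume "conv f" "conv g"
  then obtain C D where f: "bounded_by f C" and g: "bounded_by g D"
    and lf: "\<And>u. \<exists>L. ((\<lambda>t. fc f t u) \<longlongrightarrow> L) at_top" and lg: "\<And>u. \<exists>L. ((\<lambda>t. fc g t u) \<longlongrightarrow> L) at_top"
    by (auto simp: conv_def)
  have "\<exists>L. ((\<lambda>t. fc (\<lambda>x. f x * g x) t u) \<longlongrightarrow> L) at_top" for u
    unfolding fc_mult[OF f g] using fc_tendsto_compose[OF f] lf lg by metis
  then show ?thesis using bounded_by_mult[OF f g] by (auto simp: conv_def)
qed

lemma conv_const: "conv (\<lambda>_. c)"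
  unfolding conv_def fc_const using bounded_by_const by blast

lemma conv_cmult: "conv f \<Longrightarrow> conv (\<lambda>x. c * f x)"
  by (rule conv_mult[OF conv_const])

text \<open>
  The resolvents of \<open>X(t)/t\<close> converge on the dense set \<open>(Q - iM) D(X)\<close>, where
  \<open>(X(t)/t - iM)\<^sup>-\<^sup>1 (Q - iM) \<phi> = \<phi> + (X(t)/t - iM)\<^sup>-\<^sup>1 (Q - X(t)/t) \<phi>\<close>.
\<close>

lemma conv_resolvent:
  obtains M0 where "M0 > 0" "\<And>M. \<bar>M\<bar> \<ge> M0 \<Longrightarrow> conv (\<lambda>x. 1 / (of_real x - \<i> * of_real M))"
proof -
  obtain K where K: "K > 0" "\<And>u. norm (Q u) \<le> K * norm u" using Q_bound by metis
  show ?thesis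
  \<comment> \<open>For \<open>\<bar>M\<bar>\<close> at least twice the bound of \<open>Q\<close>,
    solving \<open>Q \<phi> - \<i> M \<phi> = u\<close> is a fixed point problem with contraction
    factor at most 1/2.\<close>
  proof (rule that[of "2 * K"])
    show "2 * K > 0" using K by simp
    fix M :: real assume M: "\<bar>M\<bar> \<ge> 2 * K"
    then have M0: "M \<noteq> 0" "\<bar>M\<bar> > 0" using K by auto
    let ?r = "\<lambda>x::real. 1 / (of_real x - \<i> * of_real M)"
    have nz: "of_real x - \<i> * of_real M \<noteq> 0" for x :: real using M0 by (auto simp: complex_eq_iff)
    have r: "bounded_by ?r (1 / \<bar>M\<bar>)"
      unfolding bounded_by_def
    proof
      fix x :: real
      have "\<bar>M\<bar> \<le> cmod (of_real x - \<i> * of_real M)" using abs_Im_le_cmod[of "of_real x - \<i> * of_real M"] by simp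
      then show "cmod (?r x) \<le> 1 / \<bar>M\<bar>" using M0 by (simp add: norm_divide frac_le)
    qed
    let ?R = "\<lambda>\<phi>. Q \<phi> - cscale (\<i> * of_real M) \<phi>"
    have inv: "fc ?r t ((1 / t) *\<^sub>R heis_op J t \<phi> - cscale (\<i> * of_real M) \<phi>) = \<phi>" if \<phi>: "\<phi> \<in> pos_dom" and t: "t > 0" for \<phi> t
    proof (rule fc_eqI)
      fix n
      let ?v = "l2_nth (U (- t) \<phi>) n"
      have "l2_nth (U (- t) ((1 / t) *\<^sub>R heis_op J t \<phi> - cscale (\<i> * of_real M) \<phi>)) n = (of_real (of_int n / t) - \<i> * of_real M) *s ?v"
        by (simp add: heis_op_def linear_simps[OF bounded_linear_U] U_cscale minus_l2.rep_eq scaleR_l2.rep_eq cscale.rep_eq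
            pos_op_nth[OF U_pos_dom[OF \<phi>]] vec_eq_iff algebra_simps scaleR_conv_of_real[where 'a = complex])
      then show "l2_nth (mulop (\<lambda>n. ?r (of_int n / t)) (U (- t) ((1 / t) *\<^sub>R heis_op J t \<phi> - cscale (\<i> * of_real M) \<phi>))) n = ?v"
        using nz[of "of_int n / t"] by (simp only: mulop_nth[OF bounded_by_scaled[OF r]] vector_smult_assoc
            times_divide_eq_left mult_1 divide_self_if if_False vector_smult_lid)
    qed
    show "conv ?r"
    proof (rule conv_dense[OF r, where Z = "?R ` pos_dom"])
      fix u :: "'m l2" and e :: real assume e: "e > 0"
      define d where "d = 1 / (\<i> * complex_of_real M)"
      have d: "cmod d = 1 / \<bar>M\<bar>" "\<i> * of_real M * d = 1" using M0 by (auto simp: d_def norm_divide norm_mult)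
      have "\<exists>!\<phi>. cscale d (Q \<phi> - u) = \<phi>"
      proof (rule banach_fix_type[of "1 / 2"])
        show "\<forall>x y. dist (cscale d (Q x - u)) (cscale d (Q y - u)) \<le> 1 / 2 * dist x y"
        proof (intro allI)
          fix x y
          have "dist (cscale d (Q x - u)) (cscale d (Q y - u)) = cmod d * norm (Q (x - y))"
            by (simp add: dist_norm linear_simps[OF linear_Q] flip: norm_cscale)
          also have "\<dots> \<le> 1 / \<bar>M\<bar> * (K * norm (x - y))" unfolding d using K by (intro mult_left_mono) auto
          also have "\<dots> \<le> 1 / 2 * norm (x - y)"
            using M M0 K mult_right_mono[OF M, of "norm (x - y)"] by (simp add: field_simps)
          finally show "dist (cscale d (Q x - u)) (cscale d (Q y - u)) \<le> 1 / 2 * dist x y" by (simp add: dist_norm)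
        qed
      qed auto
      then obtain \<phi> where \<phi>: "cscale d (Q \<phi> - u) = \<phi>" by blast
      have "cscale (\<i> * of_real M) \<phi> = cscale (\<i> * of_real M * d) (Q \<phi> - u)"
        using arg_cong[OF \<phi>, of "cscale (\<i> * of_real M)"] by simp
      then have R\<phi>: "?R \<phi> = u" by (simp add: d)
      \<comment> \<open>The solution \<open>\<phi>\<close> may lie outside the domain of position;
        \<open>B\<close> bounds \<open>Q - \<i> M\<close> and so controls the cost of replacing
        \<open>\<phi>\<close> by a nearby \<open>\<phi>'\<close> inside.\<close>
      define B where "B = K + \<bar>M\<bar>"
      have B: "B > 0" using K by (simp add: B_def add_pos_nonneg)
      obtain \<phi>' where \<phi>': "\<phi>' \<in> pos_dom" "norm (\<phi>' - \<phi>) < e / B" using pos_dom_approx[of "e / B" \<phi>] e B by auto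
      have "?R \<phi>' - u = ?R (\<phi>' - \<phi>)" using R\<phi> by (simp add: linear_simps[OF linear_Q] algebra_simps)
      then have "norm (?R \<phi>' - u) \<le> norm (Q (\<phi>' - \<phi>)) + norm (cscale (\<i> * of_real M) (\<phi>' - \<phi>))"
        by (simp only: norm_triangle_ineq4)
      also have "\<dots> \<le> B * norm (\<phi>' - \<phi>)" using K(2)[of "\<phi>' - \<phi>"] unfolding norm_cscale by (simp add: B_def norm_mult algebra_simps)
      also have "\<dots> < e" using \<phi>'(2) B by (simp add: field_simps)
      finally show "\<exists>v\<in>?R ` pos_dom. norm (v - u) < e" using \<phi>'(1) by blast
    next
      fix v assume "v \<in> ?R ` pos_dom"
      then obtain \<phi> where \<phi>: "\<phi> \<in> pos_dom" "v = ?R \<phi>" by blast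
      have "((\<lambda>t. fc ?r t (Q \<phi> - (1 / t) *\<^sub>R heis_op J t \<phi>) + \<phi>) \<longlongrightarrow> 0 + \<phi>) at_top"
      proof (rule tendsto_add[OF fc_tendsto_compose[OF r] tendsto_const])
        show "((\<lambda>t. Q \<phi> - (1 / t) *\<^sub>R heis_op J t \<phi>) \<longlongrightarrow> Q \<phi> - Q \<phi>) at_top"
          by (intro tendsto_diff tendsto_const heis_Q \<phi>)
        show "((\<lambda>t. fc ?r t (Q \<phi> - Q \<phi>)) \<longlongrightarrow> 0) at_top" by (simp add: fc_linear[OF r])
      qed
      moreover have "\<forall>\<^sub>F t in at_top. fc ?r t (Q \<phi> - (1 / t) *\<^sub>R heis_op J t \<phi>) + \<phi> = fc ?r t v"
        using eventually_gt_at_top[of 0]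
      proof eventually_elim
        case (elim t)
        have "v = (Q \<phi> - (1 / t) *\<^sub>R heis_op J t \<phi>) + ((1 / t) *\<^sub>R heis_op J t \<phi> - cscale (\<i> * of_real M) \<phi>)"
          using \<phi> by simp
        then have "fc ?r t v = fc ?r t (Q \<phi> - (1 / t) *\<^sub>R heis_op J t \<phi>) + fc ?r t ((1 / t) *\<^sub>R heis_op J t \<phi> - cscale (\<i> * of_real M) \<phi>)"
          by (simp only: fc_linear[OF r])
        then show ?case by (simp only: inv[OF \<phi>(1) elim])
      qed
      ultimately show "\<exists>L. ((\<lambda>t. fc ?r t v) \<longlongrightarrow> L) at_top" by (auto intro: Lim_transform_eventually)
    qed
  qed
qed

text \<open>A real-linear functional on the plane is \<open>\<alpha> z + cnj \<alpha> cnj z\<close>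
  with \<open>\<alpha> = (p 1 - \<i> p \<i>) / 2\<close>, so \<open>r\<close> and its conjugate
  generate all real polynomials.\<close>

lemma conv_polynomial:
  assumes p: "real_polynomial_function p" and r: "conv r" "conv (\<lambda>x. cnj (r x))"
  shows "conv (\<lambda>x. of_real (p (r x)))"
  using p
proof (induction p rule: real_polynomial_function.induct)
  case (linear p)
  have "of_real (p z) = (of_real (p 1) - \<i> * of_real (p \<i>)) / 2 * z + (of_real (p 1) + \<i> * of_real (p \<i>)) / 2 * cnj z" for z
  proof -
    have "z = Re z *\<^sub>R 1 + Im z *\<^sub>R \<i>" by (simp add: complex_eq_iff)
    then have "p z = p (Re z *\<^sub>R 1 + Im z *\<^sub>R \<i>)" by simp
    also have "\<dots> = Re z * p 1 + Im z * p \<i>" by (simp add: linear_simps[OF linear])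
    finally show ?thesis by (simp add: complex_eq_iff field_simps)
  qed
  from this[of "r x" for x] have eq: "(\<lambda>x. of_real (p (r x))) = (\<lambda>x. (of_real (p 1) - \<i> * of_real (p \<i>)) / 2 * r x + (of_real (p 1) + \<i> * of_real (p \<i>)) / 2 * cnj (r x))"
    by (rule ext)
  show ?case unfolding eq by (intro conv_add conv_cmult r)
next
  case (add f g)
  then show ?case using conv_add[OF add.IH] by simp
next
  case (mult f g)
  then show ?case using conv_mult[OF mult.IH] by simp
qed (rule conv_const)

text \<open>The resolvent maps the line onto a circle without the point 0, which stands for
  infinity. A compactly supported \<open>f\<close> becomes continuous on the whole circle, where
  polynomials are dense.\<close>

lemma conv_compact_support:
  fixes f :: "real \<Rightarrow> real"
  assumes f: "continuous_on UNIV f" and R: "\<And>x. \<bar>x\<bar> \<ge> R \<Longrightarrow> f x = 0"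
  shows "conv (\<lambda>x. of_real (f x))"
proof -
  obtain M where M: "M > 0" "conv (\<lambda>x. 1 / (of_real x - \<i> * of_real M))" "conv (\<lambda>x. 1 / (of_real x - \<i> * of_real (- M)))"
    using conv_resolvent by (metis abs_minus_cancel abs_of_pos order_refl)
  define r where "r x = 1 / (of_real x - \<i> * complex_of_real M)" for x :: real
  have cr: "conv r" "conv (\<lambda>x. cnj (r x))" using M by (simp_all add: r_def[abs_def])
  \<comment> \<open>The image under inversion of the line with imaginary part \<open>- M\<close>,
    completed by 0.\<close>
  define Z where "Z = sphere (\<i> / (2 * of_real M)) (1 / (2 * M))"
  have S_im: "Im (1 / y) = - M" if "y \<in> Z" "y \<noteq> 0" for y
  proof -
    have "(cmod (\<i> / (2 * of_real M) - y))\<^sup>2 = (1 / (2 * M))\<^sup>2" using that(1) by (simp add: Z_def dist_norm)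
    then have "(Re y)\<^sup>2 + (1 / (2 * M) - Im y)\<^sup>2 = (1 / (2 * M))\<^sup>2" by (simp add: cmod_power2)
    then have "(Re y)\<^sup>2 + (Im y)\<^sup>2 = Im y / M" using M(1) by (simp add: power2_diff)
    moreover have "(Re y)\<^sup>2 + (Im y)\<^sup>2 \<noteq> 0" using that(2) by (simp add: complex_eq_iff sum_power2_eq_zero_iff)
    ultimately show ?thesis using M(1) by (simp add: Im_divide)
  qed
  have rS: "r x \<in> Z" and r0: "r x \<noteq> 0" and r1: "Re (1 / r x) = x" for x
  proof -
    have nz: "of_real x - \<i> * complex_of_real M \<noteq> 0" using M(1) by (auto simp: complex_eq_iff)
    then show "r x \<noteq> 0" "Re (1 / r x) = x" by (simp_all add: r_def)
    have "\<i> / (2 * of_real M) - r x = \<i> * (of_real x + \<i> * of_real M) / (2 * of_real M * (of_real x - \<i> * of_real M))"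
      using nz M(1) by (simp add: r_def divide_simps) (simp add: algebra_simps)
    moreover have "cmod (of_real x + \<i> * of_real M) = cmod (of_real x - \<i> * of_real M)"
      by (simp add: cmod_def)
    ultimately have "cmod (\<i> / (2 * of_real M) - r x) = 1 / (2 * M)"
      using nz M(1) by (simp add: norm_divide norm_mult)
    then show "r x \<in> Z" by (simp add: Z_def dist_norm)
  qed
  define h where "h y = (if y = 0 then 0 else f (Re (1 / y)))" for y
  have hr: "h (r x) = f x" for x by (simp only: h_def r0 r1 if_False)
  have cont: "continuous_on Z h"
    unfolding continuous_on_def
  proof
    fix y0 assume y0: "y0 \<in> Z"
    show "(h \<longlongrightarrow> h y0) (at y0 within Z)"
    proof (cases "y0 = 0")
      case False
      have "isCont (\<lambda>y. f (Re (1 / y))) y0"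
      proof (rule isCont_o2[where f = "\<lambda>y. Re (1 / y)"])
        show "isCont (\<lambda>y. Re (1 / y)) y0" unfolding isCont_def by (intro tendsto_Re tendsto_divide tendsto_const tendsto_ident_at False)
        show "isCont f (Re (1 / y0))" using f by (simp add: continuous_on_eq_continuous_at)
      qed
      then have "((\<lambda>y. f (Re (1 / y))) \<longlongrightarrow> h y0) (at y0 within Z)"
        using False tendsto_within_subset[OF _ subset_UNIV] by (auto simp: isCont_def h_def)
      moreover have "\<forall>\<^sub>F y in at y0 within Z. f (Re (1 / y)) = h y"
      proof -
        have "\<forall>\<^sub>F y in at y0 within Z. y \<noteq> 0"
          using tendsto_imp_eventually_ne[OF tendsto_ident_at False] .
        then show ?thesis by eventually_elim (simp add: h_def)
      qed
      ultimately show ?thesis by (rule Lim_transform_eventually)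
    next
      case True
      \<comment> \<open>For \<open>cmod y < \<delta>\<close> the modulus of \<open>1 / y\<close>
        exceeds \<open>\<bar>R\<bar> + M\<close>; its imaginary part is \<open>- M\<close>, so its
        real part lies where \<open>f\<close> vanishes.\<close>
      define \<delta> where "\<delta> = 1 / (\<bar>R\<bar> + M)"
      have \<delta>: "\<delta> > 0" using M(1) by (simp add: \<delta>_def add_nonneg_pos)
      have "h y = 0" if y: "y \<in> Z" "y \<noteq> 0" "dist y 0 < \<delta>" for y
      proof -
        have "cmod y < 1 / (\<bar>R\<bar> + M)" using y(3) by (simp add: \<delta>_def)
        then have "\<bar>R\<bar> + M < 1 / cmod y" using y(2) M(1) by (simp add: field_simps add_nonneg_pos)
        also have "\<dots> = cmod (1 / y)" by (simp add: norm_divide)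
        also have "\<dots> \<le> \<bar>Re (1 / y)\<bar> + \<bar>Im (1 / y)\<bar>" by (rule cmod_le)
        finally have "\<bar>Re (1 / y)\<bar> \<ge> R" using S_im[OF y(1,2)] M(1) by simp
        then show ?thesis using R by (simp add: h_def)
      qed
      then have "\<forall>\<^sub>F y in at y0 within Z. h y = h y0"
        unfolding True eventually_at using \<delta> by (auto simp: h_def)
      then show ?thesis by (rule tendsto_eventually)
    qed
  qed
  have "compact Z" by (simp add: Z_def)
  obtain C where C: "\<And>y. y \<in> Z \<Longrightarrow> \<bar>h y\<bar> \<le> C"
    using compact_imp_bounded[OF compact_continuous_image[OF cont \<open>compact Z\<close>]] unfolding bounded_iff
    by (metis image_eqI real_norm_def)
  have bf: "bounded_by (\<lambda>x. of_real (f x)) C"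
    using C[OF rS] by (simp add: bounded_by_def hr)
  show ?thesis
  proof (rule conv_uniform[OF bf])
    fix e :: real assume "e > 0"
    from Stone_Weierstrass_real_polynomial_function[OF \<open>compact Z\<close> cont this]
    obtain g where g: "real_polynomial_function g" "\<And>y. y \<in> Z \<Longrightarrow> \<bar>h y - g y\<bar> < e" by blast
    have "bounded_by (\<lambda>x. of_real (f x) - of_real (g (r x))) e"
      unfolding bounded_by_def
    proof
      fix x show "cmod (of_real (f x) - of_real (g (r x))) \<le> e"
        using g(2)[OF rS[of x]] unfolding hr by (simp flip: of_real_diff)
    qed
    then show "\<exists>g. conv g \<and> bounded_by (\<lambda>x. of_real (f x) - g x) e"
      using conv_polynomial[OF g(1) cr] by blast
  qed
qed

lemma heis_bound:
  obtains K where "K > 0" "\<And>t u. u \<in> pos_dom \<Longrightarrow> t \<ge> 1 \<Longrightarrow> norm ((1 / t) *\<^sub>R heis_op J t u) \<le> norm (pos_op u) + K * norm u"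
proof -
  obtain K where K: "K > 0" "\<And>t u. t \<ge> 0 \<Longrightarrow> norm (avg A t u) \<le> K * norm u" using Q_bound by metis
  have "norm ((1 / t) *\<^sub>R heis_op J t u) \<le> norm (pos_op u) + K * norm u" if u: "u \<in> pos_dom" and t: "t \<ge> 1" for t u
  proof -
    have "(1 / t) *\<^sub>R heis_op J t u = (1 / t) *\<^sub>R pos_op u + avg A t u"
      using t by (simp add: heis_eq[OF u] avg_def scaleR_right_distrib)
    then have "norm ((1 / t) *\<^sub>R heis_op J t u) \<le> (1 / t) * norm (pos_op u) + norm (avg A t u)"
      using norm_triangle_ineq[of "(1 / t) *\<^sub>R pos_op u" "avg A t u"] t by simp
    also have "\<dots> \<le> 1 * norm (pos_op u) + K * norm u"
      using t K(2)[of t u] by (intro add_mono mult_right_mono) auto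
    finally show ?thesis by simp
  qed
  then show ?thesis using that K(1) by blast
qed

definition cutoff :: "real \<Rightarrow> real \<Rightarrow> real" where "cutoff R x = max 0 (min 1 (R + 1 - \<bar>x\<bar>))"

lemma cutoff_bounds: "0 \<le> cutoff R x" "cutoff R x \<le> 1" "\<bar>x\<bar> \<ge> R + 1 \<Longrightarrow> cutoff R x = 0"
  "R > 0 \<Longrightarrow> 1 - cutoff R x \<le> \<bar>x\<bar> / R"
proof -
  show "R > 0 \<Longrightarrow> 1 - cutoff R x \<le> \<bar>x\<bar> / R"
  proof (cases "\<bar>x\<bar> \<le> R")
    case False
    assume "R > 0"
    then have "1 \<le> \<bar>x\<bar> / R" using False by simp
    then show ?thesis by (simp add: cutoff_def)
  qed (simp add: cutoff_def)
qed (auto simp: cutoff_def)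

text \<open>On the domain of position, cutting off at \<open>R\<close> costs at most
  \<open>C / R\<close> times a bound of \<open>X(t) u / t\<close> that is uniform for
  \<open>t \<ge> 1\<close>; density does the rest.\<close>

lemma conv_continuous:
  fixes f :: "real \<Rightarrow> real"
  assumes f: "continuous_on UNIV f" and C: "\<And>x. \<bar>f x\<bar> \<le> C"
  shows "conv (\<lambda>x. of_real (f x))"
proof -
  have bf: "bounded_by (\<lambda>x. of_real (f x)) C" using C by (simp add: bounded_by_def)
  obtain K where K: "K > 0" "\<And>t u. u \<in> pos_dom \<Longrightarrow> t \<ge> 1 \<Longrightarrow> norm ((1 / t) *\<^sub>R heis_op J t u) \<le> norm (pos_op u) + K * norm u"
    using heis_bound by blast
  show ?thesis
  proof (rule conv_dense[OF bf, where Z = pos_dom])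
    show "\<exists>v\<in>pos_dom. norm (v - u) < e" if "e > 0" for u :: "'m l2" and e
      using pos_dom_approx[OF that] by blast
    fix u :: "'m l2" assume u: "u \<in> pos_dom"
    show "\<exists>L. ((\<lambda>t. fc (\<lambda>x. of_real (f x)) t u) \<longlongrightarrow> L) at_top"
    proof (rule at_top_limit_by_approximation)
      fix e :: real assume e: "e > 0"
      define B where "B = norm (pos_op u) + K * norm u"
      have B: "B \<ge> 0" using K by (simp add: B_def)
      have C0: "C \<ge> 0" using C[of 0] by simp
      \<comment> \<open>Large enough for \<open>C * B / R \<le> e\<close>; the added 1 keeps
        \<open>R\<close> positive.\<close>
      define R where "R = C * B / e + 1"
      have "C * B / e \<ge> 0" "C * B \<le> e * R" using e B C0 by (simp_all add: R_def field_simps)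
      then have R: "R > 0" "C / R * B \<le> e" by (simp_all add: R_def add_nonneg_pos divide_le_eq mult.commute)
      define g where "g x = f x * cutoff R x" for x
      have "conv (\<lambda>x. of_real (g x))"
      proof (rule conv_compact_support)
        show "continuous_on UNIV g" unfolding g_def cutoff_def by (intro continuous_intros f)
        show "\<bar>x\<bar> \<ge> R + 1 \<Longrightarrow> g x = 0" for x by (simp add: g_def cutoff_bounds)
      qed
      then obtain D where D: "bounded_by (\<lambda>x. of_real (g x)) D" by (auto simp: conv_def)
      obtain L where L: "((\<lambda>t. fc (\<lambda>x. of_real (g x)) t u) \<longlongrightarrow> L) at_top"
        using \<open>conv (\<lambda>x. of_real (g x))\<close> unfolding conv_def by blast
      have diff: "\<bar>f x - g x\<bar> = \<bar>f x\<bar> * (1 - cutoff R x)" for x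
      proof -
        have "f x - g x = f x * (1 - cutoff R x)" by (simp add: g_def algebra_simps)
        then show ?thesis using cutoff_bounds(2)[of R x] by (simp add: abs_mult)
      qed
      have bd: "bounded_by (\<lambda>x. of_real (f x) - of_real (g x)) (C * 1)"
        unfolding bounded_by_def
      proof
        fix x
        have "\<bar>f x - g x\<bar> \<le> C * 1" unfolding diff using C cutoff_bounds[of R x] C0 by (intro mult_mono) auto
        then show "cmod (of_real (f x) - of_real (g x)) \<le> C * 1" by (simp flip: of_real_diff)
      qed
      have "norm (fc (\<lambda>x. of_real (f x)) t u - fc (\<lambda>x. of_real (g x)) t u) \<le> e" if t: "t \<ge> 1" for t
      proof -
        have "fc (\<lambda>x. (of_real (f x) - of_real (g x)) + of_real (g x)) t u
            = fc (\<lambda>x. of_real (f x) - of_real (g x)) t u + fc (\<lambda>x. of_real (g x)) t u" by (rule fc_add[OF bd D])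
        then have "norm (fc (\<lambda>x. of_real (f x)) t u - fc (\<lambda>x. of_real (g x)) t u) = norm (fc (\<lambda>x. of_real (f x) - of_real (g x)) t u)" by simp
        also have "\<dots> \<le> C / R * norm ((1 / t) *\<^sub>R heis_op J t u)"
        proof (rule fc_tail_bound[OF bd _ _ u])
          fix x
          have "\<bar>f x - g x\<bar> \<le> C * (\<bar>x\<bar> / R)" unfolding diff using C cutoff_bounds[of R x] C0 R by (intro mult_mono) auto
          then show "cmod (of_real (f x) - of_real (g x)) \<le> C / R * \<bar>x\<bar>" by (simp flip: of_real_diff)
        qed (use t C0 R in auto)
        also have "\<dots> \<le> C / R * B" using K(2)[OF u t] C0 R by (intro mult_left_mono) (auto simp: B_def)
        finally show ?thesis using R by simp
      qed
      then show "\<exists>g L. (g \<longlongrightarrow> L) at_top \<and> (\<forall>\<^sub>F t in at_top. norm (fc (\<lambda>x. of_real (f x)) t u - g t) \<le> e)"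
        using L
        by (intro exI[of _ "\<lambda>t. fc (\<lambda>x. of_real (g x)) t u"] exI[of _ L])
          (auto intro: eventually_mono[OF eventually_ge_at_top[of 1]])
    qed
  qed
qed

end

subsection \<open>Spectral resolution of the scaled position operator\<close>

lemma integrable_count_space_iff:
  fixes g :: "'a \<Rightarrow> real"
  shows "integrable (count_space UNIV) g \<longleftrightarrow> g summable_on UNIV"
  unfolding abs_summable_on_def[symmetric] abs_summable_equivalent[symmetric]
  by (rule summable_on_iff_abs_summable_on_real[symmetric])

lemma integral_count_space_eq_infsum:
  fixes g :: "'a \<Rightarrow> real"
  assumes "g summable_on UNIV"
  shows "(\<integral>x. g x \<partial>count_space UNIV) = (\<Sum>\<^sub>\<infinity>x. g x)"
proof -
  have "Infinite_Set_Sum.abs_summable_on g UNIV"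
    using assms by (simp add: abs_summable_on_def integrable_count_space_iff)
  then show ?thesis using infsetsum_infsum by (simp add: infsetsum_def)
qed

definition scaled_point_measure :: "(int \<Rightarrow> real) \<Rightarrow> real \<Rightarrow> real measure" where
  "scaled_point_measure w t = distr (density (count_space UNIV) (\<lambda>n. ennreal (w n))) borel (\<lambda>n. of_int n / t)"

lemma sets_scaled_point_measure: "sets (scaled_point_measure w t) = sets borel"
  by (simp add: scaled_point_measure_def)

lemma integrable_scaled_point_measure:
  assumes w: "\<And>n. w n \<ge> 0" and f: "f \<in> borel_measurable borel"
  shows "integrable (scaled_point_measure w t) f \<longleftrightarrow> (\<lambda>n. w n * f (of_int n / t)) summable_on UNIV"
  unfolding scaled_point_measure_def using w f
  by (simp add: integrable_distr_eq integrable_density integrable_count_space_iff)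

lemma integral_scaled_point_measure:
  fixes f :: "real \<Rightarrow> real"
  assumes w: "\<And>n. w n \<ge> 0" and f: "f \<in> borel_measurable borel"
    and s: "(\<lambda>n. w n * f (of_int n / t)) summable_on UNIV"
  shows "(\<integral>x. f x \<partial>scaled_point_measure w t) = (\<Sum>\<^sub>\<infinity>n. w n * f (of_int n / t))"
  unfolding scaled_point_measure_def using w f s
  by (simp add: integral_distr integral_density integral_count_space_eq_infsum)

context periodic_jacobi
begin

text \<open>The distribution of \<open>X(t)/t\<close> in the state \<open>u\<close>, with total mass
  the squared norm of \<open>u\<close>.\<close>

definition pm :: "real \<Rightarrow> 'm l2 \<Rightarrow> real measure" where
  "pm t u = scaled_point_measure (\<lambda>n. (norm (l2_nth (U (- t) u) n))\<^sup>2) t"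

lemma sets_pm [measurable_cong]: "sets (pm t u) = sets borel"
  by (simp add: pm_def sets_scaled_point_measure)

lemma pm_bounded:
  fixes f :: "real \<Rightarrow> real"
  assumes f: "f \<in> borel_measurable borel" and C: "\<And>x. \<bar>f x\<bar> \<le> C"
  shows "integrable (pm t u) f" "(\<integral>x. f x \<partial>pm t u) = inner u (fc (\<lambda>x. of_real (f x)) t u)"
proof -
  let ?v = "U (- t) u"
  have bf: "bounded_by (\<lambda>x. of_real (f x)) C" using C by (simp add: bounded_by_def)
  have s: "(\<lambda>n. (norm (l2_nth ?v n))\<^sup>2 * f (of_int n / t)) summable_on UNIV"
  proof (rule summable_on_le[OF summable_on_cmult_right[OF l2_summable[of ?v], of C]])
    fix n show "\<bar>(norm (l2_nth ?v n))\<^sup>2 * f (of_int n / t)\<bar> \<le> C * (norm (l2_nth ?v n))\<^sup>2"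
      using mult_right_mono[OF C, of "(norm (l2_nth ?v n))\<^sup>2"] by (simp add: abs_mult mult.commute)
  qed
  then show "integrable (pm t u) f" using f by (simp add: pm_def integrable_scaled_point_measure)
  have "inner u (fc (\<lambda>x. of_real (f x)) t u) = inner ?v (mulop (\<lambda>n. of_real (f (of_int n / t))) ?v)"
    using U_adjoint[of "- t" u] by (simp add: fc_def)
  also have "\<dots> = (\<Sum>\<^sub>\<infinity>n. (norm (l2_nth ?v n))\<^sup>2 * f (of_int n / t))"
    unfolding inner_l2_def
    by (simp add: mulop_nth[OF bounded_by_scaled[OF bf]] scaleR_eq_smult[symmetric] power2_norm_eq_inner mult.commute)
  also have "\<dots> = (\<integral>x. f x \<partial>pm t u)"
    unfolding pm_def by (rule integral_scaled_point_measure[symmetric]) (use f s in auto)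
  finally show "(\<integral>x. f x \<partial>pm t u) = inner u (fc (\<lambda>x. of_real (f x)) t u)" by simp
qed

lemma finite_measure_pm: "finite_measure (pm t u)"
proof -
  have "integrable (pm t u) (\<lambda>_. 1 :: real)" by (rule pm_bounded(1)[of _ 1]) auto
  then show ?thesis by (intro finite_measureI) (simp add: integrable_iff_bounded less_top)
qed

lemma bounded_by_indicator: "bounded_by (\<lambda>x. of_real (indicator B x)) 1"
  by (auto simp: bounded_by_def indicator_def)

definition Et :: "real \<Rightarrow> real set \<Rightarrow> 'm l2 \<Rightarrow> 'm l2" where
  "Et t B = fc (\<lambda>x. of_real (indicator B x)) t"

lemma form_measure_Et: "form_measure (Et t) (pm t)"
proof (rule form_measure.intro)
  show "finite_measure (pm t u)" for u by (rule finite_measure_pm)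
  show "sets (pm t u) = sets borel" for u by (rule sets_pm)
  show "bounded_selfadjoint (Et t B)" for B
    unfolding Et_def by (rule fc_selfadjoint[OF bounded_by_indicator])
  show f: "inner u (Et t B u) = measure (pm t u) B" if B: "B \<in> sets borel" for B u
  proof -
    have "(\<integral>x. indicator B x \<partial>pm t u) = inner u (Et t B u)"
      unfolding Et_def using B by (intro pm_bounded(2)[of _ 1]) (auto simp: indicator_def)
    moreover have "space (pm t u) = UNIV" using sets_eq_imp_space_eq[OF sets_pm] by simp
    ultimately show ?thesis by simp
  qed
  show "measure (pm t u) UNIV = (norm u)\<^sup>2" for u
    using f[of UNIV u] by (simp add: Et_def fc_const power2_norm_eq_inner)
qed

lemma Et_pvm: "projection_valued_measure (Et t)"
proof (rule form_measure.projection_valued_measureI[OF form_measure_Et])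
  fix B C :: "real set" and u
  have "(\<lambda>x. complex_of_real (indicator (B \<inter> C) x)) = (\<lambda>x. of_real (indicator B x) * of_real (indicator C x))"
    by (auto simp: fun_eq_iff indicator_def)
  then show "Et t (B \<inter> C) u = Et t B (Et t C u)"
    by (simp add: Et_def fc_mult[OF bounded_by_indicator bounded_by_indicator])
qed

lemma spectral_measure_Et: "spectral_measure (Et t) u = pm t u"
  by (rule form_measure.spectral_measure_eq[OF form_measure_Et])

lemma pos_op_symmetric:
  assumes "u \<in> pos_dom" "v \<in> pos_dom"
  shows "inner (pos_op u) v = inner u (pos_op v)"
  unfolding inner_l2_def using assms by (simp add: pos_op_nth)

lemma pm_second_moment:
  assumes t: "t > 0"
  shows "u \<in> heis_dom J t \<longleftrightarrow> (\<integral>\<^sup>+x. ennreal (x\<^sup>2) \<partial>pm t u) < \<infinity>"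
    and "u \<in> heis_dom J t \<Longrightarrow> integrable (pm t u) (\<lambda>x. x\<^sup>2)"
    and "u \<in> heis_dom J t \<Longrightarrow> (\<integral>x. x\<^sup>2 \<partial>pm t u) = (norm ((1 / t) *\<^sub>R heis_op J t u))\<^sup>2"
    and "u \<in> heis_dom J t \<Longrightarrow> (\<integral>x. x \<partial>pm t u) = inner u ((1 / t) *\<^sub>R heis_op J t u)"
proof -
  let ?v = "U (- t) u"
  have eq: "(norm (l2_nth ?v n))\<^sup>2 * (of_int n / t)\<^sup>2 = (1 / t\<^sup>2) * (norm (of_int n *\<^sub>R l2_nth ?v n))\<^sup>2" for n
    by (simp add: power_mult_distrib power_divide)
  have int: "integrable (pm t u) (\<lambda>x. x\<^sup>2) \<longleftrightarrow> u \<in> heis_dom J t"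
  proof -
    have "integrable (pm t u) (\<lambda>x. x\<^sup>2) \<longleftrightarrow> (\<lambda>n. (1 / t\<^sup>2) * (norm (of_int n *\<^sub>R l2_nth ?v n))\<^sup>2) summable_on UNIV"
      unfolding pm_def by (subst integrable_scaled_point_measure) (simp_all only: eq, auto)
    also have "\<dots> \<longleftrightarrow> (\<lambda>n. (norm (of_int n *\<^sub>R l2_nth ?v n))\<^sup>2) summable_on UNIV"
      using t by (subst summable_on_cmult_right') auto
    finally show ?thesis by (simp add: heis_dom_def pos_dom_def)
  qed
  show "u \<in> heis_dom J t \<longleftrightarrow> (\<integral>\<^sup>+x. ennreal (x\<^sup>2) \<partial>pm t u) < \<infinity>"
    unfolding int[symmetric] integrable_iff_bounded by (simp add: sets_pm)
  show "u \<in> heis_dom J t \<Longrightarrow> integrable (pm t u) (\<lambda>x. x\<^sup>2)" using int by simp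
  assume u: "u \<in> heis_dom J t"
  then have v: "?v \<in> pos_dom" by (simp add: heis_dom_def)
  have sv: "(\<lambda>n. (norm (of_int n *\<^sub>R l2_nth ?v n))\<^sup>2) summable_on UNIV" using v by (simp add: pos_dom_def)
  have "(\<integral>x. x\<^sup>2 \<partial>pm t u) = (\<Sum>\<^sub>\<infinity>n. (1 / t\<^sup>2) * (norm (of_int n *\<^sub>R l2_nth ?v n))\<^sup>2)"
    unfolding pm_def
  proof (subst integral_scaled_point_measure)
    show "(\<lambda>n. (norm (l2_nth ?v n))\<^sup>2 * (of_int n / t)\<^sup>2) summable_on UNIV"
      unfolding eq by (rule summable_on_cmult_right[OF sv])
  qed (simp_all only: eq, auto)
  also have "\<dots> = (1 / t\<^sup>2) * (norm (pos_op ?v))\<^sup>2"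
    unfolding norm_l2_sq pos_op_nth[OF v] by (rule infsum_cmult_right')
  finally show "(\<integral>x. x\<^sup>2 \<partial>pm t u) = (norm ((1 / t) *\<^sub>R heis_op J t u))\<^sup>2"
    by (simp add: heis_op_def power_divide)
  have s: "(\<lambda>n. (norm (l2_nth ?v n))\<^sup>2 * (of_int n / t)) summable_on UNIV"
  proof -
    have "(\<lambda>n. inner (l2_nth ?v n) (l2_nth ((1 / t) *\<^sub>R pos_op ?v) n)) summable_on UNIV" by (rule inner_summable)
    then show ?thesis by (simp add: scaleR_l2.rep_eq pos_op_nth[OF v] power2_norm_eq_inner mult.commute)
  qed
  have "(\<integral>x. x \<partial>pm t u) = (\<Sum>\<^sub>\<infinity>n. (norm (l2_nth ?v n))\<^sup>2 * (of_int n / t))"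
    unfolding pm_def by (rule integral_scaled_point_measure) (use s in auto)
  also have "\<dots> = inner ?v ((1 / t) *\<^sub>R pos_op ?v)"
    unfolding inner_l2_def by (simp add: scaleR_l2.rep_eq pos_op_nth[OF v] power2_norm_eq_inner mult.commute)
  also have "\<dots> = inner u ((1 / t) *\<^sub>R heis_op J t u)"
    using U_adjoint[of "- t" u "pos_op ?v"] by (simp add: heis_op_def)
  finally show "(\<integral>x. x \<partial>pm t u) = inner u ((1 / t) *\<^sub>R heis_op J t u)" .
qed

lemma resolved_heis:
  assumes t: "t > 0"
  shows "resolved_operator (heis_dom J t) (\<lambda>u. (1 / t) *\<^sub>R heis_op J t u) (Et t)"
proof (intro resolved_operator.intro symmetric_domain.intro resolved_operator_axioms.intro)
  show "u + v \<in> heis_dom J t" if "u \<in> heis_dom J t" "v \<in> heis_dom J t" for u v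
    using that by (simp add: heis_dom_def U_linear pos_op_add)
  show "cscale c u \<in> heis_dom J t" if "u \<in> heis_dom J t" for u c
    using that by (simp add: heis_dom_def U_cscale pos_op_cscale)
  show "(1 / t) *\<^sub>R heis_op J t (u + v) = (1 / t) *\<^sub>R heis_op J t u + (1 / t) *\<^sub>R heis_op J t v"
    if "u \<in> heis_dom J t" "v \<in> heis_dom J t" for u v
    using that by (simp add: heis_dom_def heis_op_def U_linear pos_op_add scaleR_right_distrib)
  show "(1 / t) *\<^sub>R heis_op J t (cscale c u) = cscale c ((1 / t) *\<^sub>R heis_op J t u)" if "u \<in> heis_dom J t" for u c
    using that by (simp add: heis_dom_def heis_op_def U_cscale pos_op_cscale)
  have "cinner u ((1 / t) *\<^sub>R heis_op J t u) = of_real (\<integral>x. x \<partial>pm t u)" if u: "u \<in> heis_dom J t" for u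
  proof -
    let ?v = "U (- t) u"
    have v: "?v \<in> pos_dom" using u by (simp add: heis_dom_def)
    have "inner (cscale \<i> ?v) (pos_op ?v) = - inner (cscale \<i> ?v) (pos_op ?v)"
      using inner_cscale_i[of ?v "pos_op ?v"] pos_op_symmetric[OF v pos_op_cscale(1)[OF v], of \<i>]
      by (simp add: pos_op_cscale(2)[OF v] inner_commute)
    then have "inner (cscale \<i> u) (U t (pos_op ?v)) = 0"
      using U_adjoint[of "- t" "cscale \<i> u" "pos_op ?v"] by (simp add: U_cscale)
    then show ?thesis
      unfolding pm_second_moment(4)[OF t u] by (simp add: cinner_eq complex_eq_iff heis_op_def)
  qed
  then show "spectral_resolution (heis_dom J t) (\<lambda>u. (1 / t) *\<^sub>R heis_op J t u) (Et t)"
    unfolding spectral_resolution_def spectral_measure_Et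
    using Et_pvm pm_second_moment(1)[OF t] by auto
qed

lemma fun_calc_heis:
  fixes f :: "real \<Rightarrow> real"
  assumes t: "t > 0" and f: "continuous_on UNIV f" and C: "\<And>x. \<bar>f x\<bar> \<le> C"
  shows "fun_calc (heis_dom J t) (\<lambda>u. (1 / t) *\<^sub>R heis_op J t u) f = fc (\<lambda>x. of_real (f x)) t"
proof (rule fun_calc_eq[OF resolved_heis[OF t]])
  have bf: "bounded_by (\<lambda>x. of_real (f x)) C" using C by (simp add: bounded_by_def)
  show "bounded_operator (fc (\<lambda>x. of_real (f x)) t)" by (rule fc_bounded_operator[OF bf])
  show "cinner u (fc (\<lambda>x. of_real (f x)) t u) = of_real (\<integral>x. f x \<partial>spectral_measure (Et t) u)" for u
    unfolding spectral_measure_Et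
    by (simp add: cinner_selfadjoint[OF fc_selfadjoint[OF bf]] pm_bounded(2)[OF borel_measurable_continuous_onI[OF f] C])
qed

subsection \<open>The limiting functional calculus and the spectral resolution of Q\<close>

definition admissible :: "(real \<Rightarrow> real) \<Rightarrow> bool" where
  "admissible f \<longleftrightarrow> continuous_on UNIV f \<and> (\<exists>C. \<forall>x. \<bar>f x\<bar> \<le> C)"

text \<open>A functional calculus available before \<open>Q\<close> has a spectral resolution; it is
  identified with \<open>f(Q)\<close> only at the end.\<close>

definition limcalc :: "(real \<Rightarrow> real) \<Rightarrow> 'm l2 \<Rightarrow> 'm l2" where
  "limcalc f u = Lim at_top (\<lambda>t. fc (\<lambda>x. of_real (f x)) t u)"

lemma limcalc_tendsto:
  assumes "admissible f"
  shows "((\<lambda>t. fc (\<lambda>x. of_real (f x)) t u) \<longlongrightarrow> limcalc f u) at_top"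
proof -
  have "conv (\<lambda>x. of_real (f x))" using assms conv_continuous by (auto simp: admissible_def)
  then obtain L where "((\<lambda>t. fc (\<lambda>x. of_real (f x)) t u) \<longlongrightarrow> L) at_top" unfolding conv_def by blast
  then show ?thesis unfolding limcalc_def by (simp add: tendsto_Lim)
qed

lemma admissible_bounded:
  assumes "admissible f"
  obtains C where "bounded_by (\<lambda>x. of_real (f x)) C" "\<And>x. \<bar>f x\<bar> \<le> C" "f \<in> borel_measurable borel"
  using assms by (auto simp: admissible_def bounded_by_def borel_measurable_continuous_onI)

lemma admissible_mult: "admissible f \<Longrightarrow> admissible g \<Longrightarrow> admissible (\<lambda>x. f x * g x)"
proof -
  assume f: "admissible f" and g: "admissible g"
  obtain C D where C: "\<And>x. \<bar>f x\<bar> \<le> C" "\<And>x. \<bar>g x\<bar> \<le> D" using f g by (auto simp: admissible_def)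
  have "\<bar>f x * g x\<bar> \<le> C * D" for x
    unfolding abs_mult using C order_trans[OF abs_ge_zero C(1)[of x]] by (intro mult_mono) auto
  then show ?thesis using f g by (auto simp: admissible_def intro!: continuous_on_mult)
qed

lemma limcalc_selfadjoint:
  assumes f: "admissible f"
  shows "bounded_selfadjoint (limcalc f)"
proof -
  obtain C where C: "bounded_by (\<lambda>x. of_real (f x)) C" using admissible_bounded[OF f] by metis
  show ?thesis
    by (rule selfadjoint_limit[OF fc_selfadjoint[OF C] norm_fc[OF C] limcalc_tendsto[OF f]]) simp
qed

lemma limcalc_mult:
  assumes f: "admissible f" and g: "admissible g"
  shows "limcalc (\<lambda>x. f x * g x) u = limcalc f (limcalc g u)"
proof -
  obtain C where C: "bounded_by (\<lambda>x. of_real (f x)) C" using admissible_bounded[OF f] by metis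
  obtain D where D: "bounded_by (\<lambda>x. of_real (g x)) D" using admissible_bounded[OF g] by metis
  have "((\<lambda>t. fc (\<lambda>x. of_real (f x)) t (fc (\<lambda>x. of_real (g x)) t u)) \<longlongrightarrow> limcalc f (limcalc g u)) at_top"
    by (rule fc_tendsto_compose[OF C limcalc_tendsto[OF g] limcalc_tendsto[OF f]])
  then have "((\<lambda>t. fc (\<lambda>x. of_real (f x * g x)) t u) \<longlongrightarrow> limcalc f (limcalc g u)) at_top"
    by (simp add: fc_mult[OF C D])
  then show ?thesis
    using limcalc_tendsto[OF admissible_mult[OF f g]] tendsto_unique trivial_limit_at_top_linorder by blast
qed

lemma limcalc_norm:
  assumes f: "admissible f" and C: "\<And>x. \<bar>f x\<bar> \<le> C"
  shows "norm (limcalc f u) \<le> C * norm u"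
  by (rule tendsto_upperbound[OF tendsto_norm[OF limcalc_tendsto[OF f]]])
    (use C in \<open>auto simp: bounded_by_def intro!: norm_fc always_eventually\<close>)

lemma pm_integral_tendsto:
  assumes f: "admissible f"
  shows "((\<lambda>t. \<integral>x. f x \<partial>pm t u) \<longlongrightarrow> inner u (limcalc f u)) at_top"
proof -
  obtain C where C: "\<And>x. \<bar>f x\<bar> \<le> C" "f \<in> borel_measurable borel" using admissible_bounded[OF f] by metis
  show ?thesis unfolding pm_bounded(2)[OF C(2,1)]
    by (intro tendsto_inner tendsto_const limcalc_tendsto f)
qed

text \<open>The tail mass is the squared norm of a spectral projection of \<open>u\<close>; the part
  \<open>v\<close> in the domain is treated by Chebyshev, the rest \<open>u - v\<close> is merely
  projected.\<close>

lemma pm_tail: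
  assumes v: "v \<in> pos_dom" and R: "R > 0" and t: "t > 0"
  shows "measure (pm t u) {x. \<bar>x\<bar> > R} \<le> (norm (u - v) + norm ((1 / t) *\<^sub>R heis_op J t v) / R)\<^sup>2"
proof -
  let ?B = "{x::real. \<bar>x\<bar> > R}"
  interpret form_measure "Et t" "pm t" by (rule form_measure_Et)
  have B: "?B \<in> sets borel" by measurable
  have "(norm (Et t ?B u))\<^sup>2 = inner u (Et t ?B u)" using pvm_form[OF Et_pvm B] by simp
  then have "measure (pm t u) ?B = (norm (Et t ?B u))\<^sup>2" using form[OF B] by simp
  also have "\<dots> \<le> (norm (u - v) + norm ((1 / t) *\<^sub>R heis_op J t v) / R)\<^sup>2"
  proof (rule power_mono)
    have "norm (Et t ?B u) \<le> norm (Et t ?B (u - v)) + norm (Et t ?B v)"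
      using norm_triangle_ineq[of "Et t ?B (u - v)" "Et t ?B v"]
      by (simp add: linear_simps[OF bounded_selfadjointD(2)[OF sa[OF B]]])
    moreover have "norm (Et t ?B (u - v)) \<le> 1 * norm (u - v)"
      unfolding Et_def by (rule norm_fc[OF bounded_by_indicator])
    moreover have "norm (Et t ?B v) \<le> (1 / R) * norm ((1 / t) *\<^sub>R heis_op J t v)"
      unfolding Et_def by (rule fc_tail_bound[OF bounded_by_indicator _ _ v t]) (use R in \<open>auto simp: indicator_def field_simps\<close>)
    ultimately show "norm (Et t ?B u) \<le> norm (u - v) + norm ((1 / t) *\<^sub>R heis_op J t v) / R" by (simp add: mult.commute)
  qed simp
  finally show ?thesis .
qed

text \<open>Tightness gives a weak limit along a subsequence of integer times, and this is enough
  because integrals of admissible functions already converge as \<open>t\<close> tends to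
  infinity.\<close>

lemma pm_limit_exists:
  assumes u: "norm u = 1"
  shows "\<exists>M. real_distribution M \<and> (\<forall>f. admissible f \<longrightarrow> (\<integral>x. f x \<partial>M) = inner u (limcalc f u))"
proof -
  define \<mu> where "\<mu> n = pm (real (Suc n)) u" for n
  have form: "form_measure (Et t) (pm t)" for t by (rule form_measure_Et)
  have rd: "real_distribution (\<mu> n)" for n
  proof -
    have "emeasure (\<mu> n) (space (\<mu> n)) = 1"
      using form_measure.total[OF form, of "real (Suc n)" u] form_measure.space_M[OF form, of "real (Suc n)" u]
        finite_measure.emeasure_eq_measure[OF finite_measure_pm] u by (simp add: \<mu>_def)
    then show ?thesis
      by (intro real_distribution.intro prob_spaceI real_distribution_axioms.intro)
        (simp_all add: \<mu>_def sets_pm form_measure.space_M[OF form])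
  qed
  have "tight \<mu>"
    unfolding tight_def
  proof (intro conjI allI impI)
    fix \<epsilon> :: real assume \<epsilon>: "\<epsilon> > 0"
    \<comment> \<open>Two contributions of at most \<open>d\<close> give
      \<open>(d + d)\<^sup>2 = 4 * \<epsilon> / 9 < \<epsilon>\<close>.\<close>
    define d where "d = sqrt \<epsilon> / 3"
    have d: "d > 0" using \<epsilon> by (simp add: d_def)
    obtain v where v: "v \<in> pos_dom" "norm (v - u) < d" using pos_dom_approx[OF d] by blast
    obtain K where K: "\<And>t u. u \<in> pos_dom \<Longrightarrow> t \<ge> 1 \<Longrightarrow> norm ((1 / t) *\<^sub>R heis_op J t u) \<le> norm (pos_op u) + K * norm u"
      using heis_bound by metis
    define B where "B = \<bar>norm (pos_op v) + K * norm v\<bar>"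
    define R where "R = B / d + 1"
    have R: "R > 0" "B / R \<le> d" using d by (auto simp: R_def B_def field_simps add_nonneg_pos)
    \<comment> \<open>The left end is \<open>- R - 1\<close> because the half-open interval has to
      contain \<open>- R\<close>.\<close>
    have "measure (\<mu> n) {- R - 1<..R} > 1 - \<epsilon>" for n
    proof -
      let ?t = "real (Suc n)"
      interpret real_distribution "\<mu> n" by (rule rd)
      have "measure (\<mu> n) {x. \<bar>x\<bar> > R} \<le> (norm (u - v) + norm ((1 / ?t) *\<^sub>R heis_op J ?t v) / R)\<^sup>2"
        unfolding \<mu>_def by (rule pm_tail[OF v(1) R(1)]) simp
      also have "\<dots> \<le> (d + d)\<^sup>2"
      proof (intro power_mono add_mono)
        have "norm ((1 / ?t) *\<^sub>R heis_op J ?t v) / R \<le> B / R"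
          using K[OF v(1), of ?t] R(1) by (intro divide_right_mono) (auto simp: B_def)
        then show "norm ((1 / ?t) *\<^sub>R heis_op J ?t v) / R \<le> d" using R(2) by simp
      qed (use v(2) R in \<open>auto simp: norm_minus_commute\<close>)
      also have "\<dots> = 4 * \<epsilon> / 9" using \<epsilon> by (simp add: d_def power_divide)
      also have "\<dots> < \<epsilon>" using \<epsilon> by simp
      finally have tail: "measure (\<mu> n) {x. \<bar>x\<bar> > R} < \<epsilon>" .
      have "1 = prob (UNIV :: real set)" using prob_space by (simp add: space_eq_univ)
      also have "\<dots> \<le> prob ({- R - 1<..R} \<union> {x. \<bar>x\<bar> > R})"
        by (intro finite_measure_mono) (auto simp: events_eq_borel)
      also have "\<dots> \<le> prob {- R - 1<..R} + prob {x. \<bar>x\<bar> > R}"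
        by (intro measure_Un_le) (auto simp: events_eq_borel)
      finally show ?thesis using tail by simp
    qed
    then show "\<exists>a b. a < b \<and> (\<forall>n. measure (\<mu> n) {a<..b} > 1 - \<epsilon>)"
      using R(1) by (intro exI[of _ "- R - 1"] exI[of _ R]) auto
  qed (rule rd)
  from tight_imp_convergent_subsubsequence[OF this strict_mono_id]
  obtain r M where r: "strict_mono (r :: nat \<Rightarrow> nat)" and M: "real_distribution M" "weak_conv_m (\<mu> \<circ> id \<circ> r) M" by blast
  have "(\<integral>x. f x \<partial>M) = inner u (limcalc f u)" if f: "admissible f" for f
  proof -
    obtain C where C: "\<And>x. \<bar>f x\<bar> \<le> C" using admissible_bounded[OF f] by metis
    have "(\<lambda>n. \<integral>x. f x \<partial>(\<mu> \<circ> id \<circ> r) n) \<longlonglongrightarrow> (\<integral>x. f x \<partial>M)"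
      by (rule weak_conv_imp_integral_bdd_continuous_conv[OF _ M])
        (use rd f C in \<open>auto simp: admissible_def continuous_on_eq_continuous_at\<close>)
    moreover have "(\<lambda>n. \<integral>x. f x \<partial>(\<mu> \<circ> id \<circ> r) n) \<longlonglongrightarrow> inner u (limcalc f u)"
    proof -
      have "filterlim (\<lambda>n. real (Suc (r n))) at_top sequentially"
        by (intro filterlim_compose[OF filterlim_real_sequentially] filterlim_compose[OF filterlim_Suc] filterlim_subseq r)
      from filterlim_compose[OF pm_integral_tendsto[OF f] this] show ?thesis by (simp add: \<mu>_def)
    qed
    ultimately show ?thesis by (rule LIMSEQ_unique)
  qed
  then show ?thesis using M(1) by blast
qed

lemma limit_measures:
  obtains N where "\<And>u. finite_measure (N u)" "\<And>u. sets (N u) = sets borel" "\<And>u. measure (N u) UNIV = (norm u)\<^sup>2"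
    "\<And>u f. admissible f \<Longrightarrow> (\<integral>x. f x \<partial>N u) = inner u (limcalc f u)"
proof -
  have "\<exists>M. real_distribution M \<and> (\<forall>f. admissible f \<longrightarrow> (norm u)\<^sup>2 * (\<integral>x. f x \<partial>M) = inner u (limcalc f u))" for u
  proof (cases "u = 0")
    case True
    \<comment> \<open>For \<open>u = 0\<close> the factor \<open>(norm u)\<^sup>2\<close> vanishes,
      so any probability measure serves.\<close>
    have "real_distribution (return borel (0::real))"
      by (intro real_distribution.intro real_distribution_axioms.intro prob_space_return) auto
    then show ?thesis using True by (intro exI[of _ "return borel 0"]) simp
  next
    case False
    define v where "v = (1 / norm u) *\<^sub>R u"
    have v: "norm v = 1" "u = norm u *\<^sub>R v" using False by (simp_all add: v_def)
    obtain M where M: "real_distribution M" "\<And>f. admissible f \<Longrightarrow> (\<integral>x. f x \<partial>M) = inner v (limcalc f v)"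
      using pm_limit_exists[OF v(1)] by blast
    have "(norm u)\<^sup>2 * (\<integral>x. f x \<partial>M) = inner u (limcalc f u)" if f: "admissible f" for f
      by (subst (2 3) v(2)) (simp add: M(2)[OF f] linear_simps[OF bounded_selfadjointD(2)[OF limcalc_selfadjoint[OF f]]] power2_eq_square)
    then show ?thesis using M(1) by blast
  qed
  then obtain M where M: "\<And>u. real_distribution (M u)"
    "\<And>u f. admissible f \<Longrightarrow> (norm u)\<^sup>2 * (\<integral>x. f x \<partial>M u) = inner u (limcalc f u)" by metis
  define N where "N u = density (M u) (\<lambda>_. ennreal ((norm u)\<^sup>2))" for u
  have sets_MN: "sets (M u) = sets borel" "space (M u) = UNIV" for u
    using real_distribution.events_eq_borel[OF M(1)] real_distribution.space_eq_univ[OF M(1)] by auto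
  have em: "emeasure (N u) UNIV = ennreal ((norm u)\<^sup>2)" for u
  proof -
    interpret real_distribution "M u" by (rule M)
    show ?thesis using emeasure_space_1 sets_MN[of u] by (simp add: N_def emeasure_density)
  qed
  show ?thesis
  proof (rule that[of N])
    show "finite_measure (N u)" for u by (rule finite_measureI) (use em sets_MN in \<open>simp add: N_def\<close>)
    show "sets (N u) = sets borel" for u by (simp add: N_def sets_MN)
    show "measure (N u) UNIV = (norm u)\<^sup>2" for u by (simp add: measure_def em)
    show "(\<integral>x. f x \<partial>N u) = inner u (limcalc f u)" if f: "admissible f" for u f
    proof -
      have "f \<in> borel_measurable (M u)"
        using admissible_bounded[OF f] measurable_cong_sets[OF sets_MN(1) refl] by metis
      then show ?thesis using M(2)[OF f, of u] by (simp add: N_def integral_density)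
    qed
  qed
qed

end

text \<open>Continuous functions increasing to the indicator of the open ray; they vanish at
  \<open>x\<close>, so the limit is the open ray and not the closed one.\<close>

definition ramp :: "real \<Rightarrow> nat \<Rightarrow> real \<Rightarrow> real" where "ramp x k y = min 1 (max 0 (real k * (y - x)))"

lemma ramp_bounds: "0 \<le> ramp x k y" "ramp x k y \<le> 1" "ramp x k y \<le> ramp x (Suc k) y"
proof -
  show "ramp x k y \<le> ramp x (Suc k) y"
  proof (cases "y \<ge> x")
    case True
    then have "real k * (y - x) \<le> real (Suc k) * (y - x)" by (intro mult_right_mono) auto
    then show ?thesis by (auto simp: ramp_def)
  next
    case False
    then have "real k * (y - x) \<le> 0" by (simp add: mult_nonneg_nonpos)
    then show ?thesis by (auto simp: ramp_def)
  qed
qed (auto simp: ramp_def)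

lemma ramp_tendsto: "(\<lambda>k. ramp x k y) \<longlonglongrightarrow> indicator {x<..} y"
proof (cases "y > x")
  case True
  obtain n :: nat where n: "1 < real n * (y - x)" using reals_Archimedean3[of "y - x"] True by auto
  have "ramp x k y = 1" if "k \<ge> n" for k
  proof -
    have "real n * (y - x) \<le> real k * (y - x)" using that True by (intro mult_right_mono) auto
    then show ?thesis using n by (simp add: ramp_def)
  qed
  then have "\<forall>\<^sub>F k in sequentially. ramp x k y = indicator {x<..} y"
    using True by (auto simp: eventually_sequentially)
  then show ?thesis by (rule tendsto_eventually)
next
  case False
  then have "ramp x k y = indicator {x<..} y" for k by (simp add: ramp_def mult_nonneg_nonpos)
  then show ?thesis by simp
qed

context periodic_jacobi
begin

lemma admissible_ramp: "admissible (ramp x k)"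
  unfolding admissible_def
proof (intro conjI exI[of _ 1] allI)
  show "continuous_on UNIV (ramp x k)" unfolding ramp_def by (intro continuous_intros)
  show "\<bar>ramp x k y\<bar> \<le> 1" for y using ramp_bounds(1,2)[of x k y] by simp
qed

lemma form_le_dense:
  assumes T: "bounded_linear T" and le: "\<And>u. u \<in> pos_dom \<Longrightarrow> inner u (T u) \<le> c * (norm u)\<^sup>2"
  shows "inner u (T u) \<le> c * (norm u)\<^sup>2"
proof -
  have "\<forall>n. \<exists>v. v \<in> pos_dom \<and> norm (v - u) < 1 / real (Suc n)"
    using pos_dom_approx[of "1 / real (Suc n)" u for n] by (metis of_nat_0_less_iff zero_less_Suc zero_less_divide_1_iff)
  then obtain v where v: "\<And>n. v n \<in> pos_dom" "\<And>n. norm (v n - u) < 1 / real (Suc n)" by metis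
  have lim: "v \<longlonglongrightarrow> u"
  proof (rule LIM_zero_cancel, rule Lim_null_comparison)
    show "\<forall>\<^sub>F n in sequentially. norm (v n - u) \<le> 1 / real (Suc n)" using v(2) by (simp add: less_imp_le)
    show "(\<lambda>n. 1 / real (Suc n)) \<longlonglongrightarrow> 0" using LIMSEQ_inverse_real_of_nat by (simp add: inverse_eq_divide)
  qed
  show ?thesis
  proof (rule LIMSEQ_le)
    show "(\<lambda>n. inner (v n) (T (v n))) \<longlonglongrightarrow> inner u (T u)"
      by (intro tendsto_inner lim bounded_linear.tendsto[OF T])
    show "(\<lambda>n. c * (norm (v n))\<^sup>2) \<longlonglongrightarrow> c * (norm u)\<^sup>2" by (intro tendsto_intros lim)
  qed (use le v(1) in blast)
qed

text \<open>Projections onto rays are monotone limits of \<open>limcalc\<close> of ramps and inherit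
  its multiplicativity. Weak convergence controls bounded functions only, so \<open>x\<close> and
  \<open>x\<^sup>2\<close> are reached by truncation, using convergence of second moments on the
  domain of position.\<close>

lemma Q_resolution:
  obtains E where "resolved_operator UNIV Q E"
    "\<And>f u. admissible f \<Longrightarrow> (\<integral>x. f x \<partial>spectral_measure E u) = inner u (limcalc f u)"
proof -
  obtain N where N: "\<And>u. finite_measure (N u)" "\<And>u. sets (N u) = sets borel" "\<And>u. measure (N u) UNIV = (norm u)\<^sup>2"
    and NI: "\<And>u f. admissible f \<Longrightarrow> (\<integral>x. f x \<partial>N u) = inner u (limcalc f u)"
    using limit_measures by blast
  have spN: "space (N u) = UNIV" for u using sets_eq_imp_space_eq[OF N(2)] by simp
  have meas: "f \<in> borel_measurable (N u)" if "f \<in> borel_measurable borel" for f :: "real \<Rightarrow> real" and u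
    using that measurable_cong_sets[OF N(2) refl] by blast
  have adm_meas: "f \<in> borel_measurable (N u)" if "admissible f" for f u
    using admissible_bounded[OF that] meas by metis
  have int: "integrable (N u) f" if f: "admissible f" for f u
  proof -
    obtain C where "\<And>x. \<bar>f x\<bar> \<le> C" using admissible_bounded[OF f] by metis
    then show ?thesis by (intro finite_measure.integrable_const_bound[OF N(1), of _ C] adm_meas[OF f]) auto
  qed
  define T where "T x k = limcalc (ramp x k)" for x k
  have T: "bounded_selfadjoint (T x k)" for x k unfolding T_def by (rule limcalc_selfadjoint[OF admissible_ramp])
  have Tform: "inner u (T x k u) = (\<integral>y. ramp x k y \<partial>N u)" for x k u
    unfolding T_def by (rule NI[OF admissible_ramp, symmetric])
  have Tnorm: "norm (T x k u) \<le> 1 * norm u" for x k u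
    unfolding T_def using ramp_bounds(1,2) by (intro limcalc_norm admissible_ramp) (simp add: abs_le_iff order_trans[OF _ ramp_bounds(1)])
  have "\<exists>L. bounded_selfadjoint L \<and> (\<forall>u. (\<lambda>k. T x k u) \<longlonglongrightarrow> L u)" for x
  proof -
    obtain L where "bounded_selfadjoint L" "\<And>u. (\<lambda>k. T x k u) \<longlonglongrightarrow> L u"
    proof (rule increasing_selfadjoint_limit[of "T x", OF T])
      show "incseq (\<lambda>k. inner u (T x k u))" for u
        unfolding Tform by (intro incseq_SucI integral_mono int admissible_ramp ramp_bounds)
      show "0 \<le> inner u (T x k u)" for k u
        unfolding Tform by (intro Bochner_Integration.integral_nonneg ramp_bounds)
      show "inner u (T x k u) \<le> (norm u)\<^sup>2" for k u
      proof -
        have "(\<integral>y. ramp x k y \<partial>N u) \<le> (\<integral>y. 1 \<partial>N u)"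
          by (intro integral_mono int admissible_ramp ramp_bounds finite_measure.integrable_const[OF N(1)])
        then show ?thesis unfolding Tform by (simp add: N(3) spN)
      qed
    qed blast
    then show ?thesis by blast
  qed
  then obtain L where L: "\<And>x. bounded_selfadjoint (L x)" "\<And>x u. (\<lambda>k. T x k u) \<longlonglongrightarrow> L x u" by metis
  \<comment> \<open>Products of two ramps approximate the intersection of the rays; this value
    identifies the form of the product of the projections.\<close>
  have lim2: "(\<lambda>k. \<integral>z. ramp x k z * ramp y k z \<partial>N u) \<longlonglongrightarrow> measure (N u) ({x<..} \<inter> {y<..})" for x y u
  proof -
    have "(\<lambda>k. \<integral>z. ramp x k z * ramp y k z \<partial>N u) \<longlonglongrightarrow> (\<integral>z. indicator {x<..} z * indicator {y<..} z \<partial>N u)"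
    proof (rule integral_dominated_convergence[where w = "\<lambda>_. 1"])
      show "AE z in N u. norm (ramp x k z * ramp y k z) \<le> 1" for k
        using ramp_bounds(1,2) by (auto simp: abs_mult intro!: mult_le_one)
      show "AE z in N u. (\<lambda>k. ramp x k z * ramp y k z) \<longlonglongrightarrow> indicator {x<..} z * indicator {y<..} z"
        by (intro AE_I2 tendsto_mult ramp_tendsto)
      show "(\<lambda>z. ramp x k z * ramp y k z) \<in> borel_measurable (N u)" for k
        by (intro borel_measurable_times adm_meas admissible_ramp)
      show "(\<lambda>z. indicator {x<..} z * indicator {y<..} z :: real) \<in> borel_measurable (N u)"
        by (rule meas) simp
    qed (rule finite_measure.integrable_const[OF N(1)])
    moreover have "(\<integral>z. indicat_real {x<..} z * indicat_real {y<..} z \<partial>N u) = (\<integral>z. indicat_real ({x<..} \<inter> {y<..}) z \<partial>N u)"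
      by (intro Bochner_Integration.integral_cong) (auto simp: indicator_def)
    ultimately show ?thesis by (simp add: spN)
  qed
  have lim1: "(\<lambda>k. \<integral>z. ramp x k z \<partial>N u) \<longlonglongrightarrow> measure (N u) {x<..}" for x u
  proof -
    have "(\<lambda>k. \<integral>z. ramp x k z \<partial>N u) \<longlonglongrightarrow> (\<integral>z. indicator {x<..} z \<partial>N u)"
    proof (rule integral_dominated_convergence[where w = "\<lambda>_. 1"])
      show "AE z in N u. norm (ramp x k z) \<le> 1" for k using ramp_bounds(1,2) by auto
      show "AE z in N u. (\<lambda>k. ramp x k z) \<longlonglongrightarrow> indicator {x<..} z" by (intro AE_I2 ramp_tendsto)
      show "indicat_real {x<..} \<in> borel_measurable (N u)" by (rule meas) simp
    qed (auto intro: adm_meas admissible_ramp finite_measure.integrable_const[OF N(1)])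
    then show ?thesis by (simp add: spN)
  qed
  have Lform: "inner u (L x u) = measure (N u) {x<..}" for x u
    using tendsto_inner[OF tendsto_const[of u] L(2)[of x u]] lim1[where x = x and u = u] LIMSEQ_unique unfolding Tform by blast
  obtain E where E: "form_measure E N"
    using form_measure_from_rays[of N] N L(1) Lform by metis
  interpret form_measure E N by (rule E)
  have EL: "E {x<..} u = L x u" for x u by (rule eqI) (auto simp: L Lform)
  have base: "E ({x<..} \<inter> {y<..}) u = E {x<..} (E {y<..} u)" for x y u
  proof (rule eqI)
    have adm: "admissible (\<lambda>z. ramp x k z * ramp y k z)" for k by (intro admissible_mult admissible_ramp)
    \<comment> \<open>Both factors vary with \<open>k\<close>; the inner one may be replaced by its
      limit because all \<open>T x k\<close> are contractions.\<close>
    have TT: "(\<lambda>k. limcalc (\<lambda>z. ramp x k z * ramp y k z) v) \<longlonglongrightarrow> E {x<..} (E {y<..} v)" for v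
    proof -
      have "(\<lambda>k. T x k (T y k v) - T x k (L y v)) \<longlonglongrightarrow> 0"
      proof (rule Lim_null_comparison)
        show "\<forall>\<^sub>F k in sequentially. norm (T x k (T y k v) - T x k (L y v)) \<le> norm (T y k v - L y v)"
          using Tnorm[of x _ "T y _ v - L y v"] by (intro always_eventually allI)
            (simp flip: linear_simps(2)[OF bounded_selfadjointD(2)[OF T]])
        show "(\<lambda>k. norm (T y k v - L y v)) \<longlonglongrightarrow> 0"
          by (rule tendsto_norm_zero) (rule LIM_zero[OF L(2)])
      qed
      from tendsto_add[OF this L(2)[of x "L y v"]] show ?thesis
        unfolding EL limcalc_mult[OF admissible_ramp admissible_ramp] by (simp add: T_def)
    qed
    show "bounded_selfadjoint (\<lambda>v. E {x<..} (E {y<..} v))"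
    proof (rule selfadjoint_limit[OF limcalc_selfadjoint[OF adm] _ TT])
      show "norm (limcalc (\<lambda>z. ramp x k z * ramp y k z) v) \<le> 1 * norm v" for k v
        using ramp_bounds(1,2) by (intro limcalc_norm[OF adm]) (auto simp: abs_mult intro!: mult_le_one)
    qed simp
    show "inner v (E {x<..} (E {y<..} v)) = measure (N v) ({x<..} \<inter> {y<..})" for v
      using tendsto_inner[OF tendsto_const[of v] TT[of v]] lim2[where x = x and y = y and u = v] LIMSEQ_unique
      unfolding NI[OF adm, symmetric] by blast
  qed simp
  have pvm: "projection_valued_measure E"
    by (rule projection_valued_measureI[OF mult_from_rays[OF base]])
  obtain K where K: "K > 0" "\<And>u. norm (Q u) \<le> K * norm u" using Q_bound by metis
  have Q2: "(norm (Q u))\<^sup>2 \<le> K\<^sup>2 * (norm u)\<^sup>2" for u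
    using power_mono[OF K(2)[of u] norm_ge_zero, of 2] by (simp add: power_mult_distrib)
  have hd: "u \<in> heis_dom J t" if "u \<in> pos_dom" for u t using U_pos_dom[OF that] by (simp add: heis_dom_def)
  have A2: "((\<lambda>t. (norm ((1 / t) *\<^sub>R heis_op J t u))\<^sup>2) \<longlongrightarrow> (norm (Q u))\<^sup>2) at_top" if "u \<in> pos_dom" for u
    by (intro tendsto_power tendsto_norm heis_Q that)
  \<comment> \<open>On the domain of position the second moments of \<open>X(t)/t\<close> tend to
    \<open>(norm (Q u))\<^sup>2\<close>, which bounds every admissible function below the square;
    density removes the restriction on \<open>u\<close>.\<close>
  have moment: "inner u (limcalc g u) \<le> K\<^sup>2 * (norm u)\<^sup>2" if g: "admissible g" "\<And>x. g x \<le> x\<^sup>2" for g u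
  proof (rule form_le_dense[OF bounded_selfadjointD(2)[OF limcalc_selfadjoint[OF g(1)]]])
    fix u :: "'m l2" assume u: "u \<in> pos_dom"
    obtain C where C: "\<And>x. \<bar>g x\<bar> \<le> C" "g \<in> borel_measurable borel" using admissible_bounded[OF g(1)] by metis
    have "inner u (limcalc g u) \<le> (norm (Q u))\<^sup>2"
    proof (rule tendsto_le[OF _ A2[OF u] pm_integral_tendsto[OF g(1)]])
      show "\<forall>\<^sub>F t in at_top. (\<integral>x. g x \<partial>pm t u) \<le> (norm ((1 / t) *\<^sub>R heis_op J t u))\<^sup>2"
        using eventually_gt_at_top[of 0]
      proof eventually_elim
        case (elim t)
        show ?case unfolding pm_second_moment(3)[OF elim hd[OF u], symmetric]
          by (intro integral_mono pm_bounded(1)[OF C(2,1)] pm_second_moment(2)[OF elim hd[OF u]] g(2))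
      qed
    qed simp
    then show "inner u (limcalc g u) \<le> K\<^sup>2 * (norm u)\<^sup>2" using Q2[of u] by simp
  qed
  have second: "(\<integral>\<^sup>+x. ennreal (x\<^sup>2) \<partial>N u) \<le> ennreal (K\<^sup>2 * (norm u)\<^sup>2)" for u
  proof -
    define c where "c n x = min (x\<^sup>2) (real n)" for n :: nat and x :: real
    have adm: "admissible (c n)" for n
      unfolding admissible_def c_def by (intro conjI exI[of _ "real n"] allI continuous_intros) (auto simp: min_def)
    have "(\<lambda>n. \<integral>\<^sup>+x. ennreal (c n x) \<partial>N u) \<longlonglongrightarrow> (\<integral>\<^sup>+x. ennreal (x\<^sup>2) \<partial>N u)"
    proof (rule nn_integral_LIMSEQ)
      show "incseq (\<lambda>n x. ennreal (c n x))"
        by (auto simp: incseq_def le_fun_def c_def intro!: ennreal_leI)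
      show "(\<lambda>x. ennreal (c n x)) \<in> borel_measurable (N u)" for n
        using adm_meas[OF adm] by simp
      show "(\<lambda>n. ennreal (c n x)) \<longlonglongrightarrow> ennreal (x\<^sup>2)" for x
      proof -
        obtain n0 :: nat where n0: "x\<^sup>2 \<le> real n0" using real_arch_simple by blast
        have "c n x = x\<^sup>2" if "n \<ge> n0" for n using that n0 by (simp add: c_def)
        then have "\<forall>\<^sub>F n in sequentially. ennreal (c n x) = ennreal (x\<^sup>2)" by (intro eventually_sequentiallyI[of n0]) simp
        then show ?thesis by (rule tendsto_eventually)
      qed
    qed
    moreover have "(\<integral>\<^sup>+x. ennreal (c n x) \<partial>N u) \<le> ennreal (K\<^sup>2 * (norm u)\<^sup>2)" for n
    proof -
      have "(\<integral>\<^sup>+x. ennreal (c n x) \<partial>N u) = ennreal (\<integral>x. c n x \<partial>N u)"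
        by (rule nn_integral_eq_integral[OF int[OF adm]]) (simp add: c_def)
      also have "(\<integral>x. c n x \<partial>N u) \<le> K\<^sup>2 * (norm u)\<^sup>2"
        unfolding NI[OF adm] by (rule moment[OF adm]) (simp add: c_def)
      finally show ?thesis by (simp add: ennreal_leI)
    qed
    ultimately show ?thesis by (intro LIMSEQ_le_const2) auto
  qed
  have int2: "integrable (N u) (\<lambda>x. x\<^sup>2)" for u
    by (rule integrableI_nonneg[OF meas _ le_less_trans[OF second]]) auto
  have int1: "integrable (N u) (\<lambda>x. x)" for u
  proof (rule Bochner_Integration.integrable_bound)
    show "integrable (N u) (\<lambda>x. 1 + x\<^sup>2)"
      by (intro Bochner_Integration.integrable_add int2 finite_measure.integrable_const[OF N(1)])
    show "AE x in N u. norm x \<le> norm (1 + x\<^sup>2)"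
    proof (intro AE_I2)
      fix x :: real
      have "0 \<le> (\<bar>x\<bar> - 1)\<^sup>2 + \<bar>x\<bar>" by simp
      then show "norm x \<le> norm (1 + x\<^sup>2)" by (simp add: power2_diff)
    qed
  qed (rule meas, simp)
  \<comment> \<open>Truncation at height \<open>n + 1\<close>, never 0; the error is at most
    \<open>x\<^sup>2 / (n + 1)\<close>, which second moments control.\<close>
  define cl where "cl n x = max (- real (Suc n)) (min (real (Suc n)) x)" for n :: nat and x :: real
  have cl_adm: "admissible (cl n)" for n
    unfolding admissible_def cl_def by (intro conjI exI[of _ "real (Suc n)"] allI continuous_intros) auto
  have cl_diff: "\<bar>x - cl n x\<bar> \<le> x\<^sup>2 / real (Suc n)" for n x
  proof -
    have "\<bar>x - cl n x\<bar> * real (Suc n) \<le> x\<^sup>2"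
    proof (cases "\<bar>x\<bar> \<le> real (Suc n)")
      case True then show ?thesis by (auto simp: cl_def abs_le_iff max_def min_def)
    next
      case False
      have "\<bar>x - cl n x\<bar> * real (Suc n) \<le> \<bar>x\<bar> * \<bar>x\<bar>"
        using False by (intro mult_mono) (auto simp: cl_def max_def min_def abs_if)
      then show ?thesis by (simp add: power2_eq_square)
    qed
    then show ?thesis by (simp add: pos_le_divide_eq)
  qed
  \<comment> \<open>At finite \<open>t\<close> the first moment is the form of
    \<open>X(t)/t\<close>. First \<open>t\<close> tends to infinity with \<open>n\<close> fixed,
    then density extends the estimate to all \<open>u\<close>.\<close>
  have approx: "\<bar>inner u (Q u) - (\<integral>x. cl n x \<partial>N u)\<bar> \<le> K\<^sup>2 / real (Suc n) * (norm u)\<^sup>2" for u n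
  proof -
    obtain C where C: "\<And>x. \<bar>cl n x\<bar> \<le> C" "cl n \<in> borel_measurable borel" using admissible_bounded[OF cl_adm] by metis
    have dense: "\<bar>inner u (Q u) - inner u (limcalc (cl n) u)\<bar> \<le> K\<^sup>2 / real (Suc n) * (norm u)\<^sup>2" if u: "u \<in> pos_dom" for u
    proof -
      have "\<bar>inner u (Q u) - inner u (limcalc (cl n) u)\<bar> \<le> (norm (Q u))\<^sup>2 / real (Suc n)"
      proof (rule tendsto_le[OF _ tendsto_divide[OF A2[OF u] tendsto_const]])
        show "((\<lambda>t. \<bar>inner u ((1 / t) *\<^sub>R heis_op J t u) - (\<integral>x. cl n x \<partial>pm t u)\<bar>) \<longlongrightarrow> \<bar>inner u (Q u) - inner u (limcalc (cl n) u)\<bar>) at_top"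
          by (intro tendsto_rabs tendsto_diff tendsto_inner tendsto_const heis_Q u pm_integral_tendsto cl_adm)
        show "\<forall>\<^sub>F t in at_top. \<bar>inner u ((1 / t) *\<^sub>R heis_op J t u) - (\<integral>x. cl n x \<partial>pm t u)\<bar> \<le> (norm ((1 / t) *\<^sub>R heis_op J t u))\<^sup>2 / real (Suc n)"
          using eventually_gt_at_top[of 0]
        proof eventually_elim
          case (elim t)
          note m = pm_second_moment(2-4)[OF elim hd[OF u]]
          have i1: "integrable (pm t u) (\<lambda>x. x)"
          proof (rule Bochner_Integration.integrable_bound)
            show "integrable (pm t u) (\<lambda>x. 1 + x\<^sup>2)"
              by (intro Bochner_Integration.integrable_add m(1) finite_measure.integrable_const[OF finite_measure_pm])
            show "AE x in pm t u. norm x \<le> norm (1 + x\<^sup>2)"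
            proof (intro AE_I2)
              fix x :: real
              have "0 \<le> (\<bar>x\<bar> - 1)\<^sup>2 + \<bar>x\<bar>" by simp
              then show "norm x \<le> norm (1 + x\<^sup>2)" by (simp add: power2_diff)
            qed
          qed simp
          have i2: "integrable (pm t u) (cl n)" by (rule pm_bounded(1)[OF C(2,1)])
          have "\<bar>(\<integral>x. x \<partial>pm t u) - (\<integral>x. cl n x \<partial>pm t u)\<bar> = \<bar>\<integral>x. x - cl n x \<partial>pm t u\<bar>"
            using i1 i2 by simp
          also have "\<dots> \<le> (\<integral>x. \<bar>x - cl n x\<bar> \<partial>pm t u)" by (rule integral_abs_bound)
          also have "\<dots> \<le> (\<integral>x. x\<^sup>2 / real (Suc n) \<partial>pm t u)"
            by (intro integral_mono integrable_abs Bochner_Integration.integrable_diff i1 i2 integrable_divide m(1) cl_diff)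
          also have "\<dots> = (\<integral>x. x\<^sup>2 \<partial>pm t u) / real (Suc n)" by simp
          finally show ?case unfolding m(2,3) .
        qed
      qed auto
      also have "\<dots> \<le> (K\<^sup>2 * (norm u)\<^sup>2) / real (Suc n)" by (intro divide_right_mono Q2) simp
      finally show ?thesis by simp
    qed
    note sa' = selfadjoint_combination(2)[OF Q_selfadjoint limcalc_selfadjoint[OF cl_adm[of n]]]
      selfadjoint_combination(2)[OF limcalc_selfadjoint[OF cl_adm[of n]] Q_selfadjoint]
    have "inner u (Q u - limcalc (cl n) u) \<le> K\<^sup>2 / real (Suc n) * (norm u)\<^sup>2"
      by (rule form_le_dense[OF bounded_selfadjointD(2)[OF sa'(1)]]) (use dense in \<open>auto simp: inner_diff_right abs_le_iff\<close>)
    moreover have "inner u (limcalc (cl n) u - Q u) \<le> K\<^sup>2 / real (Suc n) * (norm u)\<^sup>2"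
      by (rule form_le_dense[OF bounded_selfadjointD(2)[OF sa'(2)]]) (use dense in \<open>auto simp: inner_diff_right abs_le_iff\<close>)
    ultimately show ?thesis unfolding NI[OF cl_adm] inner_diff_right abs_le_iff by linarith
  qed
  have first: "inner u (Q u) = (\<integral>x. x \<partial>N u)" for u
  proof -
    have "(\<lambda>n. \<integral>x. cl n x \<partial>N u) \<longlonglongrightarrow> (\<integral>x. x \<partial>N u)"
    proof (rule integral_dominated_convergence[where w = "\<lambda>x. \<bar>x\<bar>"])
      show "integrable (N u) (\<lambda>x. \<bar>x\<bar>)" by (intro integrable_abs int1)
      show "AE x in N u. norm (cl n x) \<le> \<bar>x\<bar>" for n
        by (intro AE_I2) (auto simp: cl_def max_def min_def abs_if)
      show "AE x in N u. (\<lambda>n. cl n x) \<longlonglongrightarrow> x"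
      proof (intro AE_I2)
        fix x
        have "(\<lambda>n. x - cl n x) \<longlonglongrightarrow> 0"
        proof (rule Lim_null_comparison)
          show "\<forall>\<^sub>F n in sequentially. norm (x - cl n x) \<le> x\<^sup>2 / real (Suc n)" using cl_diff by simp
          show "(\<lambda>n. x\<^sup>2 / real (Suc n)) \<longlonglongrightarrow> 0" by (rule LIMSEQ_Suc[OF lim_const_over_n])
        qed
        from tendsto_diff[OF tendsto_const[of x] this] show "(\<lambda>n. cl n x) \<longlonglongrightarrow> x" by simp
      qed
    qed (auto intro: adm_meas cl_adm meas)
    moreover have "(\<lambda>n. \<integral>x. cl n x \<partial>N u) \<longlonglongrightarrow> inner u (Q u)"
    proof -
      have "(\<lambda>n. inner u (Q u) - (\<integral>x. cl n x \<partial>N u)) \<longlonglongrightarrow> 0"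
      proof (rule Lim_null_comparison)
        show "\<forall>\<^sub>F n in sequentially. norm (inner u (Q u) - (\<integral>x. cl n x \<partial>N u)) \<le> (K\<^sup>2 * (norm u)\<^sup>2) / real (Suc n)"
          using approx by simp
        show "(\<lambda>n. (K\<^sup>2 * (norm u)\<^sup>2) / real (Suc n)) \<longlonglongrightarrow> 0" by (rule LIMSEQ_Suc[OF lim_const_over_n])
      qed
      from tendsto_diff[OF tendsto_const[of "inner u (Q u)"] this] show ?thesis by simp
    qed
    ultimately show ?thesis by (rule LIMSEQ_unique[rotated])
  qed
  show ?thesis
  proof (rule that[of E])
    show "resolved_operator UNIV Q E"
    proof (intro resolved_operator.intro symmetric_domain.intro resolved_operator_axioms.intro)
      show "spectral_resolution UNIV Q E"
        unfolding spectral_resolution_def spectral_measure_eq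
        using pvm second by (auto simp: cinner_selfadjoint[OF Q_selfadjoint] first intro: le_less_trans[OF second])
    qed (auto simp: linear_simps[OF linear_Q] bounded_selfadjointD(3)[OF Q_selfadjoint])
    show "(\<integral>x. f x \<partial>spectral_measure E u) = inner u (limcalc f u)" if "admissible f" for f u
      unfolding spectral_measure_eq by (rule NI[OF that])
  qed
qed

lemma fun_calc_Q:
  assumes f: "admissible f"
  shows "fun_calc UNIV Q f = limcalc f"
proof -
  obtain E where E: "resolved_operator UNIV Q E"
    "\<And>f u. admissible f \<Longrightarrow> (\<integral>x. f x \<partial>spectral_measure E u) = inner u (limcalc f u)"
    using Q_resolution by blast
  show ?thesis
    by (rule fun_calc_eq[OF E(1) bounded_selfadjointD(1)[OF limcalc_selfadjoint[OF f]]])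
      (simp add: E(2)[OF f] cinner_selfadjoint[OF limcalc_selfadjoint[OF f]])
qed

lemma fun_calc_tendsto:
  assumes f: "continuous_on UNIV f" "bounded (range f)"
  shows "((\<lambda>t. fun_calc (heis_dom J t) (\<lambda>u. (1 / t) *\<^sub>R heis_op J t u) f \<psi>) \<longlongrightarrow> fun_calc UNIV Q f \<psi>) at_top"
proof -
  obtain C where C: "\<And>x. \<bar>f x\<bar> \<le> C" using f(2) by (auto simp: bounded_iff)
  have adm: "admissible f" using f(1) C by (auto simp: admissible_def)
  have "\<forall>\<^sub>F t in at_top. fc (\<lambda>x. of_real (f x)) t \<psi> = fun_calc (heis_dom J t) (\<lambda>u. (1 / t) *\<^sub>R heis_op J t u) f \<psi>"
    using eventually_gt_at_top[of 0] by eventually_elim (simp add: fun_calc_heis[OF _ f(1) C])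
  from Lim_transform_eventually[OF limcalc_tendsto[OF adm] this] show ?thesis
    by (simp add: fun_calc_Q[OF adm])
qed

end

theorem theorem1p6:
  fixes a b :: "int \<Rightarrow> complex ^ 'm ^ 'm::finite" and q :: nat and J :: "'m l2 \<Rightarrow> 'm l2"
  assumes "q \<ge> 1"
    and "block_jacobi_coeffs a b"
    and "periodic_coeffs q a b"
    and "J = jacobi a b"
  shows "(\<exists>Q :: 'm l2 \<Rightarrow> 'm l2.
            bounded_selfadjoint Q \<and> {u. Q u = 0} = {0} \<and>
            (\<forall>\<psi>\<in>pos_dom.
               (\<forall>t. \<psi> \<in> heis_dom J t) \<and>
               ((\<lambda>t. (1 / t) *\<^sub>R heis_op J t \<psi>) \<longlongrightarrow> Q \<psi>) at_top) \<and>
            (\<forall>f :: real \<Rightarrow> real. continuous_on UNIV f \<and> bounded (range f) \<longrightarrow>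
               (\<forall>\<psi>. ((\<lambda>t. fun_calc (heis_dom J t) (\<lambda>u. (1 / t) *\<^sub>R heis_op J t u) f \<psi>)
                        \<longlongrightarrow> fun_calc UNIV Q f \<psi>) at_top)))
       \<and> (\<forall>\<psi> p. \<psi> \<noteq> 0 \<and> exp_decaying \<psi> \<and> p > 0 \<longrightarrow>
            beta_upper J \<psi> p = 1 \<and> beta_lower J \<psi> p = 1)"
proof -
  interpret periodic_jacobi a b q by unfold_locales (fact assms)+
  show ?thesis
    unfolding \<open>J = jacobi a b\<close>
  proof (intro conjI exI[of _ Q] ballI allI impI)
    show "{u. Q u = 0} = {0}" using Q_injective by (auto simp: linear_simps[OF linear_Q])
    show "\<psi> \<in> heis_dom (jacobi a b) t" if "\<psi> \<in> pos_dom" for \<psi> t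
      using U_pos_dom[OF that] by (simp add: heis_dom_def)
  qed (use Q_selfadjoint heis_Q fun_calc_tendsto transport_exponents in blast)+
qed

end
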